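(* Let $n\ge 1$ be an integer and $C$ a constant. For each $m\in\mathbb{N}$ let $N_m\ge 1$ be an integer and let $[u_1(m),\ldots,u_n(m)]$ be an $n$-tuple of unitary $N_m\times N_m$ complex matrices. Suppose that $$\sup_{m\neq m'}\left\|\sum_{i=1}^n u_i(m)\otimes\overline{u_i(m')}\right\|_{\min}\le C,$$ and that $[u_1(m),\ldots,u_n(m)]$ converges in distribution when $m\to\infty$. Let $\mathbb{N}=\alpha\cup\beta$ be any disjoint partition of $\mathbb{N}$ into two infinite subsets, let $$u_i(\alpha)=\bigoplus_{m\in\alpha}u_i(m)\in\bigoplus_{m\in\alpha}M_{N_m},\qquad u_i(\beta)=\bigoplus_{m'\in\beta}u_i(m')\in\bigoplus_{m'\in\beta}M_{N_{m'}}\qquad(1\le i\le n),$$ and let $$t=\sum_{i=1}^n u_i(\alpha)\otimes\overline{u_i(\beta)}\in\Big(\bigoplus_{m\in\alpha}M_{N_m}\Big)\otimes\overline{\Big(\bigoplus_{m\in\beta}M_{N_m}\Big)}.$$ Then $$\|t\|_{\min}\le C\quad\text{and}\quad\|t\|_{\max}=n,$$ hence $\|t\|_{\max}/\|t\|_{\min}\ge n/C$, where the min and max norms are relative to $\big(\bigoplus_{m\in\alpha}M_{N_m}\big)\otimes\overline{\big(\bigoplus_{m\in\beta}M_{N_m}\big)}$.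
   Context: $M_N$ denotes the $C^*$-algebra of $N\times N$ complex matrices. For an infinite set $\gamma\subset\mathbb{N}$, $\bigoplus_{m\in\gamma}M_{N_m}$ denotes the von Neumann algebra direct sum, i.e. the algebra of all bounded families $(y_m)_{m\in\gamma}$ with $y_m\in M_{N_m}$, with coordinatewise operations and norm $\sup_m\|y_m\|$; $\bigoplus_{m\in\gamma}u_i(m)$ denotes the family $(u_i(m))_{m\in\gamma}$. For $C^*$-algebras $A,B$, $A\otimes B$ denotes their algebraic tensor product, and $\|\cdot\|_{\min}$ and $\|\cdot\|_{\max}$ are the minimal and maximal $C^*$-norms on $A\otimes B$. For a $C^*$-algebra $B$, the conjugate $C^*$-algebra $\overline{B}$ is the same object (same addition, product, involution and norm) but with complex scalar multiplication changed to $(\lambda,b)\mapsto\bar\lambda b$; for $b\in B$, $\bar b$ (or $\overline{b}$) denotes the same element viewed as an element of $\overline{B}$. For a matrix $a\in M_N$, $\bar a$ may be taken to be the usual entrywise complex conjugate, $(\bar a)_{ij}=\overline{a_{ij}}$, via the identification $\overline{M_N}\simeq M_N$; thus in the supremum hypothesis the min norm is the usual operator norm on $M_{N_m}\otimes M_{N_{m'}}\simeq M_{N_mN_{m'}}$. Convergence in distribution: let $S$ be the disjoint union over $k$ of the sets $S_k=[1,\ldots,n]^k\times\{1,*\}^k$, where $[1,\ldots,n]=\{1,\ldots,n\}$. For $w=((i_1,\ldots,i_k),(\varepsilon_1,\ldots,\varepsilon_k))\in S_k$ and an $n$-tuple $x=(x_1,\ldots,x_n)$ of elements of a von Neumann algebra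 $M$ with tracial state $\tau$, put $w(x)=x_{i_1}^{\varepsilon_1}x_{i_2}^{\varepsilon_2}\cdots x_{i_k}^{\varepsilon_k}$ (where $y^{\varepsilon}=y$ if $\varepsilon=1$ and $y^{\varepsilon}=y^*$ if $\varepsilon=*$). The distribution of $x$ is the function $\mu_x:S\to\mathbb{C}$, $\mu_x(w)=\tau(w(x))$. For $n$-tuples of matrices in $M_{N_m}$, $\tau=\tau_m$ is the normalized trace on $M_{N_m}$. The sequence $[u_1(m),\ldots,u_n(m)]$ converges in distribution when $m\to\infty$ if the distributions of these $n$-tuples converge pointwise on $S$, i.e. $\lim_{m\to\infty}\tau_m\big(w(u_1(m),\ldots,u_n(m))\big)$ exists for every $w\in S$. *)

theory Defs
  imports
    Complex_Main
    "HOL-Library.Multiset"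
    "HOL-Library.FuncSet"
    "HOL-Algebra.Module"
    "Jordan_Normal_Form.Matrix"
    "Jordan_Normal_Form.Schur_Decomposition"
begin

(* both names would otherwise shadow the record fields of HOL-Algebra *)
hide_const (open) Multiset.mult Polynomial.smult

section \<open>Unital complex star-algebras and C*-norms\<close>

record 'a star_alg = "(complex, 'a) module" +
  star :: "'a \<Rightarrow> 'a"

record 'a normed_star_alg = "'a star_alg" +
  nrm :: "'a \<Rightarrow> real"

text \<open>Completeness is not part of this notion: a C*-norm on an algebraic tensor product
  is in general not complete. The equation \<open>p (star x) = p x\<close> follows from the last clause and
  submultiplicativity.\<close>

definition cstar_norm :: "('a, 'm) star_alg_scheme \<Rightarrow> ('a \<Rightarrow> real) \<Rightarrow> bool" where
  "cstar_norm T p \<longleftrightarrow>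
     (\<forall>x\<in>carrier T. p x \<ge> 0 \<and> (p x = 0 \<longleftrightarrow> x = \<zero>\<^bsub>T\<^esub>)) \<and>
     (\<forall>x\<in>carrier T. \<forall>y\<in>carrier T. p (x \<oplus>\<^bsub>T\<^esub> y) \<le> p x + p y) \<and>
     (\<forall>c. \<forall>x\<in>carrier T. p (c \<odot>\<^bsub>T\<^esub> x) = cmod c * p x) \<and>
     (\<forall>x\<in>carrier T. \<forall>y\<in>carrier T. p (x \<otimes>\<^bsub>T\<^esub> y) \<le> p x * p y) \<and>
     (\<forall>x\<in>carrier T. p (star T x \<otimes>\<^bsub>T\<^esub> x) = (p x)\<^sup>2)"

definition unitary :: "('a, 'm) star_alg_scheme \<Rightarrow> 'a \<Rightarrow> bool" where
  "unitary A u \<longleftrightarrow> u \<in> carrier A \<and> star A u \<otimes>\<^bsub>A\<^esub> u = \<one>\<^bsub>A\<^esub> \<and> u \<otimes>\<^bsub>A\<^esub> star A u = \<one>\<^bsub>A\<^esub>"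

text \<open>The conjugate algebra has the same elements, so \<open>b\<close> itself represents the element
  written with a bar over \<open>b\<close>.\<close>

definition conj_alg :: "('a, 'm) star_alg_scheme \<Rightarrow> ('a, 'm) star_alg_scheme" where
  "conj_alg B = B\<lparr>smult := \<lambda>c b. cnj c \<odot>\<^bsub>B\<^esub> b\<rparr>"

section \<open>Matrix algebras and bounded direct sums\<close>

definition vec_norm2 :: "complex vec \<Rightarrow> real" where
  "vec_norm2 v = sqrt (\<Sum>i<dim_vec v. (cmod (v $ i))\<^sup>2)"

definition op_norm :: "complex mat \<Rightarrow> real" where
  "op_norm A = (SUP v\<in>{v \<in> carrier_vec (dim_col A). vec_norm2 v \<le> 1}. vec_norm2 (A *\<^sub>v v))"

definition matrix_alg :: "nat \<Rightarrow> complex mat normed_star_alg" where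
  "matrix_alg N = \<lparr>
     carrier = carrier_mat N N,
     mult = (*),
     one = 1\<^sub>m N,
     zero = 0\<^sub>m N N,
     add = (+),
     smult = (\<cdot>\<^sub>m),
     star = mat_adjoint,
     nrm = op_norm\<rparr>"

definition kronecker :: "complex mat \<Rightarrow> complex mat \<Rightarrow> complex mat" where
  "kronecker A B = Matrix.mat (dim_row A * dim_row B) (dim_col A * dim_col B)
     (\<lambda>(i, j). A $$ (i div dim_row B, j div dim_col B) * B $$ (i mod dim_row B, j mod dim_col B))"

definition normalized_trace :: "nat \<Rightarrow> complex mat \<Rightarrow> complex" where
  "normalized_trace N A = (\<Sum>i<N. A $$ (i, i)) / of_nat N"

definition bounded_sum :: "'i set \<Rightarrow> ('i \<Rightarrow> 'a normed_star_alg) \<Rightarrow> ('i \<Rightarrow> 'a) normed_star_alg" where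
  "bounded_sum I M = \<lparr>
     carrier = {y \<in> (\<Pi>\<^sub>E m\<in>I. carrier (M m)). bdd_above ((\<lambda>m. nrm (M m) (y m)) ` I)},
     mult = (\<lambda>x y. \<lambda>m\<in>I. x m \<otimes>\<^bsub>M m\<^esub> y m),
     one = (\<lambda>m\<in>I. \<one>\<^bsub>M m\<^esub>),
     zero = (\<lambda>m\<in>I. \<zero>\<^bsub>M m\<^esub>),
     add = (\<lambda>x y. \<lambda>m\<in>I. x m \<oplus>\<^bsub>M m\<^esub> y m),
     smult = (\<lambda>c x. \<lambda>m\<in>I. c \<odot>\<^bsub>M m\<^esub> x m),
     star = (\<lambda>x. \<lambda>m\<in>I. star (M m) (x m)),
     nrm = (\<lambda>x. SUP m\<in>I. nrm (M m) (x m))\<rparr>"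

section \<open>The algebraic tensor product\<close>

text \<open>A finite multiset \<open>{#(a\<^sub>1, b\<^sub>1), \<dots>, (a\<^sub>k, b\<^sub>k)#}\<close> stands for the formal sum of the
  \<open>a\<^sub>j \<otimes> b\<^sub>j\<close>. The tensor product consists of the classes of formal sums modulo the congruence
  generated by bilinearity. No formal scalar coefficients are needed, since \<open>c (a \<otimes> b)\<close> is
  \<open>(c a) \<otimes> b\<close>; and \<open>0 \<otimes> b = 0\<close> must be imposed, because formal sums only form a monoid.\<close>

definition formal_sums ::
  "('a, 'm) star_alg_scheme \<Rightarrow> ('b, 'n) star_alg_scheme \<Rightarrow> ('a \<times> 'b) multiset set" where
  "formal_sums A B = {s. set_mset s \<subseteq> carrier A \<times> carrier B}"

inductive tensor_eq ::
  "('a, 'm) star_alg_scheme \<Rightarrow> ('b, 'n) star_alg_scheme \<Rightarrow>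
   ('a \<times> 'b) multiset \<Rightarrow> ('a \<times> 'b) multiset \<Rightarrow> bool" for A B where
  refl: "s \<in> formal_sums A B \<Longrightarrow> tensor_eq A B s s"
| sym: "tensor_eq A B s s' \<Longrightarrow> tensor_eq A B s' s"
| trans: "tensor_eq A B s s' \<Longrightarrow> tensor_eq A B s' s'' \<Longrightarrow> tensor_eq A B s s''"
| plus: "tensor_eq A B s s' \<Longrightarrow> tensor_eq A B r r' \<Longrightarrow> tensor_eq A B (s + r) (s' + r')"
| add_left: "a \<in> carrier A \<Longrightarrow> a' \<in> carrier A \<Longrightarrow> b \<in> carrier B \<Longrightarrow>
    tensor_eq A B {#(a \<oplus>\<^bsub>A\<^esub> a', b)#} {#(a, b), (a', b)#}"
| add_right: "a \<in> carrier A \<Longrightarrow> b \<in> carrier B \<Longrightarrow> b' \<in> carrier B \<Longrightarrow>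
    tensor_eq A B {#(a, b \<oplus>\<^bsub>B\<^esub> b')#} {#(a, b), (a, b')#}"
| scale: "a \<in> carrier A \<Longrightarrow> b \<in> carrier B \<Longrightarrow>
    tensor_eq A B {#(c \<odot>\<^bsub>A\<^esub> a, b)#} {#(a, c \<odot>\<^bsub>B\<^esub> b)#}"
| zero: "b \<in> carrier B \<Longrightarrow> tensor_eq A B {#(\<zero>\<^bsub>A\<^esub>, b)#} {#}"

definition tensor_rel ::
  "('a, 'm) star_alg_scheme \<Rightarrow> ('b, 'n) star_alg_scheme \<Rightarrow>
   (('a \<times> 'b) multiset \<times> ('a \<times> 'b) multiset) set" where
  "tensor_rel A B = {(s, s'). tensor_eq A B s s'}"

definition tensor_class ::
  "('a, 'm) star_alg_scheme \<Rightarrow> ('b, 'n) star_alg_scheme \<Rightarrow>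
   ('a \<times> 'b) multiset \<Rightarrow> ('a \<times> 'b) multiset set" where
  "tensor_class A B s = tensor_rel A B `` {s}"

definition pure_tensor ::
  "('a, 'm) star_alg_scheme \<Rightarrow> ('b, 'n) star_alg_scheme \<Rightarrow>
   'a \<Rightarrow> 'b \<Rightarrow> ('a \<times> 'b) multiset set" where
  "pure_tensor A B a b = tensor_class A B {#(a, b)#}"

definition tensor_alg ::
  "('a, 'm) star_alg_scheme \<Rightarrow> ('b, 'n) star_alg_scheme \<Rightarrow>
   (('a \<times> 'b) multiset set) star_alg" where
  "tensor_alg A B = \<lparr>
     carrier = formal_sums A B // tensor_rel A B,
     mult = (\<lambda>X Y. \<Union>s\<in>X. \<Union>r\<in>Y. tensor_class A B
        (\<Sum>(a, b)\<in>#s. image_mset (\<lambda>(a', b'). (a \<otimes>\<^bsub>A\<^esub> a', b \<otimes>\<^bsub>B\<^esub> b')) r)),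
     one = pure_tensor A B \<one>\<^bsub>A\<^esub> \<one>\<^bsub>B\<^esub>,
     zero = tensor_class A B {#},
     add = (\<lambda>X Y. \<Union>s\<in>X. \<Union>r\<in>Y. tensor_class A B (s + r)),
     smult = (\<lambda>c X. \<Union>s\<in>X. tensor_class A B (image_mset (\<lambda>(a, b). (c \<odot>\<^bsub>A\<^esub> a, b)) s)),
     star = (\<lambda>X. \<Union>s\<in>X. tensor_class A B (image_mset (\<lambda>(a, b). (star A a, star B b)) s))\<rparr>"

text \<open>The least and the greatest C*-norm on the algebraic tensor product, in the pointwise
  order. For C*-algebras both exist, hence they are given by the pointwise infimum and supremum
  over all C*-norms; the supremum is finite since \<open>p (a \<otimes> b)\<close> is at most the product of the
  norms of \<open>a\<close> and \<open>b\<close> for every C*-norm \<open>p\<close>.\<close>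

definition min_tensor_norm ::
  "('a, 'm) star_alg_scheme \<Rightarrow> ('b, 'n) star_alg_scheme \<Rightarrow> ('a \<times> 'b) multiset set \<Rightarrow> real" where
  "min_tensor_norm A B x = (INF p\<in>{p. cstar_norm (tensor_alg A B) p}. p x)"

definition max_tensor_norm ::
  "('a, 'm) star_alg_scheme \<Rightarrow> ('b, 'n) star_alg_scheme \<Rightarrow> ('a \<times> 'b) multiset set \<Rightarrow> real" where
  "max_tensor_norm A B x = (SUP p\<in>{p. cstar_norm (tensor_alg A B) p}. p x)"

lemma min_tensor_norm_eq_least:
  assumes "cstar_norm (tensor_alg A B) p"
    and "\<And>q. cstar_norm (tensor_alg A B) q \<Longrightarrow> p x \<le> q x"
  shows "min_tensor_norm A B x = p x"
  unfolding min_tensor_norm_def using assms by (intro cInf_eq_minimum) auto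

lemma max_tensor_norm_eq_greatest:
  assumes "cstar_norm (tensor_alg A B) p"
    and "\<And>q. cstar_norm (tensor_alg A B) q \<Longrightarrow> q x \<le> p x"
  shows "max_tensor_norm A B x = p x"
  unfolding max_tensor_norm_def using assms by (intro cSup_eq_maximum) auto

section \<open>Distributions\<close>

text \<open>A word is a list of pairs \<open>(i, e)\<close>; the flag \<open>e = True\<close> marks the adjoint of \<open>x i\<close>.\<close>

definition words :: "nat \<Rightarrow> (nat \<times> bool) list set" where
  "words n = lists ({1..n} \<times> UNIV)"

definition eval_word ::
  "('a, 'm) star_alg_scheme \<Rightarrow> (nat \<Rightarrow> 'a) \<Rightarrow> (nat \<times> bool) list \<Rightarrow> 'a" where
  "eval_word A x w =
     foldr (\<lambda>(i, e) y. (if e then star A (x i) else x i) \<otimes>\<^bsub>A\<^esub> y) w \<one>\<^bsub>A\<^esub>"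

definition distribution ::
  "('a, 'm) star_alg_scheme \<Rightarrow> ('a \<Rightarrow> complex) \<Rightarrow> (nat \<Rightarrow> 'a) \<Rightarrow> (nat \<times> bool) list \<Rightarrow> complex"
  where
  "distribution A \<tau> x w = \<tau> (eval_word A x w)"

definition converges_in_distribution ::
  "nat \<Rightarrow> (nat \<Rightarrow> nat) \<Rightarrow> (nat \<Rightarrow> nat \<Rightarrow> complex mat) \<Rightarrow> bool" where
  "converges_in_distribution n N u \<longleftrightarrow>
     (\<forall>w\<in>words n. convergent
        (\<lambda>m. distribution (matrix_alg (N m)) (normalized_trace (N m)) (\<lambda>i. u i m) w))"

end

theory Submission
  imports Defs
begin

text \<open>The estimate \<open>\<parallel>t\<parallel>\<^sub>m\<^sub>i\<^sub>n \<le> C\<close> holds because the spatial norm, the supremum of the operator norms of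
the images in \<open>M\<^bsub>N m\<^esub> \<otimes> M\<^bsub>N m'\<^esub>\<close> over \<open>m \<in> \<alpha>\<close> and \<open>m' \<in> \<beta>\<close>, is a C*-norm
(\<open>spatial_norm\<close>), and disjointness of \<open>\<alpha>\<close> and \<open>\<beta>\<close> forces \<open>m \<noteq> m'\<close> in all of these images. The
estimate \<open>\<parallel>t\<parallel>\<^sub>m\<^sub>a\<^sub>x \<le> n\<close> holds because \<open>t\<close> is a sum of \<open>n\<close> unitaries.

For \<open>\<parallel>t\<parallel>\<^sub>m\<^sub>a\<^sub>x \<ge> n\<close> it suffices to find a representation of the tensor product with a unit vector fixed
by every summand of \<open>t\<close>. Limits of the normalized traces along ultrafilters concentrated on \<open>\<alpha>\<close>
and on \<open>\<beta>\<close> give two tracial states, and convergence in distribution says that they agree on the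
algebra \<open>W\<close> of noncommutative polynomials in the unitaries. Hence the two \<open>L\<^sup>2\<close>-closures of \<open>W\<close> are
the same Hilbert space \<open>H\<close>. With \<open>P\<close> the orthogonal projection of the second \<open>L\<^sup>2\<close>-space onto \<open>H\<close>,
put \<open>pair a b = \<langle>a, P b\<rangle>\<close>, the inner product being that of the first \<open>L\<^sup>2\<close>-space. The induced linear
functional \<open>F\<close> on the tensor product takes the value \<open>1\<close> at the unit, and \<open>F(t\<^sup>* t) = n\<^sup>2\<close> because
\<open>pair w w = 1\<close> for every unitary \<open>w\<close> in \<open>W\<close>. If \<open>F\<close> is positive, its GNS representation has the
desired vector (\<open>gns_norm_ts\<close>), and the maximum of the GNS seminorm and the spatial norm is a C*-norm.

The heart of the matter is the positivity of \<open>F\<close> (\<open>kernel_positivity\<close>). Left multiplication by a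
positive matrix over the first algebra and right multiplication by a positive matrix over the
second one, both compressed to \<open>H\<close>, are positive operators that commute, and a product of commuting
positive operators is positive. Two devices make this elementary. No square root is taken: if \<open>Q\<close>
is a bounded positive form and \<open>S\<close> a contraction that is symmetric for \<open>Q\<close>, then the numbers
\<open>h\<^sub>j = Q(S\<^sup>j \<zeta>, \<zeta>)\<close> are bounded and satisfy \<open>h\<^sub>j\<^sup>2 \<le> h\<^sub>2\<^sub>j h\<^sub>0\<close>, which forces \<open>h\<^sub>1 \<le> h\<^sub>0\<close>; with \<open>S = 1 - T\<close> this
is \<open>Q(T \<zeta>, \<zeta>) \<ge> 0\<close>. And \<open>H\<close> is never constructed: a vector of \<open>H\<close> is replaced by polynomials that
approximate it to within \<open>1/(n+1)\<close>, and the numbers \<open>h\<^sub>j\<close> appear as limits along an ultrafilter.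

The quotient estimate also needs \<open>\<parallel>t\<parallel>\<^sub>m\<^sub>i\<^sub>n > 0\<close>. This holds because every C*-norm dominates the
absolute value of each matrix entry of the images in \<open>M\<^bsub>N m\<^esub> \<otimes> M\<^bsub>N m'\<^esub>\<close>
(\<open>entry_le_cstar_norm\<close>), and not all of these entries vanish at \<open>t\<close>.\<close>

section \<open>Limits along ultrafilters\<close>

definition ultra :: "'a filter \<Rightarrow> bool" where
  "ultra U \<longleftrightarrow> U \<noteq> bot \<and> (\<forall>P. eventually P U \<or> eventually (\<lambda>x. \<not> P x) U)"

text \<open>Zorn's lemma for the reversed order of filters: the infimum of a chain of proper filters is proper,
because an event holds eventually in it only if it does so in some member of the chain.\<close>

lemma ultra_exists:
  assumes "F \<noteq> bot"
  shows "\<exists>U\<le>F. ultra U"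
proof -
  let ?A = "{G. G \<le> F \<and> G \<noteq> bot}"
  let ?P = "\<lambda>G H :: 'a filter. H \<le> G"
  have "\<exists>m\<in>?A. \<forall>a\<in>?A. ?P m a \<longrightarrow> a = m"
  proof (rule predicate_Zorn)
    show "partial_order_on ?A (relation_of ?P ?A)"
      by (rule partial_order_on_relation_ofI) auto
  next
    fix C assume C: "C \<in> Chains (relation_of ?P ?A)"
    then have sub: "C \<subseteq> ?A" and ch: "\<And>G H. G \<in> C \<Longrightarrow> H \<in> C \<Longrightarrow> G \<le> H \<or> H \<le> G"
      by (auto simp: Chains_def relation_of_def)
    show "\<exists>u\<in>?A. \<forall>a\<in>C. ?P a u"
    proof (cases "C = {}")
      case True
      then show ?thesis using assms by auto
    next
      case False
      have "\<not> eventually (\<lambda>_. False) (Inf C)"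
      proof
        assume "eventually (\<lambda>_. False) (Inf C)"
        then obtain b where "b \<in> C" "eventually (\<lambda>_. False) b"
          using eventually_Inf_base[OF False] ch by (metis inf.absorb1 inf.absorb2 order_refl)
        then show False using sub by (auto simp: trivial_limit_def)
      qed
      then have "Inf C \<noteq> bot" by (auto simp: trivial_limit_def)
      moreover have "Inf C \<le> F"
      proof -
        obtain c where "c \<in> C" using False by blast
        then show ?thesis using sub by (blast intro: Inf_lower2)
      qed
      ultimately show ?thesis by (auto intro!: bexI[of _ "Inf C"] Inf_lower)
    qed
  qed
  then obtain U where U: "U \<le> F" "U \<noteq> bot" and mx: "\<And>G. G \<le> F \<Longrightarrow> G \<noteq> bot \<Longrightarrow> G \<le> U \<Longrightarrow> G = U"
    by auto
  have "eventually P U \<or> eventually (\<lambda>x. \<not> P x) U" for P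
  proof (rule disjCI)
    assume n: "\<not> eventually (\<lambda>x. \<not> P x) U"
    let ?G = "inf U (principal {x. P x})"
    have "?G \<noteq> bot" using n
      by (auto simp: trivial_limit_def eventually_inf_principal)
    moreover have "?G \<le> U" by simp
    moreover have "?G \<le> F" using U by (meson \<open>?G \<le> U\<close> order_trans)
    ultimately have "?G = U" using mx by blast
    then show "eventually P U"
      using eventually_inf_principal[of P U "{x. P x}"] by simp
  qed
  then show ?thesis using U by (auto simp: ultra_def)
qed

lemma ultra_tendsto_real:
  fixes f :: "'a \<Rightarrow> real"
  assumes U: "ultra U" and B: "\<And>x. \<bar>f x\<bar> \<le> B"
  shows "\<exists>l. (f \<longlongrightarrow> l) U"
proof -
  let ?S = "{r. eventually (\<lambda>x. r \<le> f x) U}"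
  have nb: "U \<noteq> bot" using U by (simp add: ultra_def)
  have up: "r \<le> B" if "r \<in> ?S" for r
  proof -
    have "eventually (\<lambda>x. r \<le> f x) U" using that by simp
    then obtain x where "r \<le> f x" using nb by (metis eventually_happens trivial_limit_def)
    then show ?thesis using B[of x] by linarith
  qed
  have lo: "- B \<in> ?S"
    using B by (auto intro!: always_eventually simp: abs_le_iff minus_le_iff)
  have bdd: "bdd_above ?S" using up by (meson bdd_aboveI)
  have "(f \<longlongrightarrow> Sup ?S) U"
  proof (rule order_tendstoI)
    fix y assume "y < Sup ?S"
    then obtain r where "r \<in> ?S" "y < r" using lo bdd by (metis empty_iff less_cSup_iff)
    then show "eventually (\<lambda>x. y < f x) U" by (auto elim!: eventually_mono)
  next
    fix y assume y: "Sup ?S < y"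
    have "\<not> eventually (\<lambda>x. y \<le> f x) U"
      using y cSup_upper[OF _ bdd, of y] by auto
    then have "eventually (\<lambda>x. \<not> y \<le> f x) U" using U unfolding ultra_def by blast
    then show "eventually (\<lambda>x. f x < y) U" by (auto elim!: eventually_mono)
  qed
  then show ?thesis by blast
qed

lemma ultra_tendsto_Lim:
  fixes f :: "'a \<Rightarrow> complex"
  assumes U: "ultra U" and B: "\<And>x. cmod (f x) \<le> B"
  shows "(f \<longlongrightarrow> Lim U f) U"
proof -
  obtain a where a: "((\<lambda>x. Re (f x)) \<longlongrightarrow> a) U"
    using ultra_tendsto_real[OF U, of "\<lambda>x. Re (f x)" B] B abs_Re_le_cmod order_trans by blast
  obtain b where b: "((\<lambda>x. Im (f x)) \<longlongrightarrow> b) U"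
    using ultra_tendsto_real[OF U, of "\<lambda>x. Im (f x)" B] B abs_Im_le_cmod order_trans by blast
  have "(f \<longlongrightarrow> Complex a b) U" using tendsto_Complex[OF a b] by simp
  then show ?thesis using U by (metis tendsto_Lim ultra_def)
qed

section \<open>Positive sesquilinear forms\<close>

text \<open>A semi-inner product space is described by its vectors and the operation \<open>v + z w\<close> alone. The same
lemmas then serve for ring elements, arrays of ring elements, coordinate vectors and formal sums,
the last of which have no subtraction.\<close>

locale pos_form =
  fixes V :: "'v set" and comb :: "'v \<Rightarrow> complex \<Rightarrow> 'v \<Rightarrow> 'v" and B :: "'v \<Rightarrow> 'v \<Rightarrow> complex"
  assumes comb_closed: "v \<in> V \<Longrightarrow> w \<in> V \<Longrightarrow> comb v z w \<in> V"
    and comb_left: "v \<in> V \<Longrightarrow> w \<in> V \<Longrightarrow> x \<in> V \<Longrightarrow> B (comb v z w) x = B v x + z * B w x"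
    and herm: "v \<in> V \<Longrightarrow> w \<in> V \<Longrightarrow> B w v = cnj (B v w)"
    and pos: "v \<in> V \<Longrightarrow> 0 \<le> Re (B v v)"
begin

definition nrm :: "'v \<Rightarrow> real" where "nrm v = sqrt (Re (B v v))"

lemma nrm_nonneg [simp]: "v \<in> V \<Longrightarrow> 0 \<le> nrm v"
  by (simp add: nrm_def pos)

lemma nrm_sq: "v \<in> V \<Longrightarrow> (nrm v)\<^sup>2 = Re (B v v)"
  by (simp add: nrm_def pos)

lemma B_self: "v \<in> V \<Longrightarrow> B v v = complex_of_real ((nrm v)\<^sup>2)"
proof -
  assume v: "v \<in> V"
  have "Im (B v v) = 0" using herm[OF v v] by (metis Im_complex_of_real Reals_cnj_iff complex_is_Real_iff)
  then show ?thesis using nrm_sq[OF v] by (simp add: complex_eq_iff)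
qed

lemma comb_right:
  "v \<in> V \<Longrightarrow> w \<in> V \<Longrightarrow> x \<in> V \<Longrightarrow> B x (comb v z w) = B x v + cnj z * B x w"
  using herm[of "comb v z w" x] herm[of v x] herm[of w x] comb_left[of v w x z] comb_closed[of v w z]
  by simp

lemma nrm_comb_sq:
  assumes "v \<in> V" "w \<in> V"
  shows "(nrm (comb v z w))\<^sup>2 = (nrm v)\<^sup>2 + 2 * Re (cnj z * B v w) + (cmod z)\<^sup>2 * (nrm w)\<^sup>2"
proof -
  have c: "comb v z w \<in> V" using assms comb_closed by blast
  have wv: "B w v = cnj (B v w)" using herm assms by blast
  have zz: "z * cnj z = complex_of_real ((cmod z)\<^sup>2)" by (metis complex_norm_square)
  have "B (comb v z w) (comb v z w)
      = B v v + (cnj z * B v w + cnj (cnj z * B v w)) + (z * cnj z) * B w w"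
    using assms c by (simp add: comb_left comb_right wv algebra_simps)
  then show ?thesis unfolding nrm_sq[OF c] nrm_sq[OF assms(1)] zz
    by (simp add: B_self[OF assms(2)] nrm_sq[OF assms(1)])
qed

lemma Cauchy_Schwarz:
  assumes v: "v \<in> V" and w: "w \<in> V"
  shows "cmod (B v w) \<le> nrm v * nrm w"
proof -
  define c where "c = B v w"
  have ineq: "0 \<le> (nrm v)\<^sup>2 - 2 * r * (cmod c)\<^sup>2 + r\<^sup>2 * (cmod c)\<^sup>2 * (nrm w)\<^sup>2" for r :: real
  proof -
    have "Re (cnj c * c) = (cmod c)\<^sup>2" by (simp add: cmod_power2 flip: power2_eq_square)
    then have "Re (cnj (- complex_of_real r * c) * B v w) = - r * (cmod c)\<^sup>2"
      unfolding c_def[symmetric] by (simp add: mult.assoc)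
    moreover have "(cmod (- complex_of_real r * c))\<^sup>2 = r\<^sup>2 * (cmod c)\<^sup>2"
      by (simp add: norm_mult power_mult_distrib)
    ultimately have "(nrm (comb v (- complex_of_real r * c) w))\<^sup>2
        = (nrm v)\<^sup>2 + 2 * (- r * (cmod c)\<^sup>2) + r\<^sup>2 * (cmod c)\<^sup>2 * (nrm w)\<^sup>2"
      by (simp only: nrm_comb_sq[OF v w])
    moreover have "0 \<le> (nrm (comb v (- complex_of_real r * c) w))\<^sup>2" by simp
    ultimately show ?thesis by linarith
  qed
  have "(cmod c)\<^sup>2 \<le> (nrm v)\<^sup>2 * (nrm w)\<^sup>2"
  proof (cases "nrm w = 0")
    case True
    have "cmod c = 0"
    proof (rule ccontr)
      assume "cmod c \<noteq> 0"
      then have p: "(cmod c)\<^sup>2 > 0" by simp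
      have "2 * (((nrm v)\<^sup>2 + 1) / (2 * (cmod c)\<^sup>2)) * (cmod c)\<^sup>2 = (nrm v)\<^sup>2 + 1"
        using p by (simp add: field_simps)
      with ineq[of "((nrm v)\<^sup>2 + 1) / (2 * (cmod c)\<^sup>2)"] True show False by simp
    qed
    then show ?thesis by simp
  next
    case False
    then have p: "(nrm w)\<^sup>2 > 0" by simp
    have "(1 / (nrm w)\<^sup>2)\<^sup>2 * (cmod c)\<^sup>2 * (nrm w)\<^sup>2 = 1 / (nrm w)\<^sup>2 * (cmod c)\<^sup>2"
      using p by (simp add: field_simps power2_eq_square)
    with ineq[of "1 / (nrm w)\<^sup>2"] have "1 / (nrm w)\<^sup>2 * (cmod c)\<^sup>2 \<le> (nrm v)\<^sup>2" by linarith
    then show ?thesis using p by (simp add: field_simps)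
  qed
  then have "(cmod c)\<^sup>2 \<le> (nrm v * nrm w)\<^sup>2" by (simp add: power_mult_distrib)
  then show ?thesis unfolding c_def using v w by (rule_tac power2_le_imp_le) simp_all
qed

lemma nrm_comb:
  assumes v: "v \<in> V" and w: "w \<in> V"
  shows "nrm (comb v z w) \<le> nrm v + cmod z * nrm w"
proof -
  have "Re (cnj z * B v w) \<le> cmod (cnj z * B v w)" by (rule complex_Re_le_cmod)
  also have "\<dots> \<le> cmod z * (nrm v * nrm w)"
    using Cauchy_Schwarz[OF v w] by (simp add: norm_mult mult_left_mono)
  finally have "(nrm (comb v z w))\<^sup>2 \<le> (nrm v + cmod z * nrm w)\<^sup>2"
    unfolding nrm_comb_sq[OF v w] by (simp add: power2_sum power_mult_distrib algebra_simps)
  then show ?thesis using v w by (rule_tac power2_le_imp_le) simp_all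
qed

end

section \<open>Star-algebras with a tracial state\<close>

text \<open>The ring carries all sections of a family of matrix algebras, while \<open>M\<close> singles out the bounded
ones of a given size. Neither a unit nor boundedness is part of the ring, since both depend on the
sizes of the matrices.\<close>

locale star_ring =
  fixes scl :: "complex \<Rightarrow> 'x::ring \<Rightarrow> 'x" and adj :: "'x \<Rightarrow> 'x" and M :: "'x set"
  assumes scl_add_right: "scl c (x + y) = scl c x + scl c y"
    and scl_add_left: "scl (c + d) x = scl c x + scl d x"
    and scl_scl: "scl c (scl d x) = scl (c * d) x"
    and scl_one: "scl 1 x = x"
    and scl_mult_left: "scl c x * y = scl c (x * y)"
    and scl_mult_right: "x * scl c y = scl c (x * y)"
    and adj_add: "adj (x + y) = adj x + adj y"
    and adj_mult: "adj (x * y) = adj y * adj x"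
    and adj_scl: "adj (scl c x) = scl (cnj c) (adj x)"
    and adj_adj [simp]: "adj (adj x) = x"
    and M_add [simp]: "x \<in> M \<Longrightarrow> y \<in> M \<Longrightarrow> x + y \<in> M"
    and M_mult [simp]: "x \<in> M \<Longrightarrow> y \<in> M \<Longrightarrow> x * y \<in> M"
    and M_scl [simp]: "x \<in> M \<Longrightarrow> scl c x \<in> M"
    and M_adj [simp]: "x \<in> M \<Longrightarrow> adj x \<in> M"
    and M_zero [simp]: "0 \<in> M"
begin

lemma scl_zero_right [simp]: "scl c 0 = 0"
  using scl_add_right[of c 0 0] by simp

lemma scl_zero_left [simp]: "scl 0 x = 0"
  using scl_add_left[of 0 0 x] by simp

lemma scl_minus_one: "scl (- 1) x = - x"
  using scl_add_left[of "-1" 1 x] by (simp add: scl_one eq_neg_iff_add_eq_0)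

lemma adj_zero [simp]: "adj 0 = 0"
  using adj_add[of 0 0] by simp

lemma adj_sum: "adj (\<Sum>i\<in>I. g i) = (\<Sum>i\<in>I. adj (g i))"
  by (induction I rule: infinite_finite_induct) (auto simp: adj_add)

lemma scl_sum: "scl c (\<Sum>i\<in>I. g i) = (\<Sum>i\<in>I. scl c (g i))"
  by (induction I rule: infinite_finite_induct) (auto simp: scl_add_right)

lemma M_sum [simp]: "(\<And>i. i \<in> I \<Longrightarrow> g i \<in> M) \<Longrightarrow> (\<Sum>i\<in>I. g i) \<in> M"
  by (induction I rule: infinite_finite_induct) auto

lemma M_uminus [simp]: "x \<in> M \<Longrightarrow> - x \<in> M"
  using M_scl[of x "-1"] by (simp add: scl_minus_one)

lemma M_minus [simp]: "x \<in> M \<Longrightarrow> y \<in> M \<Longrightarrow> x - y \<in> M"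
  using M_add[of x "-y"] by simp

lemma adj_minus: "adj (x - y) = adj x - adj y"
  using adj_add[of "x - y" y] by (simp add: algebra_simps)

end

locale tracial = star_ring scl adj M for scl :: "complex \<Rightarrow> 'x::ring \<Rightarrow> 'x" and adj M +
  fixes tr :: "'x \<Rightarrow> complex"
  assumes tr_add: "x \<in> M \<Longrightarrow> y \<in> M \<Longrightarrow> tr (x + y) = tr x + tr y"
    and tr_scl: "x \<in> M \<Longrightarrow> tr (scl c x) = c * tr x"
    and tr_comm: "x \<in> M \<Longrightarrow> y \<in> M \<Longrightarrow> tr (x * y) = tr (y * x)"
    and tr_adj: "x \<in> M \<Longrightarrow> tr (adj x) = cnj (tr x)"
    and tr_pos: "x \<in> M \<Longrightarrow> 0 \<le> Re (tr (adj x * x))"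
    and tr_bdd: "a \<in> M \<Longrightarrow> \<exists>K\<ge>0. \<forall>y\<in>M.
        Re (tr (adj (a * y) * (a * y))) \<le> K\<^sup>2 * Re (tr (adj y * y))"
begin

lemma tr_zero [simp]: "tr 0 = 0"
  using tr_add[of 0 0] by simp

lemma tr_sum: "(\<And>i. i \<in> I \<Longrightarrow> g i \<in> M) \<Longrightarrow> tr (\<Sum>i\<in>I. g i) = (\<Sum>i\<in>I. tr (g i))"
  by (induction I rule: infinite_finite_induct) (auto simp: tr_add)

lemma tr_minus: "x \<in> M \<Longrightarrow> y \<in> M \<Longrightarrow> tr (x - y) = tr x - tr y"
  using tr_add[of "x - y" y] by simp

sublocale L2: pos_form M "\<lambda>v z w. v + scl z w" "\<lambda>x y. tr (adj y * x)"
proof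
  fix v w assume "v \<in> M" "w \<in> M"
  then show "tr (adj v * w) = cnj (tr (adj w * v))"
    by (subst tr_adj[symmetric]) (auto simp: adj_mult)
next
  fix v w x :: 'x and z assume "v \<in> M" "w \<in> M" "x \<in> M"
  then show "tr (adj x * (v + scl z w)) = tr (adj x * v) + z * tr (adj x * w)"
    by (simp add: distrib_left tr_add tr_scl scl_mult_right)
qed (simp_all add: tr_pos)

lemma left_bound:
  assumes "a \<in> M"
  shows "\<exists>K\<ge>0. \<forall>y\<in>M. L2.nrm (a * y) \<le> K * L2.nrm y"
proof -
  obtain K where K: "K \<ge> 0" "\<And>y. y \<in> M \<Longrightarrow>
      Re (tr (adj (a * y) * (a * y))) \<le> K\<^sup>2 * Re (tr (adj y * y))"
    using tr_bdd[OF assms] by blast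
  have "L2.nrm (a * y) \<le> K * L2.nrm y" if "y \<in> M" for y
  proof -
    have "sqrt (Re (tr (adj (a * y) * (a * y)))) \<le> sqrt (K\<^sup>2 * Re (tr (adj y * y)))"
      using K(2)[OF that] by (rule real_sqrt_le_mono)
    then show ?thesis using K(1) by (simp add: L2.nrm_def real_sqrt_mult)
  qed
  then show ?thesis using K(1) by blast
qed

lemma nrm_adj: "x \<in> M \<Longrightarrow> L2.nrm (adj x) = L2.nrm x"
  unfolding L2.nrm_def by (simp add: tr_comm[OF _ M_adj])


lemma gram_tr:
  fixes p \<xi> :: "nat \<Rightarrow> 'x"
  assumes "\<And>j. p j \<in> M" "\<And>j. \<xi> j \<in> M"
  shows "Re (\<Sum>j<k. \<Sum>l<k. tr (adj (\<xi> j) * ((adj (p j) * p l) * \<xi> l))) = (L2.nrm (\<Sum>l<k. p l * \<xi> l))\<^sup>2"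
proof -
  have "(\<Sum>j<k. \<Sum>l<k. tr (adj (\<xi> j) * ((adj (p j) * p l) * \<xi> l)))
      = tr (\<Sum>j<k. \<Sum>l<k. adj (\<xi> j) * ((adj (p j) * p l) * \<xi> l))"
    using assms by (simp add: tr_sum)
  also have "(\<Sum>j<k. \<Sum>l<k. adj (\<xi> j) * ((adj (p j) * p l) * \<xi> l))
    = adj (\<Sum>l<k. p l * \<xi> l) * (\<Sum>l<k. p l * \<xi> l)"
    by (simp add: adj_sum adj_mult sum_product mult.assoc)
  finally show ?thesis using assms by (simp add: L2.nrm_sq)
qed

text \<open>With \<open>z = \<Sum>\<^sub>l p\<^sub>l \<xi>\<^sub>l\<close> the form of this kernel at \<open>\<xi>\<close> is \<open>K\<^sup>2 \<parallel>z\<parallel>\<^sup>2 - \<parallel>c z\<parallel>\<^sup>2\<close>. The kernel stands in for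
\<open>p\<^sub>j\<^sup>* (K\<^sup>2 - c\<^sup>* c) p\<^sub>l\<close>, and no square root of \<open>K\<^sup>2 - c\<^sup>* c\<close> is needed to see that it is positive.\<close>

lemma diff_kernel:
  fixes p \<xi> :: "nat \<Rightarrow> 'x"
  assumes c: "c \<in> M" and K: "K \<ge> 0" "\<And>y. y \<in> M \<Longrightarrow> L2.nrm (c * y) \<le> K * L2.nrm y"
    and p: "\<And>j. p j \<in> M" and \<xi>: "\<And>j. \<xi> j \<in> M"
  shows "0 \<le> Re (\<Sum>j<k. \<Sum>l<k. tr (adj (\<xi> j) *
      ((scl (complex_of_real (K\<^sup>2)) (adj (p j) * p l) - adj (c * p j) * (c * p l)) * \<xi> l)))"
proof -
  let ?z = "\<Sum>l<k. p l * \<xi> l"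
  let ?r = "complex_of_real (K\<^sup>2)"
  have z: "?z \<in> M" using p \<xi> by simp
  have t: "tr (adj (\<xi> j) * ((scl ?r (adj (p j) * p l) - adj (c * p j) * (c * p l)) * \<xi> l))
      = ?r * tr (adj (\<xi> j) * ((adj (p j) * p l) * \<xi> l)) - tr (adj (\<xi> j) * ((adj (c * p j) * (c * p l)) * \<xi> l))" for j l
    using p \<xi> c by (simp add: left_diff_distrib right_diff_distrib scl_mult_left scl_mult_right tr_minus tr_scl
       del: of_real_power)
  have eq: "(\<Sum>j<k. \<Sum>l<k. tr (adj (\<xi> j) *
      ((scl ?r (adj (p j) * p l) - adj (c * p j) * (c * p l)) * \<xi> l)))
    = ?r * (\<Sum>j<k. \<Sum>l<k. tr (adj (\<xi> j) * ((adj (p j) * p l) * \<xi> l)))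
      - (\<Sum>j<k. \<Sum>l<k. tr (adj (\<xi> j) * ((adj (c * p j) * (c * p l)) * \<xi> l)))"
    unfolding t by (simp add: sum_subtractf sum_distrib_left)
  have cp: "\<And>j. c * p j \<in> M" using c p by simp
  have cz: "(\<Sum>l<k. c * p l * \<xi> l) = c * ?z" by (simp add: sum_distrib_left mult.assoc)
  have "(L2.nrm (c * ?z))\<^sup>2 \<le> (K * L2.nrm ?z)\<^sup>2"
    using K(2)[OF z] c z by (intro power_mono) auto
  then have "0 \<le> K\<^sup>2 * (L2.nrm ?z)\<^sup>2 - (L2.nrm (c * ?z))\<^sup>2" by (simp add: power_mult_distrib)
  moreover have R: "Re (complex_of_real r * w) = r * Re w" for r w by simp
  ultimately show ?thesis
    unfolding eq minus_complex.sel R gram_tr[of p \<xi> k, OF p \<xi>]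
      gram_tr[of "\<lambda>j. c * p j" \<xi> k, OF cp \<xi>] cz by simp
qed

end

section \<open>Coupling two traces that agree on a subalgebra\<close>

text \<open>Both traces restrict to the same tracial state of \<open>W\<close>, so the closures of \<open>W\<close> in the two
\<open>L\<^sup>2\<close>-spaces are canonically isometric. Below, \<open>H\<close> stands for this common Hilbert space and \<open>P\<close> for
the orthogonal projection of the second \<open>L\<^sup>2\<close>-space onto it.\<close>

locale tracial_pair =
  T1: tracial scl adj M tr1 + T2: tracial scl adj M tr2
  for scl :: "complex \<Rightarrow> 'x::ring \<Rightarrow> 'x" and adj M tr1 tr2 +
  fixes W :: "'x set" and e :: 'x
  assumes W_sub: "x \<in> W \<Longrightarrow> x \<in> M"
    and W_add [simp]: "x \<in> W \<Longrightarrow> y \<in> W \<Longrightarrow> x + y \<in> W"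
    and W_mult [simp]: "x \<in> W \<Longrightarrow> y \<in> W \<Longrightarrow> x * y \<in> W"
    and W_scl [simp]: "x \<in> W \<Longrightarrow> scl c x \<in> W"
    and W_adj [simp]: "x \<in> W \<Longrightarrow> adj x \<in> W"
    and e_W [simp]: "e \<in> W"
    and e_left [simp]: "x \<in> M \<Longrightarrow> e * x = x"
    and e_right [simp]: "x \<in> M \<Longrightarrow> x * e = x"
    and e_adj [simp]: "adj e = e"
    and traces_agree: "x \<in> W \<Longrightarrow> tr1 x = tr2 x"
begin

abbreviation "n1 \<equiv> T1.L2.nrm"
abbreviation "n2 \<equiv> T2.L2.nrm"

lemma W_zero [simp]: "0 \<in> W"
  using W_scl[OF e_W, of 0] by simp

lemma W_minus [simp]: "x \<in> W \<Longrightarrow> y \<in> W \<Longrightarrow> x - y \<in> W"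
  using W_add[OF _ W_scl[of y "- 1"], of x] by (simp add: T1.scl_minus_one)

lemma n_agree: "x \<in> W \<Longrightarrow> n1 x = n2 x"
  by (simp add: T1.L2.nrm_def T2.L2.nrm_def traces_agree)

text \<open>This says \<open>\<parallel>p - P y\<parallel> \<le> d\<close>, expressed without \<open>P\<close> by testing against vectors of \<open>W\<close>.\<close>

definition approx :: "real \<Rightarrow> 'x \<Rightarrow> 'x \<Rightarrow> bool" where
  "approx d p y \<longleftrightarrow> 0 \<le> d \<and> p \<in> W \<and> (\<forall>v\<in>W. cmod (tr2 (adj v * (y - p))) \<le> d * n2 v)"

lemma approx_W: "approx d p y \<Longrightarrow> p \<in> W"
  by (simp add: approx_def)

lemma approx_M: "approx d p y \<Longrightarrow> p \<in> M"
  by (simp add: approx_def W_sub)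

lemma approxD: "approx d p y \<Longrightarrow> v \<in> W \<Longrightarrow> cmod (tr2 (adj v * (y - p))) \<le> d * n2 v"
  by (simp add: approx_def)

lemma n2_nonneg [simp]: "x \<in> W \<Longrightarrow> 0 \<le> n2 x"
  by (simp add: W_sub)

lemma n2_minus_scl:
  assumes x: "x \<in> M" and y: "y \<in> M"
  shows "(n2 (x - scl z y))\<^sup>2 = (n2 x)\<^sup>2 - 2 * Re (cnj z * tr2 (adj y * x)) + (cmod z)\<^sup>2 * (n2 y)\<^sup>2"
proof -
  have "scl (- z) y = - scl z y" using T1.scl_scl[of "-1" z y] by (simp add: T1.scl_minus_one)
  then have "x - scl z y = x + scl (- z) y" by simp
  then show ?thesis by (simp only: T2.L2.nrm_comb_sq[OF x y, of "- z"]) simp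
qed

text \<open>A vector of \<open>W\<close> whose distance to \<open>y\<close> nearly attains the infimum is nearly the projection of \<open>y\<close>: a
large inner product of \<open>y - p\<close> with some \<open>v\<close> would allow \<open>p\<close> to be improved in the direction of \<open>v\<close>.\<close>

lemma approx_exists:
  assumes y: "y \<in> M" and d: "d > 0"
  shows "\<exists>p. approx d p y"
proof -
  let ?S = "(\<lambda>p. (n2 (y - p))\<^sup>2) ` W"
  define m where "m = Inf ?S"
  have bdd: "bdd_below ?S" by (rule bdd_belowI[of _ 0]) auto
  have "Inf ?S < m + d\<^sup>2" using d by (simp add: m_def)
  then obtain p where p: "p \<in> W" "(n2 (y - p))\<^sup>2 < m + d\<^sup>2"
    using cInf_lessD[of ?S "m + d\<^sup>2"] e_W by blast
  have pM: "p \<in> M" using p W_sub by simp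
  have "cmod (tr2 (adj v * (y - p))) \<le> d * n2 v" if v: "v \<in> W" for v
  proof -
    have vM: "v \<in> M" using v W_sub by simp
    define c where "c = tr2 (adj v * (y - p))"
    show ?thesis
    proof (cases "n2 v = 0")
      case True
      have "cmod c \<le> n2 (y - p) * n2 v"
        unfolding c_def using T2.L2.Cauchy_Schwarz[of "y - p" v] y pM vM by simp
      then show ?thesis using True by (simp add: c_def)
    next
      case False
      then have pos: "n2 v > 0" using vM T2.L2.nrm_nonneg[OF vM] by linarith
      (* the multiple of \<open>v\<close> that minimizes the distance of \<open>p + z v\<close> to \<open>y\<close> *)
      define z where "z = c / complex_of_real ((n2 v)\<^sup>2)"
      have "p + scl z v \<in> W" using p v by simp
      then have "m \<le> (n2 (y - (p + scl z v)))\<^sup>2"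
        unfolding m_def using bdd by (intro cInf_lower) auto
      also have "y - (p + scl z v) = (y - p) - scl z v" by simp
      also have "(n2 \<dots>)\<^sup>2 = (n2 (y - p))\<^sup>2 - 2 * Re (cnj z * c) + (cmod z)\<^sup>2 * (n2 v)\<^sup>2"
        unfolding c_def using y pM vM by (intro n2_minus_scl) auto
      also have "Re (cnj z * c) = (cmod c)\<^sup>2 / (n2 v)\<^sup>2"
      proof -
        have "cnj z * c = (c * cnj c) / complex_of_real ((n2 v)\<^sup>2)" by (simp add: z_def)
        also have "\<dots> = complex_of_real ((cmod c)\<^sup>2 / (n2 v)\<^sup>2)"
          by (simp flip: complex_norm_square)
        finally show ?thesis by simp
      qed
      also have "(cmod z)\<^sup>2 * (n2 v)\<^sup>2 = (cmod c)\<^sup>2 / (n2 v)\<^sup>2"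

        using pos by (simp add: z_def norm_divide norm_power power_divide) (simp add: power2_eq_square power4_eq_xxxx)
      finally have "(cmod c)\<^sup>2 / (n2 v)\<^sup>2 \<le> d\<^sup>2" using p by linarith
      then have "(cmod c)\<^sup>2 \<le> (d * n2 v)\<^sup>2" using pos by (simp add: field_simps power_mult_distrib)
      then show ?thesis unfolding c_def[symmetric] using d pos by (rule_tac power2_le_imp_le) simp_all
    qed
  qed
  then show ?thesis using p d by (auto simp: approx_def)
qed

text \<open>Both defining estimates are tested against the vector \<open>p - q\<close> itself.\<close>

lemma approx_unique:
  assumes p: "approx d p y" and q: "approx d' q y" and y: "y \<in> M"
  shows "n2 (p - q) \<le> d + d'"
proof -
  let ?v = "p - q"
  have v: "?v \<in> W" "?v \<in> M" and pq: "p \<in> M" "q \<in> M"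
    using p q approx_W approx_M by auto
  have a: "adj ?v * ?v = adj ?v * (y - q) - adj ?v * (y - p)"
    by (simp add: algebra_simps)
  have "(n2 ?v)\<^sup>2 = Re (tr2 (adj ?v * ?v))" using T2.L2.nrm_sq v by simp
  also have "tr2 (adj ?v * ?v) = tr2 (adj ?v * (y - q)) - tr2 (adj ?v * (y - p))"
    unfolding a using v y pq by (intro T2.tr_minus) auto
  also have "Re \<dots> \<le> cmod (tr2 (adj ?v * (y - q)) - tr2 (adj ?v * (y - p)))"
    by (rule complex_Re_le_cmod)
  also have "\<dots> \<le> d' * n2 ?v + d * n2 ?v"
    using approxD[OF p v(1)] approxD[OF q v(1)] norm_triangle_ineq4 by (smt (verit))
  finally have ineq: "n2 ?v * n2 ?v \<le> (d + d') * n2 ?v" by (simp add: power2_eq_square algebra_simps)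
  have nn: "0 \<le> n2 ?v" using v by simp
  show ?thesis
  proof (cases "n2 ?v = 0")
    case True
    then show ?thesis using p q by (simp add: approx_def)
  next
    case False
    then show ?thesis using ineq nn by (simp add: mult_le_cancel_right)
  qed
qed

lemma approx_add:
  assumes "approx d p y" "approx d' q z" and y: "y \<in> M" and z: "z \<in> M"
  shows "approx (d + d') (p + q) (y + z)"
  unfolding approx_def
proof (intro conjI ballI)
  fix v assume v: "v \<in> W"
  have pq: "p \<in> M" "q \<in> M" using assms approx_M by auto
  have "adj v * (y + z - (p + q)) = adj v * (y - p) + adj v * (z - q)"
    by (simp add: algebra_simps)
  then have "tr2 (adj v * (y + z - (p + q))) = tr2 (adj v * (y - p)) + tr2 (adj v * (z - q))"
    using v pq y z W_sub by (simp add: T2.tr_add)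
  then show "cmod (tr2 (adj v * (y + z - (p + q)))) \<le> (d + d') * n2 v"
    using approxD[OF assms(1) v] approxD[OF assms(2) v] norm_triangle_ineq[of "tr2 (adj v * (y - p))" "tr2 (adj v * (z - q))"]
    by (simp add: distrib_right)
qed (use assms in \<open>auto simp: approx_def\<close>)

lemma approx_scl:
  assumes "approx d p y" and y: "y \<in> M"
  shows "approx (cmod c * d) (scl c p) (scl c y)"
  unfolding approx_def
proof (intro conjI ballI)
  fix v assume v: "v \<in> W"
  have p: "p \<in> M" using assms approx_M by auto
  have eq: "adj v * (scl c y - scl c p) = scl c (adj v * (y - p))"
    using T1.scl_add_right[of c "y - p" p] by (simp add: T1.scl_mult_right[symmetric])
  have "tr2 (adj v * (scl c y - scl c p)) = c * tr2 (adj v * (y - p))"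
    unfolding eq using v p y W_sub by (intro T2.tr_scl) auto
  then show "cmod (tr2 (adj v * (scl c y - scl c p))) \<le> (cmod c * d) * n2 v"
    using approxD[OF assms(1) v] by (simp add: norm_mult mult_left_mono mult.assoc)
qed (use assms in \<open>auto simp: approx_def\<close>)

lemma approx_adj:
  assumes "approx d p y" and y: "y \<in> M"
  shows "approx d (adj p) (adj y)"
  unfolding approx_def
proof (intro conjI ballI)
  fix v assume v: "v \<in> W"
  have p: "p \<in> M" and vM: "v \<in> M" using assms approx_M v W_sub by auto
  have "adj v * (adj y - adj p) = adj ((y - p) * v)"
    by (simp add: T1.adj_mult T1.adj_minus)
  then have "tr2 (adj v * (adj y - adj p)) = cnj (tr2 ((y - p) * v))"
    using T2.tr_adj[of "(y - p) * v"] p y vM by simp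
  also have "tr2 ((y - p) * v) = tr2 (adj (adj v) * (y - p))"
    using T2.tr_comm[of "y - p" v] p y vM by simp
  finally show "cmod (tr2 (adj v * (adj y - adj p))) \<le> d * n2 v"
    using approxD[OF assms(1) W_adj[OF v]] T2.nrm_adj[OF vM] by simp
qed (use assms in \<open>auto simp: approx_def\<close>)

text \<open>The projection \<open>P\<close> commutes with left multiplication by \<open>w\<close>, because \<open>W\<close> is invariant under \<open>w\<close> and
under its adjoint. The constant is a bound for left multiplication by the adjoint.\<close>

lemma approx_mult_left:
  assumes w: "w \<in> W"
  shows "\<exists>K\<ge>0. \<forall>d p y. y \<in> M \<longrightarrow> approx d p y \<longrightarrow> approx (K * d) (w * p) (w * y)"
proof -
  have wM: "w \<in> M" using w W_sub by simp
  obtain K where K: "K \<ge> 0" "\<And>v. v \<in> M \<Longrightarrow> n2 (adj w * v) \<le> K * n2 v"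
    using T2.left_bound[OF T1.M_adj[OF wM]] by blast
  have "approx (K * d) (w * p) (w * y)" if y: "y \<in> M" and a: "approx d p y" for d p y
    unfolding approx_def
  proof (intro conjI ballI)
    fix v assume v: "v \<in> W"
    have p: "p \<in> M" and vM: "v \<in> M" using a approx_M v W_sub by auto
    have "adj v * (w * y - w * p) = adj (adj w * v) * (y - p)"
      by (simp add: T1.adj_mult mult.assoc right_diff_distrib)
    also have "cmod (tr2 \<dots>) \<le> d * n2 (adj w * v)"
      using approxD[OF a] v w by simp
    also have "\<dots> \<le> d * (K * n2 v)"
      using a K(2)[OF vM] by (intro mult_left_mono) (auto simp: approx_def)
    finally show "cmod (tr2 (adj v * (w * y - w * p))) \<le> K * d * n2 v" by (simp add: ac_simps)
  qed (use a K w in \<open>auto simp: approx_def\<close>)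
  then show ?thesis using K(1) by metis
qed

definition pr :: "nat \<Rightarrow> 'x \<Rightarrow> 'x" where
  "pr n y = (SOME p. approx (inverse (real (Suc n))) p y)"

lemma pr_approx: "y \<in> M \<Longrightarrow> approx (inverse (real (Suc n))) (pr n y) y"
  unfolding pr_def by (rule someI_ex) (rule approx_exists, simp_all)

text \<open>This is \<open>\<langle>x, P y\<rangle>\<close> in the first \<open>L\<^sup>2\<close>-space, where \<open>P y\<close> is transported there through \<open>W\<close>. For a
sub-von-Neumann-algebra with conditional expectations it would be the trace of \<open>E(y)\<^sup>* E(x)\<close>.\<close>

definition pair :: "'x \<Rightarrow> 'x \<Rightarrow> complex" where
  "pair x y = lim (\<lambda>n. tr1 (adj (pr n y) * x))"

text \<open>Here the agreement of the traces enters: two approximants are close in the second norm, hence, since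
their difference lies in \<open>W\<close>, also in the first.\<close>

lemma approx_pair:
  assumes "approx d p y" "approx d' q y" "y \<in> M" "x \<in> M"
  shows "cmod (tr1 (adj p * x) - tr1 (adj q * x)) \<le> (d + d') * n1 x"
proof -
  have pq: "p \<in> M" "q \<in> M" "p - q \<in> W" "p - q \<in> M" using assms approx_W approx_M by auto
  have "tr1 (adj p * x) - tr1 (adj q * x) = tr1 (adj (p - q) * x)"
    using pq assms by (simp add: T1.adj_minus left_diff_distrib T1.tr_minus)
  also have "cmod \<dots> \<le> n1 x * n1 (p - q)" using assms pq by (intro T1.L2.Cauchy_Schwarz)
  also have "\<dots> \<le> n1 x * (d + d')"
    using approx_unique[OF assms(1-3)] n_agree[OF pq(3)] assms(4) by (intro mult_left_mono) auto
  finally show ?thesis by (simp add: mult.commute)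
qed

lemma pair_LIMSEQ:
  assumes y: "y \<in> M" and x: "x \<in> M"
  shows "(\<lambda>n. tr1 (adj (pr n y) * x)) \<longlonglongrightarrow> pair x y"
proof -
  let ?a = "\<lambda>n. tr1 (adj (pr n y) * x)"
  have d: "cmod (?a m - ?a n) \<le> (inverse (real (Suc m)) + inverse (real (Suc n))) * n1 x" for m n
    using approx_pair[OF pr_approx[OF y] pr_approx[OF y] y x] .
  have "Cauchy ?a"
  proof (rule CauchyI)
    fix r :: real assume r: "0 < r"
    have "(\<lambda>n. inverse (real (Suc n)) * (2 * n1 x)) \<longlonglongrightarrow> 0 * (2 * n1 x)"
      by (intro tendsto_mult LIMSEQ_inverse_real_of_nat tendsto_const)
    then have "(\<lambda>n. inverse (real (Suc n)) * (2 * n1 x)) \<longlonglongrightarrow> 0" by simp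
    from order_tendstoD(2)[OF this r] obtain N
      where N: "inverse (real (Suc N)) * (2 * n1 x) < r" by (auto simp: eventually_sequentially)
    have "cmod (?a m - ?a n) < r" if "m \<ge> N" "n \<ge> N" for m n
    proof -
      have "inverse (real (Suc m)) \<le> inverse (real (Suc N))"
           "inverse (real (Suc n)) \<le> inverse (real (Suc N))"
        using that by (auto intro!: le_imp_inverse_le)
      then have "(inverse (real (Suc m)) + inverse (real (Suc n))) * n1 x
          \<le> (inverse (real (Suc N)) + inverse (real (Suc N))) * n1 x"
        using x by (intro mult_right_mono add_mono) auto
      also have "\<dots> = inverse (real (Suc N)) * (2 * n1 x)" by simp
      finally show ?thesis using d[of m n] N by linarith
    qed
    then show "\<exists>N. \<forall>m\<ge>N. \<forall>n\<ge>N. cmod (?a m - ?a n) < r" by blast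
  qed
  then show ?thesis
    unfolding pair_def using Cauchy_convergent convergent_LIMSEQ_iff by blast
qed

lemma pair_close:
  assumes p: "approx d p y" and y: "y \<in> M" and x: "x \<in> M"
  shows "cmod (tr1 (adj p * x) - pair x y) \<le> d * n1 x"
proof (rule LIMSEQ_le)
  show "(\<lambda>n. cmod (tr1 (adj p * x) - tr1 (adj (pr n y) * x))) \<longlonglongrightarrow> cmod (tr1 (adj p * x) - pair x y)"
    by (intro tendsto_norm tendsto_diff tendsto_const pair_LIMSEQ y x)
  have "(\<lambda>n. (d + inverse (real (Suc n))) * n1 x) \<longlonglongrightarrow> (d + 0) * n1 x"
    by (intro tendsto_mult tendsto_add LIMSEQ_inverse_real_of_nat tendsto_const)
  then show "(\<lambda>n. (d + inverse (real (Suc n))) * n1 x) \<longlonglongrightarrow> d * n1 x" by simp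
  show "\<exists>N. \<forall>n\<ge>N. cmod (tr1 (adj p * x) - tr1 (adj (pr n y) * x)) \<le> (d + inverse (real (Suc n))) * n1 x"
    using approx_pair[OF p pr_approx[OF y] y x] by blast
qed

lemma pair_tendsto:
  assumes "\<And>n. approx (d n) (p n) y" "d \<longlonglongrightarrow> 0" and y: "y \<in> M" and x: "x \<in> M"
  shows "(\<lambda>n. tr1 (adj (p n) * x)) \<longlonglongrightarrow> pair x y"
proof -
  have "(\<lambda>n. d n * n1 x) \<longlonglongrightarrow> 0 * n1 x" by (intro tendsto_mult assms tendsto_const)
  then have "(\<lambda>n. d n * n1 x) \<longlonglongrightarrow> 0" by simp
  then have "(\<lambda>n. tr1 (adj (p n) * x) - pair x y) \<longlonglongrightarrow> 0"
    by (rule tendsto_0_le[where K = 1])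
      (use pair_close[OF assms(1) y x] in \<open>auto intro!: always_eventually intro: order_trans[OF _ abs_ge_self]\<close>)
  then show ?thesis by (simp add: LIM_zero_iff)
qed

lemma pair_add_left:
  assumes "x \<in> M" "x' \<in> M" and y: "y \<in> M"
  shows "pair (x + x') y = pair x y + pair x' y"
proof (rule LIMSEQ_unique[OF pair_LIMSEQ])
  have "pr n y \<in> M" for n using approx_M[OF pr_approx[OF y]] .
  then have "(\<lambda>n. tr1 (adj (pr n y) * (x + x'))) = (\<lambda>n. tr1 (adj (pr n y) * x) + tr1 (adj (pr n y) * x'))"
    using assms by (simp add: distrib_left T1.tr_add)
  then show "(\<lambda>n. tr1 (adj (pr n y) * (x + x'))) \<longlonglongrightarrow> pair x y + pair x' y"
    using assms by (simp add: tendsto_add pair_LIMSEQ)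
qed (use assms in auto)

lemma pair_scl_left:
  assumes "x \<in> M" and y: "y \<in> M"
  shows "pair (scl c x) y = c * pair x y"
proof (rule LIMSEQ_unique[OF pair_LIMSEQ])
  have "pr n y \<in> M" for n using approx_M[OF pr_approx[OF y]] .
  then have "(\<lambda>n. tr1 (adj (pr n y) * scl c x)) = (\<lambda>n. c * tr1 (adj (pr n y) * x))"
    using assms by (simp add: T1.scl_mult_right T1.tr_scl)
  then show "(\<lambda>n. tr1 (adj (pr n y) * scl c x)) \<longlonglongrightarrow> c * pair x y"
    using assms by (simp add: tendsto_mult_left pair_LIMSEQ)
qed (use assms in auto)

lemma inverse_Suc_null: "(\<lambda>n. K * inverse (real (Suc n))) \<longlonglongrightarrow> 0"
  using tendsto_mult[OF tendsto_const[of K] LIMSEQ_inverse_real_of_nat] by simp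

lemma pair_add_right:
  assumes x: "x \<in> M" and y: "y \<in> M" and z: "z \<in> M"
  shows "pair x (y + z) = pair x y + pair x z"
proof (rule LIMSEQ_unique)
  have pM: "pr n y \<in> M" "pr n z \<in> M" for n using approx_M[OF pr_approx] y z by auto
  show "(\<lambda>n. tr1 (adj (pr n y + pr n z) * x)) \<longlonglongrightarrow> pair x (y + z)"
  proof (rule pair_tendsto)
    show "approx (2 * inverse (real (Suc n))) (pr n y + pr n z) (y + z)" for n
      using approx_add[OF pr_approx[OF y] pr_approx[OF z] y z] by (simp only: mult_2)
  qed (use x y z inverse_Suc_null in auto)
  have "(\<lambda>n. tr1 (adj (pr n y + pr n z) * x)) = (\<lambda>n. tr1 (adj (pr n y) * x) + tr1 (adj (pr n z) * x))"
    using assms pM by (simp add: T1.adj_add distrib_right T1.tr_add)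
  then show "(\<lambda>n. tr1 (adj (pr n y + pr n z) * x)) \<longlonglongrightarrow> pair x y + pair x z"
    using assms by (simp add: tendsto_add pair_LIMSEQ)
qed

lemma pair_scl_right:
  assumes x: "x \<in> M" and y: "y \<in> M"
  shows "pair x (scl c y) = cnj c * pair x y"
proof (rule LIMSEQ_unique)
  have pM: "pr n y \<in> M" for n using approx_M[OF pr_approx] y by auto
  show "(\<lambda>n. tr1 (adj (scl c (pr n y)) * x)) \<longlonglongrightarrow> pair x (scl c y)"
    by (rule pair_tendsto[OF approx_scl[OF pr_approx[OF y] y] inverse_Suc_null]) (use x y in auto)
  have "(\<lambda>n. tr1 (adj (scl c (pr n y)) * x)) = (\<lambda>n. cnj c * tr1 (adj (pr n y) * x))"
    using assms pM by (simp add: T1.adj_scl T1.scl_mult_left T1.tr_scl)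
  then show "(\<lambda>n. tr1 (adj (scl c (pr n y)) * x)) \<longlonglongrightarrow> cnj c * pair x y"
    using assms by (simp add: tendsto_mult_left pair_LIMSEQ)
qed

lemma pair_adj:
  assumes x: "x \<in> M" and y: "y \<in> M"
  shows "pair (adj x) (adj y) = cnj (pair x y)"
proof (rule LIMSEQ_unique)
  have pM: "pr n y \<in> M" for n using approx_M[OF pr_approx] y by auto
  show "(\<lambda>n. tr1 (adj (adj (pr n y)) * adj x)) \<longlonglongrightarrow> pair (adj x) (adj y)"
    by (rule pair_tendsto[OF approx_adj[OF pr_approx[OF y] y] LIMSEQ_inverse_real_of_nat]) (use x y in auto)
  have "tr1 (adj (adj (pr n y)) * adj x) = cnj (tr1 (adj (pr n y) * x))" for n
  proof -
    have "tr1 (adj (adj (pr n y)) * adj x) = tr1 (adj x * pr n y)"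
      using T1.tr_comm[of "pr n y" "adj x"] x pM by simp
    also have "adj x * pr n y = adj (adj (pr n y) * x)" by (simp add: T1.adj_mult)
    finally show ?thesis using T1.tr_adj[of "adj (pr n y) * x"] x pM by simp
  qed
  then show "(\<lambda>n. tr1 (adj (adj (pr n y)) * adj x)) \<longlonglongrightarrow> cnj (pair x y)"
    using assms by (simp add: tendsto_cnj pair_LIMSEQ)
qed

text \<open>The module property of a conditional expectation, inherited from \<open>approx_mult_left\<close>.\<close>

lemma pair_shift_left:
  assumes x: "x \<in> M" and y: "y \<in> M" and w: "w \<in> W"
  shows "pair (w * x) y = pair x (adj w * y)"
proof (rule LIMSEQ_unique)
  have wM: "w \<in> M" using w W_sub by simp
  obtain K where K: "\<And>d p y. y \<in> M \<Longrightarrow> approx d p y \<Longrightarrow> approx (K * d) (adj w * p) (adj w * y)"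
    using approx_mult_left[OF W_adj[OF w]] by blast
  show "(\<lambda>n. tr1 (adj (pr n y) * (w * x))) \<longlonglongrightarrow> pair (w * x) y"
    using x y wM by (intro pair_LIMSEQ) auto
  have "tr1 (adj (pr n y) * (w * x)) = tr1 (adj (adj w * pr n y) * x)" for n
    by (simp add: T1.adj_mult mult.assoc)
  moreover have "(\<lambda>n. tr1 (adj (adj w * pr n y) * x)) \<longlonglongrightarrow> pair x (adj w * y)"
    by (rule pair_tendsto[OF K[OF y pr_approx[OF y]] inverse_Suc_null]) (use x y wM in auto)
  ultimately show "(\<lambda>n. tr1 (adj (pr n y) * (w * x))) \<longlonglongrightarrow> pair x (adj w * y)" by simp
qed

lemma pair_W:
  assumes x: "x \<in> M" and y: "y \<in> W"
  shows "pair x y = tr1 (adj y * x)"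
proof -
  have "approx 0 y y" using y by (simp add: approx_def)
  then show ?thesis using pair_close[of 0 y y x] x y W_sub by simp
qed

lemma pair_sum_right: "(\<And>i. i \<in> I \<Longrightarrow> g i \<in> M) \<Longrightarrow> x \<in> M \<Longrightarrow> pair x (\<Sum>i\<in>I. g i) = (\<Sum>i\<in>I. pair x (g i))"
  using pair_scl_right[of x 0 0]
  by (induction I rule: infinite_finite_induct) (auto simp: pair_add_right)

end

section \<open>Positivity of the coupling\<close>

text \<open>If \<open>r = H 1 / H 0\<close> exceeded \<open>1\<close>, the inequality would give \<open>H (2^i) \<ge> r ^ (2^i) * H 0\<close> by induction,
contradicting boundedness.\<close>

lemma power_doubling_bound:
  fixes H :: "nat \<Rightarrow> real"
  assumes sq: "\<And>j. (H j)\<^sup>2 \<le> H (2 * j) * H 0" and bd: "\<And>j. H j \<le> C" and H0: "0 \<le> H 0"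
  shows "H 1 \<le> H 0"
proof (rule ccontr)
  assume "\<not> H 1 \<le> H 0"
  then have gt: "H 1 > H 0" by simp
  show False
  proof (cases "H 0 = 0")
    case True
    then have "(H 1)\<^sup>2 \<le> 0" using sq[of 1] by simp
    then show False using gt True by simp
  next
    case False
    then have pos: "H 0 > 0" using H0 by simp
    define r where "r = H 1 / H 0"
    have r: "r > 1" using gt pos by (simp add: r_def)
    have grow: "H (2 ^ i) \<ge> r ^ (2 ^ i) * H 0" for i
    proof (induction i)
      case 0
      then show ?case using pos by (simp add: r_def)
    next
      case (Suc i)
      have "(r ^ (2 ^ i) * H 0)\<^sup>2 \<le> (H (2 ^ i))\<^sup>2"
        using Suc r pos by (intro power_mono) auto
      also have "\<dots> \<le> H (2 ^ Suc i) * H 0" using sq[of "2 ^ i"] by simp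
      finally have "(r ^ (2 ^ Suc i) * H 0) * H 0 \<le> H (2 ^ Suc i) * H 0"
        by (simp add: power2_eq_square power_add[symmetric] mult_2 algebra_simps)
      then show ?case using pos by (simp add: mult_le_cancel_right)
    qed
    obtain i where i: "C / H 0 < r ^ i" using real_arch_pow[OF r] by blast
    have "i \<le> 2 ^ i" by (simp add: less_imp_le_nat)
    then have "r ^ i \<le> r ^ (2 ^ i)" using r by (intro power_increasing) auto
    then have "C < r ^ (2 ^ i) * H 0" using i pos by (simp add: pos_divide_less_eq) (smt (verit) mult_right_mono)
    then show False using grow[of i] bd[of "2 ^ i"] by linarith
  qed
qed

text \<open>Two positive matrices \<open>x\<close> and \<open>y\<close> over the algebra; positivity is only demanded of the forms that they
define on tuples of elements of \<open>W\<close>. The last hypothesis normalizes \<open>y\<close> so that it acts as a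
contraction.\<close>

locale kernel_pair = tracial_pair scl adj M tr1 tr2 W e
  for scl :: "complex \<Rightarrow> 'x::ring \<Rightarrow> 'x" and adj M tr1 tr2 W e +
  fixes k :: nat and x y :: "nat \<Rightarrow> nat \<Rightarrow> 'x"
  assumes x_M [simp]: "x j l \<in> M" and y_M [simp]: "y j l \<in> M"
    and x_adj [simp]: "adj (x j l) = x l j" and y_adj [simp]: "adj (y j l) = y l j"
    and x_pos: "(\<And>j. \<xi> j \<in> W) \<Longrightarrow> 0 \<le> Re (\<Sum>j<k. \<Sum>l<k. tr1 (adj (\<xi> j) * (x j l * \<xi> l)))"
    and y_pos: "(\<And>j. \<xi> j \<in> W) \<Longrightarrow> 0 \<le> Re (\<Sum>j<k. \<Sum>l<k. tr2 (adj (\<xi> j) * (y j l * \<xi> l)))"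
    and y_le: "(\<And>j. \<xi> j \<in> W) \<Longrightarrow> Re (\<Sum>j<k. \<Sum>l<k. tr2 (adj (\<xi> j) * (y j l * \<xi> l)))
        \<le> Re (\<Sum>j<k. tr2 (adj (\<xi> j) * \<xi> j))"
begin

text \<open>The matrices act on square arrays of elements of \<open>W\<close>: \<open>x\<close> by left multiplication on the row index, and
\<open>y\<close> by right multiplication on the column index. Separating the indices keeps the two actions apart;
the entrywise pairing of \<open>x\<close> and \<open>y\<close> is recovered at the diagonal array \<open>\<zeta>\<close> below.\<close>

definition Vec :: "(nat \<Rightarrow> nat \<Rightarrow> 'x) set" where "Vec = {\<xi>. \<forall>j l. \<xi> j l \<in> W}"

definition vcomb :: "(nat \<Rightarrow> nat \<Rightarrow> 'x) \<Rightarrow> complex \<Rightarrow> (nat \<Rightarrow> nat \<Rightarrow> 'x) \<Rightarrow> (nat \<Rightarrow> nat \<Rightarrow> 'x)" where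
  "vcomb \<xi> z \<eta> = (\<lambda>j l. \<xi> j l + scl z (\<eta> j l))"

definition ip :: "(nat \<Rightarrow> nat \<Rightarrow> 'x) \<Rightarrow> (nat \<Rightarrow> nat \<Rightarrow> 'x) \<Rightarrow> complex" where
  "ip \<xi> \<eta> = (\<Sum>j<k. \<Sum>l<k. tr2 (adj (\<eta> j l) * \<xi> j l))"

text \<open>The action of \<open>y\<close>, which leads out of \<open>W\<close>; its compression to \<open>H\<close> has the form \<open>T\<close>, and \<open>S\<close> is the form
of the complementary contraction.\<close>

definition R :: "(nat \<Rightarrow> nat \<Rightarrow> 'x) \<Rightarrow> nat \<Rightarrow> nat \<Rightarrow> 'x" where
  "R \<xi> j l = (\<Sum>l'<k. \<xi> j l' * y l' l)"

definition T :: "(nat \<Rightarrow> nat \<Rightarrow> 'x) \<Rightarrow> (nat \<Rightarrow> nat \<Rightarrow> 'x) \<Rightarrow> complex" where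
  "T \<xi> \<eta> = (\<Sum>j<k. \<Sum>l<k. tr2 (adj (\<eta> j l) * R \<xi> j l))"

definition S :: "(nat \<Rightarrow> nat \<Rightarrow> 'x) \<Rightarrow> (nat \<Rightarrow> nat \<Rightarrow> 'x) \<Rightarrow> complex" where
  "S \<xi> \<eta> = ip \<xi> \<eta> - T \<xi> \<eta>"

definition Q :: "(nat \<Rightarrow> nat \<Rightarrow> 'x) \<Rightarrow> (nat \<Rightarrow> nat \<Rightarrow> 'x) \<Rightarrow> complex" where
  "Q \<xi> \<eta> = (\<Sum>l<k. \<Sum>j<k. \<Sum>j'<k. tr1 (adj (\<eta> j l) * (x j j' * \<xi> j' l)))"

text \<open>The value \<open>Q (P (R \<xi>)) \<eta>\<close>. The vector \<open>P (R \<xi>)\<close> lives in the closure of the space of arrays only, but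
its inner products with fixed vectors are values of \<open>pair\<close>.\<close>

definition QT :: "(nat \<Rightarrow> nat \<Rightarrow> 'x) \<Rightarrow> (nat \<Rightarrow> nat \<Rightarrow> 'x) \<Rightarrow> complex" where
  "QT \<xi> \<eta> = (\<Sum>l<k. \<Sum>j<k. \<Sum>j'<k. cnj (pair (x j' j * \<eta> j l) (R \<xi> j' l)))"

lemma Vec_W: "\<xi> \<in> Vec \<Longrightarrow> \<xi> j l \<in> W" and Vec_M [simp]: "\<xi> \<in> Vec \<Longrightarrow> \<xi> j l \<in> M"
  by (auto simp: Vec_def W_sub)

lemma R_M [simp]: "\<xi> \<in> Vec \<Longrightarrow> R \<xi> j l \<in> M"
  by (simp add: R_def)

lemma vcomb_Vec: "\<xi> \<in> Vec \<Longrightarrow> \<eta> \<in> Vec \<Longrightarrow> vcomb \<xi> z \<eta> \<in> Vec"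
  by (auto simp: Vec_def vcomb_def)

lemma R_vcomb: "R (vcomb \<xi> z \<eta>) j l = R \<xi> j l + scl z (R \<eta> j l)"
  by (simp add: R_def vcomb_def distrib_right sum.distrib T1.scl_sum T1.scl_mult_left)

lemma ip_left: "\<xi> \<in> Vec \<Longrightarrow> \<eta> \<in> Vec \<Longrightarrow> \<zeta> \<in> Vec \<Longrightarrow> ip (vcomb \<xi> z \<eta>) \<zeta> = ip \<xi> \<zeta> + z * ip \<eta> \<zeta>"
  by (simp add: ip_def vcomb_def distrib_left T1.scl_mult_right T2.tr_add T2.tr_scl
      sum.distrib sum_distrib_left)

lemma T_left: "\<xi> \<in> Vec \<Longrightarrow> \<eta> \<in> Vec \<Longrightarrow> \<zeta> \<in> Vec \<Longrightarrow> T (vcomb \<xi> z \<eta>) \<zeta> = T \<xi> \<zeta> + z * T \<eta> \<zeta>"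
  by (simp add: T_def R_vcomb distrib_left T1.scl_mult_right T2.tr_add T2.tr_scl
      sum.distrib sum_distrib_left)

lemma Q_left: "\<xi> \<in> Vec \<Longrightarrow> \<eta> \<in> Vec \<Longrightarrow> \<zeta> \<in> Vec \<Longrightarrow> Q (vcomb \<xi> z \<eta>) \<zeta> = Q \<xi> \<zeta> + z * Q \<eta> \<zeta>"
  by (simp add: Q_def vcomb_def distrib_left T1.scl_mult_right T1.tr_add T1.tr_scl
      sum.distrib sum_distrib_left)

lemma tr2_herm: "a \<in> M \<Longrightarrow> b \<in> M \<Longrightarrow> tr2 (adj a * b) = cnj (tr2 (adj b * a))"
  using T2.tr_adj[of "adj b * a"] by (simp add: T1.adj_mult)

lemma tr1_herm: "a \<in> M \<Longrightarrow> b \<in> M \<Longrightarrow> tr1 (adj a * b) = cnj (tr1 (adj b * a))"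
  using T1.tr_adj[of "adj b * a"] by (simp add: T1.adj_mult)

lemma ip_herm: "\<xi> \<in> Vec \<Longrightarrow> \<eta> \<in> Vec \<Longrightarrow> ip \<eta> \<xi> = cnj (ip \<xi> \<eta>)"
  by (simp add: ip_def tr2_herm[of "\<xi> _ _" "\<eta> _ _"])

lemma T_sum: "\<xi> \<in> Vec \<Longrightarrow> \<eta> \<in> Vec \<Longrightarrow>
    T \<xi> \<eta> = (\<Sum>j<k. \<Sum>l<k. \<Sum>l'<k. tr2 (adj (\<eta> j l) * (\<xi> j l' * y l' l)))"
  by (simp add: T_def R_def sum_distrib_left T2.tr_sum)

lemma T_herm:
  assumes "\<xi> \<in> Vec" "\<eta> \<in> Vec"
  shows "T \<eta> \<xi> = cnj (T \<xi> \<eta>)"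
proof -
  have "tr2 (adj (\<xi> j l) * (\<eta> j l' * y l' l)) = cnj (tr2 (adj (\<eta> j l') * (\<xi> j l * y l l')))" for j l l'
  proof -
    have "tr2 (adj (\<xi> j l) * (\<eta> j l' * y l' l)) = cnj (tr2 (adj (\<eta> j l' * y l' l) * \<xi> j l))"
      using assms by (intro tr2_herm) auto
    also have "tr2 (adj (\<eta> j l' * y l' l) * \<xi> j l) = tr2 ((adj (\<eta> j l') * \<xi> j l) * y l l')"
      using assms T2.tr_comm[of "y l l'" "adj (\<eta> j l') * \<xi> j l"] by (simp add: T1.adj_mult mult.assoc)
    finally show ?thesis by (simp add: mult.assoc)
  qed
  then have "T \<eta> \<xi> = (\<Sum>j<k. \<Sum>l<k. \<Sum>l'<k. cnj (tr2 (adj (\<eta> j l') * (\<xi> j l * y l l'))))"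
    unfolding T_sum[OF assms(2,1)] by (simp only:)
  also have "\<dots> = (\<Sum>j<k. \<Sum>l'<k. \<Sum>l<k. cnj (tr2 (adj (\<eta> j l') * (\<xi> j l * y l l'))))"
    by (intro sum.cong HOL.refl sum.swap)
  finally show ?thesis unfolding T_sum[OF assms] cnj_sum .
qed

lemma Q_herm:
  assumes "\<xi> \<in> Vec" "\<eta> \<in> Vec"
  shows "Q \<eta> \<xi> = cnj (Q \<xi> \<eta>)"
proof -
  have "tr1 (adj (\<xi> j l) * (x j j' * \<eta> j' l)) = cnj (tr1 (adj (\<eta> j' l) * (x j' j * \<xi> j l)))" for j l j'
  proof -
    have "tr1 (adj (\<xi> j l) * (x j j' * \<eta> j' l)) = cnj (tr1 (adj (x j j' * \<eta> j' l) * \<xi> j l))"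
      using assms by (intro tr1_herm) auto
    then show ?thesis by (simp add: T1.adj_mult mult.assoc)
  qed
  then have "Q \<eta> \<xi> = (\<Sum>l<k. \<Sum>j<k. \<Sum>j'<k. cnj (tr1 (adj (\<eta> j' l) * (x j' j * \<xi> j l))))"
    by (simp add: Q_def)
  also have "\<dots> = (\<Sum>l<k. \<Sum>j'<k. \<Sum>j<k. cnj (tr1 (adj (\<eta> j' l) * (x j' j * \<xi> j l))))"
    by (intro sum.cong HOL.refl sum.swap)
  finally show ?thesis by (simp add: Q_def)
qed

text \<open>Traciality turns right multiplication by \<open>y\<close> into left multiplication on the adjoint array, for which
the positivity of \<open>y\<close> is formulated.\<close>

lemma T_diag:
  assumes "\<xi> \<in> Vec"
  shows "T \<xi> \<xi> = (\<Sum>j<k. \<Sum>l'<k. \<Sum>l<k. tr2 (adj (adj (\<xi> j l')) * (y l' l * adj (\<xi> j l))))"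
proof -
  have "tr2 (adj (\<xi> j l) * (\<xi> j l' * y l' l)) = tr2 (adj (adj (\<xi> j l')) * (y l' l * adj (\<xi> j l)))" for j l l'
    using assms T2.tr_comm[of "adj (\<xi> j l)" "\<xi> j l' * y l' l"] by (simp add: mult.assoc)
  then have "T \<xi> \<xi> = (\<Sum>j<k. \<Sum>l<k. \<Sum>l'<k. tr2 (adj (adj (\<xi> j l')) * (y l' l * adj (\<xi> j l))))"
    using assms by (simp add: T_sum)
  also have "\<dots> = (\<Sum>j<k. \<Sum>l'<k. \<Sum>l<k. tr2 (adj (adj (\<xi> j l')) * (y l' l * adj (\<xi> j l))))"
    by (intro sum.cong HOL.refl sum.swap)
  finally show ?thesis .
qed

lemma T_pos: "\<xi> \<in> Vec \<Longrightarrow> 0 \<le> Re (T \<xi> \<xi>)"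
proof -
  assume v: "\<xi> \<in> Vec"
  have "Re (T \<xi> \<xi>) = (\<Sum>j<k. Re (\<Sum>l'<k. \<Sum>l<k. tr2 (adj (adj (\<xi> j l')) * (y l' l * adj (\<xi> j l)))))"
    unfolding T_diag[OF v] by (rule Re_sum)
  also have "\<dots> \<ge> 0" using v by (intro sum_nonneg y_pos) (simp add: Vec_W)
  finally show ?thesis .
qed

lemma T_le: "\<xi> \<in> Vec \<Longrightarrow> Re (T \<xi> \<xi>) \<le> Re (ip \<xi> \<xi>)"
proof -
  assume v: "\<xi> \<in> Vec"
  have "Re (T \<xi> \<xi>) = (\<Sum>j<k. Re (\<Sum>l'<k. \<Sum>l<k. tr2 (adj (adj (\<xi> j l')) * (y l' l * adj (\<xi> j l)))))"
    unfolding T_diag[OF v] by (rule Re_sum)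
  also have "\<dots> \<le> (\<Sum>j<k. Re (\<Sum>l<k. tr2 (adj (adj (\<xi> j l)) * adj (\<xi> j l))))"
    using v by (intro sum_mono y_le) (simp add: Vec_W)
  also have "\<dots> = Re (ip \<xi> \<xi>)"
    unfolding ip_def Re_sum using v T2.tr_comm by (intro sum.cong HOL.refl arg_cong[where f = Re]) auto
  finally show ?thesis .
qed

sublocale ipf: pos_form Vec vcomb ip
  by unfold_locales (blast intro: vcomb_Vec ip_left ip_herm order_trans[OF T_pos T_le])+

sublocale Sf: pos_form Vec vcomb S
proof
  fix v w assume vw: "v \<in> Vec" "w \<in> Vec"
  show "S w v = cnj (S v w)"
    unfolding S_def T_herm[OF vw] ip_herm[OF vw] by simp
qed (simp_all add: S_def vcomb_Vec T_left ip_left T_le right_diff_distrib)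

lemma Q_pos: "\<xi> \<in> Vec \<Longrightarrow> 0 \<le> Re (Q \<xi> \<xi>)"
proof -
  assume v: "\<xi> \<in> Vec"
  have "Re (Q \<xi> \<xi>) = (\<Sum>l<k. Re (\<Sum>j<k. \<Sum>j'<k. tr1 (adj (\<xi> j l) * (x j j' * \<xi> j' l))))"
    unfolding Q_def by (rule Re_sum)
  also have "\<dots> \<ge> 0" using v by (intro sum_nonneg x_pos) (simp add: Vec_W)
  finally show ?thesis .
qed

sublocale Qf: pos_form Vec vcomb Q
  by unfold_locales (blast intro: vcomb_Vec Q_left Q_herm Q_pos)+

text \<open>Since \<open>0 \<le> T \<le> ip\<close>, the form \<open>S = ip - T\<close> is itself positive and dominated by \<open>ip\<close>, so its own
Cauchy-Schwarz inequality shows that it belongs to a contraction.\<close>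

lemma S_bound:
  assumes "\<xi> \<in> Vec" "\<eta> \<in> Vec"
  shows "cmod (S \<xi> \<eta>) \<le> ipf.nrm \<xi> * ipf.nrm \<eta>"
proof -
  have le: "Sf.nrm \<zeta> \<le> ipf.nrm \<zeta>" if "\<zeta> \<in> Vec" for \<zeta>
    unfolding Sf.nrm_def ipf.nrm_def using T_pos[OF that] by (intro real_sqrt_le_mono) (simp add: S_def)
  have "cmod (S \<xi> \<eta>) \<le> Sf.nrm \<xi> * Sf.nrm \<eta>" using assms by (rule Sf.Cauchy_Schwarz)
  also have "\<dots> \<le> ipf.nrm \<xi> * ipf.nrm \<eta>" using assms le by (intro mult_mono) auto
  finally show ?thesis .
qed

lemma n2_le_nrm:
  assumes v: "\<xi> \<in> Vec" and jl: "j < k" "l < k"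
  shows "n2 (\<xi> j l) \<le> ipf.nrm \<xi>"
proof -
  have "(n2 (\<xi> j l))\<^sup>2 = Re (tr2 (adj (\<xi> j l) * \<xi> j l))" using v by (intro T2.L2.nrm_sq) auto
  also have "\<dots> \<le> (\<Sum>l<k. Re (tr2 (adj (\<xi> j l) * \<xi> j l)))"
    using jl v T2.L2.pos by (intro member_le_sum) auto
  also have "\<dots> \<le> (\<Sum>j<k. \<Sum>l<k. Re (tr2 (adj (\<xi> j l) * \<xi> j l)))"
    using jl v T2.L2.pos
    by (intro member_le_sum[where f = "\<lambda>j. \<Sum>l<k. Re (tr2 (adj (\<xi> j l) * \<xi> j l))"]) (auto intro!: sum_nonneg)
  also have "\<dots> = (ipf.nrm \<xi>)\<^sup>2" using v by (simp add: ipf.nrm_sq ip_def)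
  finally show ?thesis using v by (rule_tac power2_le_imp_le) auto
qed

text \<open>An approximation in \<open>W\<close> of the array \<open>\<xi> - P (R \<xi>)\<close>, that is, of the contraction with form \<open>S\<close> applied
to \<open>\<xi>\<close>.\<close>

definition step :: "nat \<Rightarrow> (nat \<Rightarrow> nat \<Rightarrow> 'x) \<Rightarrow> nat \<Rightarrow> nat \<Rightarrow> 'x" where
  "step n \<xi> = (\<lambda>j l. \<xi> j l - pr n (R \<xi> j l))"

lemma pr_R: "\<xi> \<in> Vec \<Longrightarrow> approx (inverse (real (Suc n))) (pr n (R \<xi> j l)) (R \<xi> j l)"
  by (rule pr_approx) simp

lemma pr_R_W [simp]: "\<xi> \<in> Vec \<Longrightarrow> pr n (R \<xi> j l) \<in> W"
  using approx_W[OF pr_R] .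

lemma pr_R_M [simp]: "\<xi> \<in> Vec \<Longrightarrow> pr n (R \<xi> j l) \<in> M"
  using approx_M[OF pr_R] .

lemma step_Vec [simp]: "\<xi> \<in> Vec \<Longrightarrow> step n \<xi> \<in> Vec"
  by (auto simp: Vec_def step_def intro!: W_minus pr_R_W)

lemma step_ip:
  assumes v: "\<xi> \<in> Vec" and w: "\<eta> \<in> Vec"
  shows "cmod (ip (step n \<xi>) \<eta> - S \<xi> \<eta>) \<le> (real k)\<^sup>2 * inverse (real (Suc n)) * ipf.nrm \<eta>"
proof -
  have eq: "ip (step n \<xi>) \<eta> - S \<xi> \<eta> = (\<Sum>j<k. \<Sum>l<k. tr2 (adj (\<eta> j l) * (R \<xi> j l - pr n (R \<xi> j l))))"
    using v w by (simp add: ip_def S_def T_def step_def right_diff_distrib T2.tr_minus sum_subtractf)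
  have "cmod (tr2 (adj (\<eta> j l) * (R \<xi> j l - pr n (R \<xi> j l)))) \<le> inverse (real (Suc n)) * ipf.nrm \<eta>"
    if "j < k" "l < k" for j l
    using approxD[OF pr_R[OF v] Vec_W[OF w]] n2_le_nrm[OF w that]
    by (meson inverse_nonnegative_iff_nonnegative mult_left_mono of_nat_0_le_iff order_trans)
  then have "cmod (ip (step n \<xi>) \<eta> - S \<xi> \<eta>) \<le> (\<Sum>j<k. \<Sum>l<k. inverse (real (Suc n)) * ipf.nrm \<eta>)"
    unfolding eq by (intro order_trans[OF norm_sum] sum_mono) (auto intro!: order_trans[OF norm_sum] sum_mono)
  then show ?thesis by (simp add: power2_eq_square mult.assoc)
qed

lemma step_nrm:
  assumes v: "\<xi> \<in> Vec"
  shows "ipf.nrm (step n \<xi>) \<le> ipf.nrm \<xi> + (real k)\<^sup>2 * inverse (real (Suc n))"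
proof -
  let ?D = "step n \<xi>" let ?d = "(real k)\<^sup>2 * inverse (real (Suc n))"
  have D: "?D \<in> Vec" using v by simp
  have "(ipf.nrm ?D)\<^sup>2 = Re (ip ?D ?D)" using D by (rule ipf.nrm_sq)
  also have "\<dots> \<le> cmod (ip ?D ?D)" by (rule complex_Re_le_cmod)
  also have "\<dots> \<le> cmod (S \<xi> ?D) + cmod (ip ?D ?D - S \<xi> ?D)" using norm_triangle_sub by blast
  also have "\<dots> \<le> ipf.nrm \<xi> * ipf.nrm ?D + ?d * ipf.nrm ?D"
    using S_bound[OF v D] step_ip[OF v D, of n] by linarith
  finally have ineq: "ipf.nrm ?D * ipf.nrm ?D \<le> (ipf.nrm \<xi> + ?d) * ipf.nrm ?D"
    by (simp add: power2_eq_square distrib_right)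
  show ?thesis
  proof (cases "ipf.nrm ?D = 0")
    case True
    then show ?thesis using v by simp
  next
    case False
    then show ?thesis using ineq ipf.nrm_nonneg[OF D] by (simp add: mult_le_cancel_right)
  qed
qed

lemma x_bound: "\<exists>K\<ge>0. \<forall>j<k. \<forall>l<k. \<forall>v\<in>M. n1 (x j l * v) \<le> K * n1 v"
proof -
  obtain K where K: "\<And>j l. K j l \<ge> 0" "\<And>j l v. v \<in> M \<Longrightarrow> n1 (x j l * v) \<le> K j l * n1 v"
    using T1.left_bound[OF x_M] by metis
  let ?K = "\<Sum>j<k. \<Sum>l<k. K j l"
  have "n1 (x j l * v) \<le> ?K * n1 v" if "j < k" "l < k" "v \<in> M" for j l v
  proof -
    have "K j l \<le> (\<Sum>l<k. K j l)" using K(1) that by (intro member_le_sum) auto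
    also have "\<dots> \<le> ?K"
      using K(1) that by (intro member_le_sum[where f = "\<lambda>j. \<Sum>l<k. K j l"]) (auto intro!: sum_nonneg)
    finally have "K j l * n1 v \<le> ?K * n1 v" using that by (intro mult_right_mono) auto
    then show ?thesis using K(2)[OF that(3), of j l] by linarith
  qed
  moreover have "?K \<ge> 0" using K(1) by (intro sum_nonneg) auto
  ultimately show ?thesis by blast
qed

definition Kx :: real where
  "Kx = (SOME K. K \<ge> 0 \<and> (\<forall>j<k. \<forall>l<k. \<forall>v\<in>M. n1 (x j l * v) \<le> K * n1 v))"

lemma Kx_nonneg [simp]: "Kx \<ge> 0"
  and Kx: "j < k \<Longrightarrow> l < k \<Longrightarrow> v \<in> M \<Longrightarrow> n1 (x j l * v) \<le> Kx * n1 v"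
  using someI_ex[OF x_bound] unfolding Kx_def by blast+

lemma n1_x_Vec:
  assumes "\<xi> \<in> Vec" "j < k" "j' < k" "l < k"
  shows "n1 (x j j' * \<xi> j' l) \<le> Kx * ipf.nrm \<xi>"
proof -
  have "n1 (x j j' * \<xi> j' l) \<le> Kx * n1 (\<xi> j' l)" using assms by (intro Kx) auto
  also have "\<dots> \<le> Kx * ipf.nrm \<xi>"
    using assms n2_le_nrm by (intro mult_left_mono) (auto simp: n_agree Vec_W)
  finally show ?thesis .
qed

lemma triple_sum_le:
  assumes "\<And>l j j'. l < k \<Longrightarrow> j < k \<Longrightarrow> j' < k \<Longrightarrow> cmod (g l j j') \<le> c"
  shows "cmod (\<Sum>l<k. \<Sum>j<k. \<Sum>j'<k. g l j j') \<le> (real k) ^ 3 * c"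
proof -
  have "cmod (\<Sum>l<k. \<Sum>j<k. \<Sum>j'<k. g l j j') \<le> (\<Sum>l<k. \<Sum>j<k. \<Sum>j'<k. cmod (g l j j'))"
    by (intro order_trans[OF norm_sum] sum_mono) simp
  also have "\<dots> \<le> (\<Sum>l<k. \<Sum>j<k. \<Sum>j'<k. c)" using assms by (intro sum_mono) auto
  also have "\<dots> = (real k) ^ 3 * c" by (simp add: power3_eq_cube mult.assoc)
  finally show ?thesis .
qed

lemma Q_bound:
  assumes v: "\<xi> \<in> Vec" and w: "\<eta> \<in> Vec"
  shows "cmod (Q \<xi> \<eta>) \<le> (real k) ^ 3 * (Kx * ipf.nrm \<xi> * ipf.nrm \<eta>)"
  unfolding Q_def
proof (rule triple_sum_le)
  fix l j j' assume jl: "l < k" "j < k" "j' < k"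
  have "cmod (tr1 (adj (\<eta> j l) * (x j j' * \<xi> j' l))) \<le> n1 (x j j' * \<xi> j' l) * n1 (\<eta> j l)"
    using v w by (intro T1.L2.Cauchy_Schwarz) auto
  also have "\<dots> \<le> Kx * ipf.nrm \<xi> * ipf.nrm \<eta>"
    using v w jl n1_x_Vec n2_le_nrm by (intro mult_mono) (auto simp: n_agree Vec_W)
  finally show "cmod (tr1 (adj (\<eta> j l) * (x j j' * \<xi> j' l))) \<le> Kx * ipf.nrm \<xi> * ipf.nrm \<eta>" .
qed

lemma step_Q:
  assumes v: "\<xi> \<in> Vec" and w: "\<eta> \<in> Vec"
  shows "cmod (Q (step n \<xi>) \<eta> - (Q \<xi> \<eta> - QT \<xi> \<eta>))
    \<le> (real k) ^ 3 * (inverse (real (Suc n)) * (Kx * ipf.nrm \<eta>))"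
proof -
  have tm: "tr1 (adj (\<eta> j l) * (x j j' * pr n (R \<xi> j' l)))
      = cnj (tr1 (adj (pr n (R \<xi> j' l)) * (x j' j * \<eta> j l)))" for j l j'
  proof -
    have "tr1 (adj (x j' j * \<eta> j l) * pr n (R \<xi> j' l))
        = cnj (tr1 (adj (pr n (R \<xi> j' l)) * (x j' j * \<eta> j l)))"
      using v w by (intro tr1_herm) auto
    then show ?thesis by (simp add: T1.adj_mult mult.assoc)
  qed
  have eq: "Q (step n \<xi>) \<eta> - (Q \<xi> \<eta> - QT \<xi> \<eta>) =
    (\<Sum>l<k. \<Sum>j<k. \<Sum>j'<k. cnj (pair (x j' j * \<eta> j l) (R \<xi> j' l) -
      tr1 (adj (pr n (R \<xi> j' l)) * (x j' j * \<eta> j l))))"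
    using v w by (simp add: Q_def QT_def step_def right_diff_distrib T1.tr_minus sum_subtractf tm)
  show ?thesis unfolding eq
  proof (rule triple_sum_le)
    fix l j j' assume jl: "l < k" "j < k" "j' < k"
    have "cmod (tr1 (adj (pr n (R \<xi> j' l)) * (x j' j * \<eta> j l)) - pair (x j' j * \<eta> j l) (R \<xi> j' l))
        \<le> inverse (real (Suc n)) * n1 (x j' j * \<eta> j l)"
      using v w by (intro pair_close pr_R) auto
    also have "\<dots> \<le> inverse (real (Suc n)) * (Kx * ipf.nrm \<eta>)"
      using w jl by (intro mult_left_mono n1_x_Vec) auto
    finally show "cmod (cnj (pair (x j' j * \<eta> j l) (R \<xi> j' l) - tr1 (adj (pr n (R \<xi> j' l)) * (x j' j * \<eta> j l))))
      \<le> inverse (real (Suc n)) * (Kx * ipf.nrm \<eta>)"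
      by (simp only: complex_mod_cnj norm_minus_commute)
  qed
qed

lemma QT_sum:
  assumes v: "\<xi> \<in> Vec" and w: "\<eta> \<in> Vec"
  shows "QT \<xi> \<eta> = (\<Sum>l<k. \<Sum>l'<k. \<Sum>j<k. \<Sum>j'<k. cnj (pair (adj (\<xi> j' l') * x j' j * \<eta> j l) (y l' l)))"
proof -
  have t: "cnj (pair (x j' j * \<eta> j l) (R \<xi> j' l)) =
      (\<Sum>l'<k. cnj (pair (adj (\<xi> j' l') * x j' j * \<eta> j l) (y l' l)))" for l j j'
  proof -
    have "pair (x j' j * \<eta> j l) (R \<xi> j' l) = (\<Sum>l'<k. pair (x j' j * \<eta> j l) (\<xi> j' l' * y l' l))"
      unfolding R_def using v w by (intro pair_sum_right) auto
    also have "\<dots> = (\<Sum>l'<k. pair (adj (\<xi> j' l') * (x j' j * \<eta> j l)) (y l' l))"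
      using v w pair_shift_left[of "x j' j * \<eta> j l" "y _ l" "adj (\<xi> j' _)"] by (intro sum.cong HOL.refl) (simp add: Vec_W)
    finally show ?thesis by (simp add: mult.assoc)
  qed
  have "QT \<xi> \<eta> = (\<Sum>l<k. \<Sum>j<k. \<Sum>j'<k. \<Sum>l'<k. cnj (pair (adj (\<xi> j' l') * x j' j * \<eta> j l) (y l' l)))"
    unfolding QT_def t ..
  also have "\<dots> = (\<Sum>l<k. \<Sum>j<k. \<Sum>l'<k. \<Sum>j'<k. cnj (pair (adj (\<xi> j' l') * x j' j * \<eta> j l) (y l' l)))"
    by (intro sum.cong HOL.refl sum.swap)
  also have "\<dots> = (\<Sum>l<k. \<Sum>l'<k. \<Sum>j<k. \<Sum>j'<k. cnj (pair (adj (\<xi> j' l') * x j' j * \<eta> j l) (y l' l)))"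
    by (intro sum.cong HOL.refl sum.swap)
  finally show ?thesis .
qed

text \<open>This is the commutation of the two actions. After the entries of one array are moved to the other side
by the module property of \<open>pair\<close>, both sides are the same sum over all four indices.\<close>

lemma QT_herm:
  assumes v: "\<xi> \<in> Vec" and w: "\<eta> \<in> Vec"
  shows "QT \<eta> \<xi> = cnj (QT \<xi> \<eta>)"
proof -
  have t: "pair (adj (\<eta> j' l') * x j' j * \<xi> j l) (y l' l) = cnj (pair (adj (\<xi> j l) * x j j' * \<eta> j' l') (y l l'))" for j j' l l'
    using pair_adj[of "adj (\<xi> j l) * x j j' * \<eta> j' l'" "y l l'"] v w by (simp add: T1.adj_mult mult.assoc)
  have "QT \<eta> \<xi> = (\<Sum>l<k. \<Sum>l'<k. \<Sum>j<k. \<Sum>j'<k. pair (adj (\<xi> j l) * x j j' * \<eta> j' l') (y l l'))"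
    unfolding QT_sum[OF w v] t complex_cnj_cnj ..
  also have "\<dots> = (\<Sum>l'<k. \<Sum>l<k. \<Sum>j<k. \<Sum>j'<k. pair (adj (\<xi> j l) * x j j' * \<eta> j' l') (y l l'))"
    by (rule sum.swap)
  also have "\<dots> = (\<Sum>l'<k. \<Sum>l<k. \<Sum>j'<k. \<Sum>j<k. pair (adj (\<xi> j l) * x j j' * \<eta> j' l') (y l l'))"
    by (intro sum.cong HOL.refl sum.swap)
  also have "\<dots> = cnj (QT \<xi> \<eta>)"
    unfolding QT_sum[OF v w] cnj_sum complex_cnj_cnj ..
  finally show ?thesis .
qed

text \<open>The contraction approximated by \<open>step\<close> is symmetric for \<open>Q\<close>. The error involves only the
\<open>L\<^sup>2\<close>-norms of the arrays, not their operator norms, which may grow along the iteration.\<close>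

lemma step_Q_symmetric:
  assumes v: "\<xi> \<in> Vec" and w: "\<eta> \<in> Vec"
  shows "cmod (Q (step n \<xi>) \<eta> - Q \<xi> (step n \<eta>))
    \<le> (real k) ^ 3 * Kx * (ipf.nrm \<xi> + ipf.nrm \<eta>) * inverse (real (Suc n))"
proof -
  let ?c = "(real k) ^ 3" and ?d = "inverse (real (Suc n))"
  have 1: "cmod (Q (step n \<xi>) \<eta> - (Q \<xi> \<eta> - QT \<xi> \<eta>)) \<le> ?c * (?d * (Kx * ipf.nrm \<eta>))"
    by (rule step_Q[OF v w])
  have "Q \<xi> (step n \<eta>) - (Q \<xi> \<eta> - QT \<xi> \<eta>) = cnj (Q (step n \<eta>) \<xi> - (Q \<eta> \<xi> - QT \<eta> \<xi>))"
    using v w Q_herm[of "step n \<eta>" \<xi>] Q_herm[of \<xi> \<eta>] QT_herm[of \<xi> \<eta>] by simp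
  then have 2: "cmod (Q \<xi> (step n \<eta>) - (Q \<xi> \<eta> - QT \<xi> \<eta>)) \<le> ?c * (?d * (Kx * ipf.nrm \<xi>))"
    using step_Q[OF w v, of n] by (simp only: complex_mod_cnj)
  have "cmod (Q (step n \<xi>) \<eta> - Q \<xi> (step n \<eta>)) \<le> ?c * (?d * (Kx * ipf.nrm \<eta>)) + ?c * (?d * (Kx * ipf.nrm \<xi>))"
    using norm_triangle_ineq4[of "Q (step n \<xi>) \<eta> - (Q \<xi> \<eta> - QT \<xi> \<eta>)" "Q \<xi> (step n \<eta>) - (Q \<xi> \<eta> - QT \<xi> \<eta>)"] 1 2
    by simp
  then show ?thesis by (simp add: algebra_simps)
qed

text \<open>The diagonal array reads off \<open>\<Sum>\<^sub>j\<^sub>l pair (x j l) (y j l)\<close>, up to conjugation, as the value of \<open>QT\<close>.\<close>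

definition \<zeta> :: "nat \<Rightarrow> nat \<Rightarrow> 'x" where "\<zeta> = (\<lambda>j l. if j = l then e else 0)"

lemma zeta_Vec [simp]: "\<zeta> \<in> Vec"
  by (simp add: Vec_def \<zeta>_def)

lemma R_zeta: "j < k \<Longrightarrow> R \<zeta> j l = y j l"
proof -
  assume j: "j < k"
  have "R \<zeta> j l = (\<Sum>l'<k. if j = l' then y l' l else 0)"
    unfolding R_def \<zeta>_def by (intro sum.cong HOL.refl) simp
  then show ?thesis using j by simp
qed

lemma QT_zeta: "QT \<zeta> \<zeta> = cnj (\<Sum>j<k. \<Sum>l<k. pair (x j l) (y j l))"
proof -
  have z: "pair 0 b = 0" if "b \<in> M" for b using pair_scl_left[of 0 b 0] that by simp
  have "QT \<zeta> \<zeta> = (\<Sum>l<k. \<Sum>j<k. \<Sum>j'<k. if j = l then cnj (pair (x j' j) (y j' l)) else 0)"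
    unfolding QT_def
    by (intro sum.cong HOL.refl) (simp add: R_zeta, simp add: \<zeta>_def z)
  also have "\<dots> = (\<Sum>l<k. \<Sum>j<k. if j = l then (\<Sum>j'<k. cnj (pair (x j' j) (y j' l))) else 0)"
    by (intro sum.cong HOL.refl) simp
  also have "\<dots> = (\<Sum>l<k. \<Sum>j'<k. cnj (pair (x j' l) (y j' l)))" by simp
  also have "\<dots> = (\<Sum>j'<k. \<Sum>l<k. cnj (pair (x j' l) (y j' l)))" by (rule sum.swap)
  finally show ?thesis by (simp add: cnj_sum)
qed

definition iter :: "nat \<Rightarrow> nat \<Rightarrow> nat \<Rightarrow> nat \<Rightarrow> 'x" where "iter n i = (step n ^^ i) \<zeta>"

lemma iter_Vec [simp]: "iter n i \<in> Vec"
  unfolding iter_def by (induction i) auto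

lemma iter_Suc: "iter n (Suc i) = step n (iter n i)" and iter_0 [simp]: "iter n 0 = \<zeta>"
  by (simp_all add: iter_def)

lemma iter_nrm: "ipf.nrm (iter n i) \<le> ipf.nrm \<zeta> + real i * (real k)\<^sup>2 * inverse (real (Suc n))"
proof (induction i)
  case 0
  then show ?case by simp
next
  case (Suc i)
  then show ?case using step_nrm[OF iter_Vec, of n n i] by (simp add: iter_Suc algebra_simps)
qed

lemma iter_nrm': "ipf.nrm (iter n i) \<le> ipf.nrm \<zeta> + real i * (real k)\<^sup>2"
proof -
  have "real i * (real k)\<^sup>2 * inverse (real (Suc n)) \<le> real i * (real k)\<^sup>2 * 1"
    by (intro mult_left_mono) (auto simp: field_simps)
  then show ?thesis using iter_nrm[of n i] by simp
qed

text \<open>The vectors \<open>iter n j\<close> approximate \<open>S\<^sup>j \<zeta>\<close> as \<open>n\<close> grows. In the limit along an ultrafilter the errors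
vanish and the numbers \<open>H i j = Q(S\<^sup>i \<zeta>, S\<^sup>j \<zeta>)\<close> depend only on \<open>i + j\<close> by symmetry. Hence
Cauchy-Schwarz for \<open>Q\<close> is the hypothesis of \<open>power_doubling_bound\<close>, whose conclusion \<open>H 1 0 \<le> H 0 0\<close>
means that \<open>QT \<zeta> \<zeta> = Q(\<zeta>, \<zeta>) - Q(S \<zeta>, \<zeta>)\<close> has nonnegative real part.\<close>

theorem kernel_positivity: "0 \<le> Re (\<Sum>j<k. \<Sum>l<k. pair (x j l) (y j l))"
proof -
  obtain U :: "nat filter" where U: "U \<le> sequentially" "ultra U"
    using ultra_exists[OF sequentially_bot] by blast
  have nb: "U \<noteq> bot" using U(2) by (simp add: ultra_def)
  define N where "N = (\<lambda>i. ipf.nrm \<zeta> + real i * (real k)\<^sup>2)"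
  have N: "ipf.nrm (iter n i) \<le> N i" "0 \<le> N i" for n i
    using iter_nrm'[of n i] by (auto simp: N_def)
  define c where "c = (real k) ^ 3 * Kx"
  have c0: "0 \<le> c" by (simp add: c_def)
  define H where "H = (\<lambda>i j. Lim U (\<lambda>n. Q (iter n i) (iter n j)))"
  have H: "((\<lambda>n. Q (iter n i) (iter n j)) \<longlongrightarrow> H i j) U" for i j
    unfolding H_def
  proof (rule ultra_tendsto_Lim[OF U(2), where B = "c * (N i * N j)"])
    fix n
    have "cmod (Q (iter n i) (iter n j)) \<le> c * (ipf.nrm (iter n i) * ipf.nrm (iter n j))"
      using Q_bound[OF iter_Vec iter_Vec, of n i n j] by (simp add: c_def mult.assoc)
    also have "\<dots> \<le> c * (N i * N j)" using c0 N by (intro mult_left_mono mult_mono) auto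
    finally show "cmod (Q (iter n i) (iter n j)) \<le> c * (N i * N j)" .
  qed
  have null: "((\<lambda>n. K * inverse (real (Suc n))) \<longlongrightarrow> 0) U" for K
    using tendsto_mono[OF U(1) inverse_Suc_null] .
  have shift: "H (Suc i) j = H i (Suc j)" for i j
  proof -
    have "((\<lambda>n. Q (iter n (Suc i)) (iter n j) - Q (iter n i) (iter n (Suc j))) \<longlongrightarrow> 0) U"
    proof (rule tendsto_0_le[OF null[of "c * (N i + N j)"], where K = 1], rule always_eventually, rule allI)
      fix n
      have "cmod (Q (iter n (Suc i)) (iter n j) - Q (iter n i) (iter n (Suc j)))
          \<le> c * (ipf.nrm (iter n i) + ipf.nrm (iter n j)) * inverse (real (Suc n))"
        using step_Q_symmetric[OF iter_Vec iter_Vec, of n n i n j] by (simp only: iter_Suc c_def)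
      also have "\<dots> \<le> c * (N i + N j) * inverse (real (Suc n))"
        using c0 N by (intro mult_right_mono mult_left_mono add_mono) auto
      finally have a: "cmod (Q (iter n (Suc i)) (iter n j) - Q (iter n i) (iter n (Suc j)))
          \<le> c * (N i + N j) * inverse (real (Suc n))" .
      show "cmod (Q (iter n (Suc i)) (iter n j) - Q (iter n i) (iter n (Suc j)))
          \<le> norm (c * (N i + N j) * inverse (real (Suc n))) * 1"
        unfolding mult_1_right real_norm_def by (rule order_trans[OF a abs_ge_self])
    qed
    moreover have "((\<lambda>n. Q (iter n (Suc i)) (iter n j) - Q (iter n i) (iter n (Suc j)))
        \<longlongrightarrow> H (Suc i) j - H i (Suc j)) U" by (intro tendsto_diff H)
    ultimately show ?thesis using tendsto_unique[OF nb] by fastforce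
  qed
  have hankel: "H i j = H (i + j) 0" for i j
  proof (induction j arbitrary: i)
    case (Suc j)
    have "H i (Suc j) = H (Suc i) j" by (rule shift[symmetric])
    also have "\<dots> = H (Suc i + j) 0" by (rule Suc)
    finally show ?case by simp
  qed simp
  have "Re (H 1 0) \<le> Re (H 0 0)"
  proof (rule power_doubling_bound[where H = "\<lambda>j. Re (H j 0)"])
    fix j
    have "(Re (H j 0))\<^sup>2 \<le> Re (H j j) * Re (H 0 0)"
    proof (rule tendsto_le[OF nb])
      show "((\<lambda>n. (Re (Q (iter n j) (iter n 0)))\<^sup>2) \<longlongrightarrow> (Re (H j 0))\<^sup>2) U"
        by (intro tendsto_power tendsto_Re H)
      show "((\<lambda>n. Re (Q (iter n j) (iter n j)) * Re (Q (iter n 0) (iter n 0))) \<longlongrightarrow> Re (H j j) * Re (H 0 0)) U"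
        by (intro tendsto_mult tendsto_Re H)
      have "(Re (Q (iter n j) (iter n 0)))\<^sup>2 \<le> Re (Q (iter n j) (iter n j)) * Re (Q (iter n 0) (iter n 0))" for n
      proof -
        have "(Re (Q (iter n j) (iter n 0)))\<^sup>2 \<le> (cmod (Q (iter n j) (iter n 0)))\<^sup>2"
          by (simp add: cmod_power2)
        also have "\<dots> \<le> (Qf.nrm (iter n j) * Qf.nrm (iter n 0))\<^sup>2"
          by (intro power_mono Qf.Cauchy_Schwarz) simp_all
        also have "\<dots> = Re (Q (iter n j) (iter n j)) * Re (Q (iter n 0) (iter n 0))"
          by (simp only: power_mult_distrib Qf.nrm_sq iter_Vec)
        finally show ?thesis .
      qed
      then show "eventually (\<lambda>n. (Re (Q (iter n j) (iter n 0)))\<^sup>2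
          \<le> Re (Q (iter n j) (iter n j)) * Re (Q (iter n 0) (iter n 0))) U" by simp
    qed
    then show "(Re (H j 0))\<^sup>2 \<le> Re (H (2 * j) 0) * Re (H 0 0)"
      using hankel[of j j] by (simp add: mult_2)
  next
    fix j
    (* The bound must not depend on \<open>j\<close>: the error accumulated in \<open>j\<close> steps disappears
       in the limit, because \<open>j\<close> is fixed while \<open>n\<close> grows. *)
    show "Re (H j 0) \<le> c * ((ipf.nrm \<zeta> + 0) * ipf.nrm \<zeta>)"
    proof (rule tendsto_le[OF nb])
      show "((\<lambda>n. Re (Q (iter n j) (iter n 0))) \<longlongrightarrow> Re (H j 0)) U" by (intro tendsto_Re H)
      show "((\<lambda>n. c * ((ipf.nrm \<zeta> + real j * (real k)\<^sup>2 * inverse (real (Suc n))) * ipf.nrm \<zeta>))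
          \<longlongrightarrow> c * ((ipf.nrm \<zeta> + 0) * ipf.nrm \<zeta>)) U"
        by (intro tendsto_mult tendsto_add tendsto_const null)
      have "Re (Q (iter n j) (iter n 0)) \<le> c * ((ipf.nrm \<zeta> + real j * (real k)\<^sup>2 * inverse (real (Suc n))) * ipf.nrm \<zeta>)" for n
      proof -
        have "Re (Q (iter n j) (iter n 0)) \<le> cmod (Q (iter n j) \<zeta>)"
          using complex_Re_le_cmod by simp
        also have "\<dots> \<le> c * (ipf.nrm (iter n j) * ipf.nrm \<zeta>)"
          using Q_bound[OF iter_Vec zeta_Vec, of n j] by (simp add: c_def mult.assoc)
        also have "\<dots> \<le> c * ((ipf.nrm \<zeta> + real j * (real k)\<^sup>2 * inverse (real (Suc n))) * ipf.nrm \<zeta>)"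
          using c0 iter_nrm by (intro mult_left_mono mult_right_mono) auto
        finally show ?thesis .
      qed
      then show "eventually (\<lambda>n. Re (Q (iter n j) (iter n 0))
          \<le> c * ((ipf.nrm \<zeta> + real j * (real k)\<^sup>2 * inverse (real (Suc n))) * ipf.nrm \<zeta>)) U" by simp
    qed
  next
    have "((\<lambda>n. Q (iter n 0) (iter n 0)) \<longlongrightarrow> Q \<zeta> \<zeta>) U" by simp
    then have "H 0 0 = Q \<zeta> \<zeta>" using tendsto_unique[OF nb H] by blast
    then show "0 \<le> Re (H 0 0)" using Q_pos by simp
  qed
  moreover have "H 0 0 = Q \<zeta> \<zeta>"
  proof -
    have "((\<lambda>n. Q (iter n 0) (iter n 0)) \<longlongrightarrow> Q \<zeta> \<zeta>) U" by simp
    then show ?thesis using tendsto_unique[OF nb H] by blast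
  qed
  moreover have "H 1 0 = Q \<zeta> \<zeta> - QT \<zeta> \<zeta>"
  proof -
    have "((\<lambda>n. Q (iter n 1) (iter n 0) - (Q \<zeta> \<zeta> - QT \<zeta> \<zeta>)) \<longlongrightarrow> 0) U"
    proof (rule tendsto_0_le[OF null[of "c * ipf.nrm \<zeta>"], where K = 1], rule always_eventually, rule allI)
      fix n
      have a: "cmod (Q (iter n 1) (iter n 0) - (Q \<zeta> \<zeta> - QT \<zeta> \<zeta>)) \<le> c * ipf.nrm \<zeta> * inverse (real (Suc n))"
        using step_Q[OF zeta_Vec zeta_Vec, of n] by (simp add: iter_def c_def ac_simps)
      show "cmod (Q (iter n 1) (iter n 0) - (Q \<zeta> \<zeta> - QT \<zeta> \<zeta>))
          \<le> norm (c * ipf.nrm \<zeta> * inverse (real (Suc n))) * 1"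
        unfolding mult_1_right real_norm_def by (rule order_trans[OF a abs_ge_self])
    qed
    moreover have "((\<lambda>n. Q (iter n 1) (iter n 0) - (Q \<zeta> \<zeta> - QT \<zeta> \<zeta>))
        \<longlongrightarrow> H 1 0 - (Q \<zeta> \<zeta> - QT \<zeta> \<zeta>)) U" by (intro tendsto_diff H tendsto_const)
    ultimately show ?thesis using tendsto_unique[OF nb] by fastforce
  qed
  ultimately have "0 \<le> Re (QT \<zeta> \<zeta>)" by simp
  then show ?thesis unfolding QT_zeta by simp
qed

end

context tracial_pair
begin

text \<open>The normalization of \<open>y\<close> is removed by scaling with a small positive constant \<open>c\<close>.\<close>

lemma pair_kernel_pos:
  fixes x y :: "nat \<Rightarrow> nat \<Rightarrow> 'x"
  assumes x_M: "\<And>j l. x j l \<in> M" and y_M: "\<And>j l. y j l \<in> M"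
    and x_adj: "\<And>j l. adj (x j l) = x l j" and y_adj: "\<And>j l. adj (y j l) = y l j"
    and x_pos: "\<And>\<xi>. (\<And>j. \<xi> j \<in> W) \<Longrightarrow> 0 \<le> Re (\<Sum>j<k. \<Sum>l<k. tr1 (adj (\<xi> j) * (x j l * \<xi> l)))"
    and y_pos: "\<And>\<xi>. (\<And>j. \<xi> j \<in> W) \<Longrightarrow> 0 \<le> Re (\<Sum>j<k. \<Sum>l<k. tr2 (adj (\<xi> j) * (y j l * \<xi> l)))"
  shows "0 \<le> Re (\<Sum>j<k. \<Sum>l<k. pair (x j l) (y j l))"
proof -
  obtain K where K: "\<And>j l. K j l \<ge> 0" "\<And>j l v. v \<in> M \<Longrightarrow> n2 (y j l * v) \<le> K j l * n2 v"
    using T2.left_bound[OF y_M] by metis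
  let ?K = "\<Sum>j<k. \<Sum>l<k. K j l"
  have K0: "?K \<ge> 0" using K(1) by (intro sum_nonneg) auto
  define c where "c = inverse (?K + 1)"
  have c: "c > 0" "c * ?K \<le> 1" using K0 by (auto simp: c_def field_simps)
  define y' where "y' = (\<lambda>j l. scl (complex_of_real c) (y j l))"
  have le: "Re (\<Sum>j<k. \<Sum>l<k. tr2 (adj (\<xi> j) * (y j l * \<xi> l))) \<le> ?K * Re (\<Sum>j<k. tr2 (adj (\<xi> j) * \<xi> j))"
    if \<xi>: "\<And>j. \<xi> j \<in> W" for \<xi>
  proof -
    let ?s = "\<Sum>j<k. (n2 (\<xi> j))\<^sup>2"
    have \<xi>M: "\<xi> j \<in> M" for j using \<xi> W_sub by blast
    have t: "Re (tr2 (adj (\<xi> j) * (y j l * \<xi> l))) \<le> K j l * ?s" if "j < k" "l < k" for j l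
    proof -
      have "Re (tr2 (adj (\<xi> j) * (y j l * \<xi> l))) \<le> cmod (tr2 (adj (\<xi> j) * (y j l * \<xi> l)))"
        by (rule complex_Re_le_cmod)
      also have "\<dots> \<le> n2 (y j l * \<xi> l) * n2 (\<xi> j)"
        using \<xi>M y_M by (intro T2.L2.Cauchy_Schwarz) auto
      also have "\<dots> \<le> K j l * n2 (\<xi> l) * n2 (\<xi> j)"
        using \<xi>M by (intro mult_right_mono K) auto
      also have "\<dots> = K j l * (n2 (\<xi> l) * n2 (\<xi> j))" by simp
      also have "\<dots> \<le> K j l * ?s"
      proof (rule mult_left_mono[OF _ K(1)])
        have sl: "(n2 (\<xi> i))\<^sup>2 \<le> ?s" if "i < k" for i
          using that by (intro member_le_sum) auto
        have "n2 (\<xi> l) \<le> sqrt ?s" "n2 (\<xi> j) \<le> sqrt ?s"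
          using sl that real_le_rsqrt by auto
        then have "n2 (\<xi> l) * n2 (\<xi> j) \<le> sqrt ?s * sqrt ?s"
          using \<xi> by (intro mult_mono) (auto intro: sum_nonneg)
        then show "n2 (\<xi> l) * n2 (\<xi> j) \<le> ?s" by (simp add: sum_nonneg)
      qed
      finally show ?thesis .
    qed
    have "Re (\<Sum>j<k. \<Sum>l<k. tr2 (adj (\<xi> j) * (y j l * \<xi> l))) \<le> (\<Sum>j<k. \<Sum>l<k. K j l * ?s)"
      unfolding Re_sum using t by (intro sum_mono) auto
    also have "\<dots> = ?K * ?s" by (simp only: sum_distrib_right)
    also have "?s = Re (\<Sum>j<k. tr2 (adj (\<xi> j) * \<xi> j))"
      using \<xi>M by (simp add: T2.L2.nrm_sq)
    finally show ?thesis .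
  qed
  have sc: "(\<Sum>j<k. \<Sum>l<k. tr2 (adj (\<xi> j) * (y' j l * \<xi> l)))
      = complex_of_real c * (\<Sum>j<k. \<Sum>l<k. tr2 (adj (\<xi> j) * (y j l * \<xi> l)))"
    if \<xi>: "\<And>j. \<xi> j \<in> W" for \<xi>
  proof -
    have \<xi>M: "\<xi> j \<in> M" for j using \<xi> W_sub by blast
    show ?thesis unfolding y'_def using \<xi>M y_M
      by (simp add: T1.scl_mult_left T1.scl_mult_right T2.tr_scl sum_distrib_left)
  qed
  interpret kp: kernel_pair scl adj M tr1 tr2 W e k x y'
  proof
    fix \<xi> :: "nat \<Rightarrow> 'x" assume \<xi>: "\<And>j. \<xi> j \<in> W"
    let ?s = "\<Sum>j<k. \<Sum>l<k. tr2 (adj (\<xi> j) * (y j l * \<xi> l))"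
    let ?i = "Re (\<Sum>j<k. tr2 (adj (\<xi> j) * \<xi> j))"
    show "0 \<le> Re (\<Sum>j<k. \<Sum>l<k. tr2 (adj (\<xi> j) * (y' j l * \<xi> l)))"
      unfolding sc[OF \<xi>] using y_pos[OF \<xi>] c(1) by simp
    have i: "0 \<le> ?i" unfolding Re_sum using \<xi> W_sub by (intro sum_nonneg T2.tr_pos) auto
    have "c * Re ?s \<le> c * (?K * ?i)" using le[OF \<xi>] c(1) by (intro mult_left_mono) auto
    also have "\<dots> = (c * ?K) * ?i" by simp
    also have "\<dots> \<le> 1 * ?i" using c(2) i by (intro mult_right_mono) auto
    finally show "Re (\<Sum>j<k. \<Sum>l<k. tr2 (adj (\<xi> j) * (y' j l * \<xi> l))) \<le> ?i"
      unfolding sc[OF \<xi>] by simp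
  qed (use x_M y_M x_adj y_adj x_pos in \<open>auto simp: y'_def T1.adj_scl\<close>)
  have "(\<Sum>j<k. \<Sum>l<k. pair (x j l) (y' j l)) = complex_of_real c * (\<Sum>j<k. \<Sum>l<k. pair (x j l) (y j l))"
    unfolding y'_def using x_M y_M by (simp add: pair_scl_right sum_distrib_left)
  then show ?thesis using kp.kernel_positivity c(1) by (simp add: zero_le_mult_iff)
qed


lemma pair_zero_left: "y \<in> M \<Longrightarrow> pair 0 y = 0"
  using pair_scl_left[of 0 y 0] by simp

lemma pair_null_left:
  assumes x: "x \<in> M" "n1 x = 0" and y: "y \<in> M"
  shows "pair x y = 0"
proof -
  have "tr1 (adj (pr n y) * x) = 0" for n
    using T1.L2.Cauchy_Schwarz[of x "pr n y"] x approx_M[OF pr_approx[OF y]] by simp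
  then have "(\<lambda>n. 0) \<longlonglongrightarrow> pair x y" using pair_LIMSEQ[OF y x(1)] by simp
  then show ?thesis by (simp add: LIMSEQ_const_iff)
qed

lemma pair_null_right:
  assumes x: "x \<in> M" and y: "y \<in> M" "n2 y = 0"
  shows "pair x y = 0"
proof -
  have "approx 0 0 y"
    unfolding approx_def using T2.L2.Cauchy_Schwarz[OF y(1)] y W_sub by simp
  then show ?thesis using pair_close[of 0 0 y x] x y by simp
qed

text \<open>The coupling only sees elements up to null vectors of the two traces. This makes it insensitive to
the entries of a family outside a set on which an ultrafilter is concentrated.\<close>

lemma pair_cong:
  assumes "x \<in> M" "x' \<in> M" "y \<in> M" "y' \<in> M" "n1 (x - x') = 0" "n2 (y - y') = 0"
  shows "pair x y = pair x' y'"
proof -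
  have "pair x y = pair x' y + pair (x - x') y"
    using pair_add_left[of x' "x - x'" y] assms by simp
  also have "pair (x - x') y = 0" using assms by (intro pair_null_left) auto
  also have "pair x' y = pair x' y' + pair x' (y - y')"
    using pair_add_right[of x' y' "y - y'"] assms by simp
  also have "pair x' (y - y') = 0" using assms by (intro pair_null_right) auto
  finally show ?thesis by simp
qed

lemma pair_minus_left: "x \<in> M \<Longrightarrow> x' \<in> M \<Longrightarrow> y \<in> M \<Longrightarrow> pair (x - x') y = pair x y - pair x' y"
  using pair_add_left[of "x - x'" x' y] by simp

lemma pair_minus_right: "x \<in> M \<Longrightarrow> y \<in> M \<Longrightarrow> y' \<in> M \<Longrightarrow> pair x (y - y') = pair x y - pair x y'"
  using pair_add_right[of x "y - y'" y'] by simp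

text \<open>The squared length of the formal sum of the tensors \<open>p\<^sub>j \<otimes> q\<^sub>j\<close> for the functional induced by \<open>pair\<close>.\<close>

definition gram :: "nat \<Rightarrow> (nat \<Rightarrow> 'x) \<Rightarrow> (nat \<Rightarrow> 'x) \<Rightarrow> real" where
  "gram k p q = Re (\<Sum>j<k. \<Sum>l<k. pair (adj (p j) * p l) (adj (q j) * q l))"


lemma gram_nonneg:
  assumes p: "\<And>j. p j \<in> M" and q: "\<And>j. q j \<in> M"
  shows "0 \<le> gram k p q"
  unfolding gram_def
proof (rule pair_kernel_pos)
  fix \<xi> :: "nat \<Rightarrow> 'x" assume "\<And>j. \<xi> j \<in> W"
  then have \<xi>: "\<And>j. \<xi> j \<in> M" using W_sub by blast
  show "0 \<le> Re (\<Sum>j<k. \<Sum>l<k. tr1 (adj (\<xi> j) * ((adj (p j) * p l) * \<xi> l)))"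
    unfolding T1.gram_tr[OF p \<xi>] by simp
  show "0 \<le> Re (\<Sum>j<k. \<Sum>l<k. tr2 (adj (\<xi> j) * ((adj (q j) * q l) * \<xi> l)))"
    unfolding T2.gram_tr[OF q \<xi>] by simp
qed (use p q in \<open>auto simp: T1.adj_mult\<close>)


text \<open>Left multiplication by \<open>c\<close> is bounded for this length: the difference of the two sides is the value of
the coupling at the positive kernel of \<open>diff_kernel\<close> and a Gram kernel. The next lemma is the same for
the other factor.\<close>

lemma gram_left:
  assumes c: "c \<in> M" and K: "K \<ge> 0" "\<And>y. y \<in> M \<Longrightarrow> n1 (c * y) \<le> K * n1 y"
    and p: "\<And>j. p j \<in> M" and q: "\<And>j. q j \<in> M"
  shows "gram k (\<lambda>j. c * p j) q \<le> K\<^sup>2 * gram k p q"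
proof -
  let ?r = "complex_of_real (K\<^sup>2)"
  have "0 \<le> Re (\<Sum>j<k. \<Sum>l<k. pair (scl ?r (adj (p j) * p l) - adj (c * p j) * (c * p l)) (adj (q j) * q l))"
  proof (rule pair_kernel_pos)
    fix \<xi> :: "nat \<Rightarrow> 'x" assume "\<And>j. \<xi> j \<in> W"
    then have \<xi>: "\<And>j. \<xi> j \<in> M" using W_sub by blast
    show "0 \<le> Re (\<Sum>j<k. \<Sum>l<k. tr1 (adj (\<xi> j) *
      ((scl ?r (adj (p j) * p l) - adj (c * p j) * (c * p l)) * \<xi> l)))"
      by (rule T1.diff_kernel[OF c K p \<xi>])
    show "0 \<le> Re (\<Sum>j<k. \<Sum>l<k. tr2 (adj (\<xi> j) * ((adj (q j) * q l) * \<xi> l)))"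
      unfolding T2.gram_tr[OF q \<xi>] by simp
  qed (use p q c in \<open>auto simp: T1.adj_mult T1.adj_minus T1.adj_scl mult.assoc simp del: of_real_power\<close>)
  also have "(\<Sum>j<k. \<Sum>l<k. pair (scl ?r (adj (p j) * p l) - adj (c * p j) * (c * p l)) (adj (q j) * q l))
    = ?r * (\<Sum>j<k. \<Sum>l<k. pair (adj (p j) * p l) (adj (q j) * q l))
      - (\<Sum>j<k. \<Sum>l<k. pair (adj (c * p j) * (c * p l)) (adj (q j) * q l))"
    using p q c by (simp add: pair_minus_left pair_scl_left sum_subtractf sum_distrib_left del: of_real_power)
  finally show ?thesis by (simp add: gram_def del: of_real_power)
qed

lemma gram_right:
  assumes c: "c \<in> M" and K: "K \<ge> 0" "\<And>y. y \<in> M \<Longrightarrow> n2 (c * y) \<le> K * n2 y"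
    and p: "\<And>j. p j \<in> M" and q: "\<And>j. q j \<in> M"
  shows "gram k p (\<lambda>j. c * q j) \<le> K\<^sup>2 * gram k p q"
proof -
  let ?r = "complex_of_real (K\<^sup>2)"
  have "0 \<le> Re (\<Sum>j<k. \<Sum>l<k. pair (adj (p j) * p l) (scl ?r (adj (q j) * q l) - adj (c * q j) * (c * q l)))"
  proof (rule pair_kernel_pos)
    fix \<xi> :: "nat \<Rightarrow> 'x" assume "\<And>j. \<xi> j \<in> W"
    then have \<xi>: "\<And>j. \<xi> j \<in> M" using W_sub by blast
    show "0 \<le> Re (\<Sum>j<k. \<Sum>l<k. tr2 (adj (\<xi> j) *
      ((scl ?r (adj (q j) * q l) - adj (c * q j) * (c * q l)) * \<xi> l)))"
      by (rule T2.diff_kernel[OF c K q \<xi>])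
    show "0 \<le> Re (\<Sum>j<k. \<Sum>l<k. tr1 (adj (\<xi> j) * ((adj (p j) * p l) * \<xi> l)))"
      unfolding T1.gram_tr[OF p \<xi>] by simp
  qed (use p q c in \<open>auto simp: T1.adj_mult T1.adj_minus T1.adj_scl mult.assoc simp del: of_real_power\<close>)
  also have "(\<Sum>j<k. \<Sum>l<k. pair (adj (p j) * p l) (scl ?r (adj (q j) * q l) - adj (c * q j) * (c * q l)))
    = ?r * (\<Sum>j<k. \<Sum>l<k. pair (adj (p j) * p l) (adj (q j) * q l))
      - (\<Sum>j<k. \<Sum>l<k. pair (adj (p j) * p l) (adj (c * q j) * (c * q l)))"
    using p q c by (simp add: pair_minus_right pair_scl_right sum_subtractf sum_distrib_left del: of_real_power)
  finally show ?thesis by (simp add: gram_def del: of_real_power)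
qed

end

section \<open>The star-algebra structure of the algebraic tensor product\<close>

locale star_algebra =
  fixes A :: "('a, 'm) star_alg_scheme" (structure)
  assumes zero_closed [simp]: "\<zero> \<in> carrier A"
    and one_closed [simp]: "\<one> \<in> carrier A"
    and add_closed [simp]: "a \<in> carrier A \<Longrightarrow> b \<in> carrier A \<Longrightarrow> a \<oplus> b \<in> carrier A"
    and mult_closed [simp]: "a \<in> carrier A \<Longrightarrow> b \<in> carrier A \<Longrightarrow> a \<otimes> b \<in> carrier A"
    and smult_closed [simp]: "a \<in> carrier A \<Longrightarrow> z \<odot> a \<in> carrier A"
    and star_closed [simp]: "a \<in> carrier A \<Longrightarrow> star A a \<in> carrier A"
    and mult_assoc: "a \<in> carrier A \<Longrightarrow> b \<in> carrier A \<Longrightarrow> c \<in> carrier A \<Longrightarrow>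
      a \<otimes> b \<otimes> c = a \<otimes> (b \<otimes> c)"
    and one_left [simp]: "a \<in> carrier A \<Longrightarrow> \<one> \<otimes> a = a"
    and one_right [simp]: "a \<in> carrier A \<Longrightarrow> a \<otimes> \<one> = a"
    and distrib_left: "a \<in> carrier A \<Longrightarrow> b \<in> carrier A \<Longrightarrow> c \<in> carrier A \<Longrightarrow>
      a \<otimes> (b \<oplus> c) = a \<otimes> b \<oplus> a \<otimes> c"
    and distrib_right: "a \<in> carrier A \<Longrightarrow> b \<in> carrier A \<Longrightarrow> c \<in> carrier A \<Longrightarrow>
      (a \<oplus> b) \<otimes> c = a \<otimes> c \<oplus> b \<otimes> c"
    and zero_mult [simp]: "a \<in> carrier A \<Longrightarrow> \<zero> \<otimes> a = \<zero>"
    and mult_zero [simp]: "a \<in> carrier A \<Longrightarrow> a \<otimes> \<zero> = \<zero>"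
    and smult_mult_left: "a \<in> carrier A \<Longrightarrow> b \<in> carrier A \<Longrightarrow> (z \<odot> a) \<otimes> b = z \<odot> (a \<otimes> b)"
    and smult_mult_right: "a \<in> carrier A \<Longrightarrow> b \<in> carrier A \<Longrightarrow> a \<otimes> (z \<odot> b) = z \<odot> (a \<otimes> b)"
    and smult_add: "a \<in> carrier A \<Longrightarrow> b \<in> carrier A \<Longrightarrow> z \<odot> (a \<oplus> b) = z \<odot> a \<oplus> z \<odot> b"
    and smult_smult: "a \<in> carrier A \<Longrightarrow> z \<odot> (w \<odot> a) = (z * w) \<odot> a"
    and smult_one [simp]: "a \<in> carrier A \<Longrightarrow> 1 \<odot> a = a"
    and add_smult: "a \<in> carrier A \<Longrightarrow> (z + w) \<odot> a = z \<odot> a \<oplus> w \<odot> a"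
    and smult_zero [simp]: "z \<odot> \<zero> = \<zero>"
    and zero_smult [simp]: "a \<in> carrier A \<Longrightarrow> 0 \<odot> a = \<zero>"
    and star_add: "a \<in> carrier A \<Longrightarrow> b \<in> carrier A \<Longrightarrow> star A (a \<oplus> b) = star A a \<oplus> star A b"
    and star_mult: "a \<in> carrier A \<Longrightarrow> b \<in> carrier A \<Longrightarrow> star A (a \<otimes> b) = star A b \<otimes> star A a"
    and star_smult: "a \<in> carrier A \<Longrightarrow> star A (z \<odot> a) = cnj z \<odot> star A a"
    and star_star [simp]: "a \<in> carrier A \<Longrightarrow> star A (star A a) = a"
    and star_zero [simp]: "star A \<zero> = \<zero>"

lemma conj_alg_simps [simp]:
  "carrier (conj_alg B) = carrier B" "monoid.mult (conj_alg B) = monoid.mult B"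
  "one (conj_alg B) = one B" "zero (conj_alg B) = zero B" "add (conj_alg B) = add B"
  "star (conj_alg B) = star B" "module.smult (conj_alg B) c b = cnj c \<odot>\<^bsub>B\<^esub> b"
  by (simp_all add: conj_alg_def)

lemma star_algebra_conj_alg: "star_algebra B \<Longrightarrow> star_algebra (conj_alg B)"
  unfolding star_algebra_def by simp

text \<open>The operations of the tensor product act on formal sums, where all laws of a star-algebra hold as
equations of multisets, apart from those that involve negatives, the scalar zero or sums of scalars.\<close>

definition fmul where
  "fmul A B s r = (\<Sum>(a, b)\<in>#s. image_mset (\<lambda>(a', b'). (a \<otimes>\<^bsub>A\<^esub> a', b \<otimes>\<^bsub>B\<^esub> b')) r)"

definition fsmul where
  "fsmul A c s = image_mset (\<lambda>(a, b). (c \<odot>\<^bsub>A\<^esub> a, b)) s"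

definition fstar where
  "fstar A B s = image_mset (\<lambda>(a, b). (star A a, star B b)) s"

lemma fmul_empty_left [simp]: "fmul A B {#} r = {#}"
  and fmul_empty_right [simp]: "fmul A B s {#} = {#}"
  and fmul_add_left: "fmul A B (s + s') r = fmul A B s r + fmul A B s' r"
  by (simp_all add: fmul_def case_prod_unfold)

lemma fmul_add_right: "fmul A B s (r + r') = fmul A B s r + fmul A B s r'"
  by (induction s) (auto simp: fmul_def)

lemma fmul_single_left: "fmul A B {#(a, b)#} r = image_mset (\<lambda>(a', b'). (a \<otimes>\<^bsub>A\<^esub> a', b \<otimes>\<^bsub>B\<^esub> b')) r"
  by (simp add: fmul_def)

lemma fmul_single_right: "fmul A B s {#(a', b')#} = image_mset (\<lambda>(a, b). (a \<otimes>\<^bsub>A\<^esub> a', b \<otimes>\<^bsub>B\<^esub> b')) s"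
  by (induction s) (auto simp: fmul_def)

lemma fsmul_simps [simp]: "fsmul A c {#} = {#}" "fsmul A c (s + r) = fsmul A c s + fsmul A c r"
  "fsmul A c {#(a, b)#} = {#(c \<odot>\<^bsub>A\<^esub> a, b)#}"
  by (simp_all add: fsmul_def)

lemma fstar_simps [simp]: "fstar A B {#} = {#}" "fstar A B (s + r) = fstar A B s + fstar A B r"
  "fstar A B {#(a, b)#} = {#(star A a, star B b)#}"
  by (simp_all add: fstar_def)

locale tensor = A: star_algebra A + B: star_algebra B
  for A :: "('a, 'm) star_alg_scheme" and B :: "('b, 'n) star_alg_scheme"
begin

abbreviation "fs \<equiv> formal_sums A B"
abbreviation "eqv \<equiv> tensor_eq A B"
abbreviation "cls \<equiv> tensor_class A B"

lemma fs_simps [simp]: "{#} \<in> fs" "s + r \<in> fs \<longleftrightarrow> s \<in> fs \<and> r \<in> fs"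
  "add_mset p s \<in> fs \<longleftrightarrow> p \<in> carrier A \<times> carrier B \<and> s \<in> fs"
  by (auto simp: formal_sums_def)

lemma fs_induct [consumes 1, case_names empty add]:
  assumes "s \<in> fs" and "P {#}"
    and "\<And>a b s. a \<in> carrier A \<Longrightarrow> b \<in> carrier B \<Longrightarrow> s \<in> fs \<Longrightarrow> P s \<Longrightarrow> P ({#(a, b)#} + s)"
  shows "P s"
  using assms(1)
proof (induction s)
  case (add p s)
  obtain a b where p: "p = (a, b)" by (cases p)
  have "s \<in> fs" "a \<in> carrier A" "b \<in> carrier B" using add.prems by (auto simp: formal_sums_def p)
  then show ?case using add.IH assms(3)[of a b s] by (simp add: p)
qed (rule assms(2))

lemma fmul_fs [simp]: "s \<in> fs \<Longrightarrow> r \<in> fs \<Longrightarrow> fmul A B s r \<in> fs"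
  by (auto simp: formal_sums_def fmul_def intro!: A.mult_closed B.mult_closed)

lemma fsmul_fs [simp]: "s \<in> fs \<Longrightarrow> fsmul A c s \<in> fs"
  by (auto simp: formal_sums_def fsmul_def)

lemma fstar_fs [simp]: "s \<in> fs \<Longrightarrow> fstar A B s \<in> fs"
  by (auto simp: formal_sums_def fstar_def)

lemma eqv_fs: "eqv s r \<Longrightarrow> s \<in> fs \<and> r \<in> fs"
  by (induction rule: tensor_eq.induct) auto

lemma equiv_tensor_rel: "equiv fs (tensor_rel A B)"
proof (rule equivI)
  show "tensor_rel A B \<subseteq> fs \<times> fs" using eqv_fs by (auto simp: tensor_rel_def)
  show "refl_on fs (tensor_rel A B)"
    by (auto simp: refl_on_def tensor_rel_def intro: tensor_eq.refl)
  show "sym (tensor_rel A B)" by (auto simp: sym_def tensor_rel_def intro: tensor_eq.sym)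
  show "trans (tensor_rel A B)"
    unfolding trans_def tensor_rel_def by (auto intro: tensor_eq.trans)
qed

lemma cls_eq: "s \<in> fs \<Longrightarrow> r \<in> fs \<Longrightarrow> cls s = cls r \<longleftrightarrow> eqv s r"
  unfolding tensor_class_def using eq_equiv_class_iff[OF equiv_tensor_rel] by (simp add: tensor_rel_def)

lemma eqv_cls: "eqv s r \<Longrightarrow> cls s = cls r"
  using cls_eq eqv_fs by blast

lemma cls_mem: "r \<in> cls s \<longleftrightarrow> eqv s r"
  by (simp add: tensor_class_def tensor_rel_def)

lemma cls_self [simp]: "s \<in> fs \<Longrightarrow> s \<in> cls s"
  by (simp add: cls_mem tensor_eq.refl)

text \<open>Left and right multiplication by an elementary tensor, scalar multiplication and the adjoint are all
of this form; \<open>\<sigma>\<close> is conjugation for the adjoint and the identity otherwise.\<close>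

lemma eqv_map:
  assumes eq: "eqv s r"
    and g: "\<And>a. a \<in> carrier A \<Longrightarrow> g a \<in> carrier A" and h: "\<And>b. b \<in> carrier B \<Longrightarrow> h b \<in> carrier B"
    and g_add: "\<And>a a'. a \<in> carrier A \<Longrightarrow> a' \<in> carrier A \<Longrightarrow> g (a \<oplus>\<^bsub>A\<^esub> a') = g a \<oplus>\<^bsub>A\<^esub> g a'"
    and h_add: "\<And>b b'. b \<in> carrier B \<Longrightarrow> b' \<in> carrier B \<Longrightarrow> h (b \<oplus>\<^bsub>B\<^esub> b') = h b \<oplus>\<^bsub>B\<^esub> h b'"
    and g_smult: "\<And>z a. a \<in> carrier A \<Longrightarrow> g (z \<odot>\<^bsub>A\<^esub> a) = \<sigma> z \<odot>\<^bsub>A\<^esub> g a"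
    and h_smult: "\<And>z b. b \<in> carrier B \<Longrightarrow> h (z \<odot>\<^bsub>B\<^esub> b) = \<sigma> z \<odot>\<^bsub>B\<^esub> h b"
    and g_zero: "g \<zero>\<^bsub>A\<^esub> = \<zero>\<^bsub>A\<^esub>"
  shows "eqv (image_mset (\<lambda>(a, b). (g a, h b)) s) (image_mset (\<lambda>(a, b). (g a, h b)) r)"
  using eq
proof induction
  case (refl s)
  then show ?case using g h by (intro tensor_eq.refl) (auto simp: formal_sums_def)
next
  case (sym s s')
  then show ?case by (blast intro: tensor_eq.sym)
next
  case (trans s s' s'')
  then show ?case by (blast intro: tensor_eq.trans)
next
  case (plus s s' r r')
  then show ?case by (simp add: tensor_eq.plus)
next
  case (add_left a a' b)
  then show ?case using g h tensor_eq.add_left[of "g a" A "g a'" "h b" B] by (simp add: g_add)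
next
  case (add_right a b b')
  then show ?case using g h tensor_eq.add_right[of "g a" A "h b" B "h b'"] by (simp add: h_add)
next
  case (scale a b c)
  then show ?case using g h tensor_eq.scale[of "g a" A "h b" B "\<sigma> c"] by (simp add: g_smult h_smult)
next
  case (zero b)
  then show ?case using h tensor_eq.zero[of "h b" B A] by (simp add: g_zero)
qed

lemma fmul_cong_right:
  assumes "s \<in> fs" and eq: "eqv r r'"
  shows "eqv (fmul A B s r) (fmul A B s r')"
  using assms(1)
proof (induction rule: fs_induct)
  case empty
  then show ?case by (simp add: tensor_eq.refl)
next
  case (add a b s)
  have "eqv (fmul A B {#(a, b)#} r) (fmul A B {#(a, b)#} r')"
    unfolding fmul_single_left using add eq
    by (intro eqv_map[where \<sigma> = "\<lambda>z. z"])
      (auto simp: A.distrib_left B.distrib_left A.smult_mult_right B.smult_mult_right)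
  from tensor_eq.plus[OF this add.IH] show ?case by (simp only: fmul_add_left)
qed

lemma fmul_cong_left:
  assumes "r \<in> fs" and eq: "eqv s s'"
  shows "eqv (fmul A B s r) (fmul A B s' r)"
  using assms(1)
proof (induction rule: fs_induct)
  case empty
  then show ?case by (simp add: tensor_eq.refl)
next
  case (add a b r)
  have "eqv (fmul A B s {#(a, b)#}) (fmul A B s' {#(a, b)#})"
    unfolding fmul_single_right using add eq
    by (intro eqv_map[where \<sigma> = "\<lambda>z. z"])
      (auto simp: A.distrib_right B.distrib_right A.smult_mult_left B.smult_mult_left)
  from tensor_eq.plus[OF this add.IH] show ?case by (simp only: fmul_add_right)
qed

lemma fmul_cong: "eqv s s' \<Longrightarrow> eqv r r' \<Longrightarrow> eqv (fmul A B s r) (fmul A B s' r')"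
  by (meson eqv_fs fmul_cong_left fmul_cong_right tensor_eq.trans)

lemma fsmul_cong: "eqv s r \<Longrightarrow> eqv (fsmul A c s) (fsmul A c r)"
  unfolding fsmul_def
  by (rule eqv_map[where \<sigma> = "\<lambda>z. z"]) (auto simp: A.smult_add A.smult_smult mult.commute)

lemma fstar_cong: "eqv s r \<Longrightarrow> eqv (fstar A B s) (fstar A B r)"
  unfolding fstar_def
  by (rule eqv_map[where \<sigma> = cnj]) (auto simp: A.star_add B.star_add A.star_smult B.star_smult)

abbreviation "TA \<equiv> tensor_alg A B"

lemma TA_carrier: "carrier TA = cls ` fs"
  by (auto simp: tensor_alg_def quotient_def tensor_class_def)

lemma cls_carrier [simp]: "s \<in> fs \<Longrightarrow> cls s \<in> carrier TA"
  by (simp add: TA_carrier)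

lemma TA_mult: "s \<in> fs \<Longrightarrow> r \<in> fs \<Longrightarrow> cls s \<otimes>\<^bsub>TA\<^esub> cls r = cls (fmul A B s r)"
proof -
  assume s: "s \<in> fs" and r: "r \<in> fs"
  have "cls (fmul A B s' r') = cls (fmul A B s r)" if "s' \<in> cls s" "r' \<in> cls r" for s' r'
    using that by (intro eqv_cls fmul_cong) (auto simp: cls_mem intro: tensor_eq.sym)
  then have "(\<Union>s'\<in>cls s. \<Union>r'\<in>cls r. cls (fmul A B s' r')) = cls (fmul A B s r)"
    using cls_self[OF s] cls_self[OF r] by blast
  then show ?thesis by (simp add: tensor_alg_def fmul_def)
qed

lemma TA_add: "s \<in> fs \<Longrightarrow> r \<in> fs \<Longrightarrow> cls s \<oplus>\<^bsub>TA\<^esub> cls r = cls (s + r)"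
proof -
  assume s: "s \<in> fs" and r: "r \<in> fs"
  have "cls (s' + r') = cls (s + r)" if "s' \<in> cls s" "r' \<in> cls r" for s' r'
    using that by (intro eqv_cls tensor_eq.plus) (auto simp: cls_mem intro: tensor_eq.sym)
  then have "(\<Union>s'\<in>cls s. \<Union>r'\<in>cls r. cls (s' + r')) = cls (s + r)"
    using cls_self[OF s] cls_self[OF r] by blast
  then show ?thesis by (simp add: tensor_alg_def)
qed

lemma TA_smult: "s \<in> fs \<Longrightarrow> c \<odot>\<^bsub>TA\<^esub> cls s = cls (fsmul A c s)"
proof -
  assume s: "s \<in> fs"
  have "cls (fsmul A c s') = cls (fsmul A c s)" if "s' \<in> cls s" for s'
    using that by (intro eqv_cls fsmul_cong) (auto simp: cls_mem intro: tensor_eq.sym)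
  then have "(\<Union>s'\<in>cls s. cls (fsmul A c s')) = cls (fsmul A c s)"
    using cls_self[OF s] by blast
  then show ?thesis by (simp add: tensor_alg_def fsmul_def)
qed

lemma TA_star: "s \<in> fs \<Longrightarrow> star TA (cls s) = cls (fstar A B s)"
proof -
  assume s: "s \<in> fs"
  have "cls (fstar A B s') = cls (fstar A B s)" if "s' \<in> cls s" for s'
    using that by (intro eqv_cls fstar_cong) (auto simp: cls_mem intro: tensor_eq.sym)
  then have "(\<Union>s'\<in>cls s. cls (fstar A B s')) = cls (fstar A B s)"
    using cls_self[OF s] by blast
  then show ?thesis by (simp add: tensor_alg_def fstar_def)
qed

lemma TA_zero: "\<zero>\<^bsub>TA\<^esub> = cls {#}"
  by (simp add: tensor_alg_def)

lemma abelian_monoid_TA: "abelian_monoid TA"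
proof (rule abelian_monoidI)
  fix x y z assume "x \<in> carrier TA" "y \<in> carrier TA" "z \<in> carrier TA"
  then obtain s r q where "x = cls s" "y = cls r" "z = cls q" "s \<in> fs" "r \<in> fs" "q \<in> fs"
    by (auto simp: TA_carrier)
  then show "(x \<oplus>\<^bsub>TA\<^esub> y) \<oplus>\<^bsub>TA\<^esub> z = x \<oplus>\<^bsub>TA\<^esub> (y \<oplus>\<^bsub>TA\<^esub> z)"
    by (simp add: TA_add add.assoc)
next
  fix x y assume "x \<in> carrier TA" "y \<in> carrier TA"
  then obtain s r where "x = cls s" "y = cls r" "s \<in> fs" "r \<in> fs"
    by (auto simp: TA_carrier)
  then show "x \<oplus>\<^bsub>TA\<^esub> y = y \<oplus>\<^bsub>TA\<^esub> x" "x \<oplus>\<^bsub>TA\<^esub> y \<in> carrier TA"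
    by (simp_all add: TA_add add.commute)
next
  fix x assume "x \<in> carrier TA"
  then obtain s where "x = cls s" "s \<in> fs" by (auto simp: TA_carrier)
  then show "\<zero>\<^bsub>TA\<^esub> \<oplus>\<^bsub>TA\<^esub> x = x" by (simp add: TA_add TA_zero)
qed (simp add: TA_zero)

lemma TA_finsum:
  assumes "finite I" "\<And>i. i \<in> I \<Longrightarrow> g i \<in> fs"
  shows "(\<Oplus>\<^bsub>TA\<^esub>i\<in>I. cls (g i)) = cls (\<Sum>i\<in>I. g i) \<and> (\<Sum>i\<in>I. g i) \<in> fs"
  using assms
proof (induction I)
  case empty
  then show ?case
    using abelian_monoid.finsum_empty[OF abelian_monoid_TA] by (simp add: TA_zero)
next
  case (insert i I)
  then show ?case
    by (subst abelian_monoid.finsum_insert[OF abelian_monoid_TA]) (auto simp: TA_add)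
qed

text \<open>The universal property of the tensor product, for balanced maps into the complex numbers.\<close>

lemma balanced_sum_eqv:
  fixes g :: "'a \<Rightarrow> 'b \<Rightarrow> complex"
  assumes eq: "eqv s r"
    and "\<And>a a' b. a \<in> carrier A \<Longrightarrow> a' \<in> carrier A \<Longrightarrow> b \<in> carrier B \<Longrightarrow> g (a \<oplus>\<^bsub>A\<^esub> a') b = g a b + g a' b"
    and "\<And>a b b'. a \<in> carrier A \<Longrightarrow> b \<in> carrier B \<Longrightarrow> b' \<in> carrier B \<Longrightarrow> g a (b \<oplus>\<^bsub>B\<^esub> b') = g a b + g a b'"
    and "\<And>z a b. a \<in> carrier A \<Longrightarrow> b \<in> carrier B \<Longrightarrow> g (z \<odot>\<^bsub>A\<^esub> a) b = g a (z \<odot>\<^bsub>B\<^esub> b)"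
    and "\<And>b. b \<in> carrier B \<Longrightarrow> g \<zero>\<^bsub>A\<^esub> b = 0"
  shows "(\<Sum>(a, b)\<in>#s. g a b) = (\<Sum>(a, b)\<in>#r. g a b)"
  using eq by induction (auto simp: assms)

lemma fmul_assoc:
  assumes "s \<in> fs" "r \<in> fs" "q \<in> fs"
  shows "fmul A B (fmul A B s r) q = fmul A B s (fmul A B r q)"
  using assms(1)
proof (induction rule: fs_induct)
  case (add a b s)
  note ab = add.hyps
  have "fmul A B (fmul A B {#(a, b)#} r) q = fmul A B {#(a, b)#} (fmul A B r q)"
    using assms(2)
  proof (induction rule: fs_induct)
    case (add a' b' r)
    have "fmul A B (fmul A B {#(a, b)#} {#(a', b')#}) q = fmul A B {#(a, b)#} (fmul A B {#(a', b')#} q)"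
      using ab add assms(3)
      by (auto simp: fmul_single_left formal_sums_def A.mult_assoc B.mult_assoc multiset.map_comp
          intro!: image_mset_cong)
    then show ?case using add.IH by (simp only: fmul_add_left fmul_add_right)
  qed simp
  then show ?case using add.IH by (simp only: fmul_add_left fmul_add_right)
qed simp

lemma fstar_fstar: "s \<in> fs \<Longrightarrow> fstar A B (fstar A B s) = s"
  by (induction rule: fs_induct) (simp_all only: fstar_simps A.star_star B.star_star)

lemma fstar_fmul:
  assumes "s \<in> fs" "r \<in> fs"
  shows "fstar A B (fmul A B s r) = fmul A B (fstar A B r) (fstar A B s)"
  using assms(1)
proof (induction rule: fs_induct)
  case (add a b s)
  note ab = add.hyps
  have "fstar A B (fmul A B {#(a, b)#} r) = fmul A B (fstar A B r) (fstar A B {#(a, b)#})"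
    using assms(2)
  proof (induction rule: fs_induct)
    case (add a' b' r)
    have "fstar A B (fmul A B {#(a, b)#} {#(a', b')#}) = fmul A B (fstar A B {#(a', b')#}) (fstar A B {#(a, b)#})"
      using ab add by (simp add: fmul_single_left A.star_mult B.star_mult)
    then show ?case using add.IH by (simp only: fmul_add_left fmul_add_right fstar_simps)
  qed simp
  then show ?case using add.IH by (simp only: fmul_add_left fmul_add_right fstar_simps)
qed simp

lemma fsmul_fmul_left:
  assumes "s \<in> fs" "r \<in> fs"
  shows "fmul A B (fsmul A c s) r = fsmul A c (fmul A B s r)"
  using assms(1)
proof (induction rule: fs_induct)
  case (add a b s)
  have "fmul A B (fsmul A c {#(a, b)#}) r = fsmul A c (fmul A B {#(a, b)#} r)"
    using add assms(2)
    by (auto simp: fmul_single_left fsmul_def formal_sums_def A.smult_mult_left multiset.map_comp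
          intro!: image_mset_cong)
  then show ?case using add.IH by (simp only: fmul_add_left fsmul_simps)
qed simp

lemma fsmul_fmul_right:
  assumes "s \<in> fs" "r \<in> fs"
  shows "fmul A B s (fsmul A c r) = fsmul A c (fmul A B s r)"
  using assms(1)
proof (induction rule: fs_induct)
  case (add a b s)
  have "fmul A B {#(a, b)#} (fsmul A c r) = fsmul A c (fmul A B {#(a, b)#} r)"
    using add assms(2)
    by (auto simp: fmul_single_left fsmul_def formal_sums_def A.smult_mult_right multiset.map_comp
          intro!: image_mset_cong)
  then show ?case using add.IH by (simp only: fmul_add_left fsmul_simps)
qed simp


lemma fmul_sum:
  fixes g :: "'a \<Rightarrow> 'b \<Rightarrow> complex"
  shows "(\<Sum>(a, b)\<in>#fmul A B s r. g a b)
    = (\<Sum>(a, b)\<in>#s. \<Sum>(a', b')\<in>#r. g (a \<otimes>\<^bsub>A\<^esub> a') (b \<otimes>\<^bsub>B\<^esub> b'))"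
proof (induction s)
  case (add p s)
  have "fmul A B (add_mset p s) r = fmul A B {#p#} r + fmul A B s r"
    using fmul_add_left[of A B "{#p#}" s r] by simp
  then show ?case using add
    by (cases p) (simp add: fmul_single_left image_mset.compositionality comp_def case_prod_unfold)
qed simp

lemma smult_left_eqv: "a \<in> carrier A \<Longrightarrow> b \<in> carrier B \<Longrightarrow>
    eqv {#(a, z \<odot>\<^bsub>B\<^esub> b)#} {#(z \<odot>\<^bsub>A\<^esub> a, b)#}"
  by (blast intro: tensor_eq.sym tensor_eq.scale)

lemma zero_right_eqv: "a \<in> carrier A \<Longrightarrow> eqv {#(a, \<zero>\<^bsub>B\<^esub>)#} {#}"
proof -
  assume a: "a \<in> carrier A"
  have "eqv {#(a, 0 \<odot>\<^bsub>B\<^esub> \<zero>\<^bsub>B\<^esub>)#} {#(0 \<odot>\<^bsub>A\<^esub> a, \<zero>\<^bsub>B\<^esub>)#}"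
    using a by (intro smult_left_eqv) auto
  moreover have "eqv {#(0 \<odot>\<^bsub>A\<^esub> a, \<zero>\<^bsub>B\<^esub>)#} {#}"
    using a tensor_eq.zero[of "\<zero>\<^bsub>B\<^esub>" B A] by simp
  ultimately show ?thesis by (auto intro: tensor_eq.trans)
qed

text \<open>A formal sum whose coefficients all vanish can be shortened. If \<open>(a, b)\<close> is a summand and
\<open>\<phi> a x \<noteq> 0\<close>, the relation at \<open>x\<close> expresses \<open>b\<close> as a linear combination of the second components of
the remaining summands; substituting it and moving the scalars to the left absorbs \<open>(a, b)\<close> into the
remaining summands. This proves that families of separating functionals on both factors separate the
elements of the algebraic tensor product.\<close>

lemma zero_of_coefficients:
  fixes \<phi> :: "'a \<Rightarrow> 'x \<Rightarrow> complex" and \<psi> :: "'b \<Rightarrow> 'y \<Rightarrow> complex"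
  assumes \<phi>_add: "\<And>a a' x. a \<in> carrier A \<Longrightarrow> a' \<in> carrier A \<Longrightarrow> \<phi> (a \<oplus>\<^bsub>A\<^esub> a') x = \<phi> a x + \<phi> a' x"
    and \<phi>_smult: "\<And>z a x. a \<in> carrier A \<Longrightarrow> \<phi> (z \<odot>\<^bsub>A\<^esub> a) x = z * \<phi> a x"
    and \<phi>_inj: "\<And>a. a \<in> carrier A \<Longrightarrow> (\<And>x. \<phi> a x = 0) \<Longrightarrow> a = \<zero>\<^bsub>A\<^esub>"
    and \<psi>_add: "\<And>b b' y. b \<in> carrier B \<Longrightarrow> b' \<in> carrier B \<Longrightarrow> \<psi> (b \<oplus>\<^bsub>B\<^esub> b') y = \<psi> b y + \<psi> b' y"
    and \<psi>_smult: "\<And>z b y. b \<in> carrier B \<Longrightarrow> \<psi> (z \<odot>\<^bsub>B\<^esub> b) y = z * \<psi> b y"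
    and \<psi>_inj: "\<And>b b'. b \<in> carrier B \<Longrightarrow> b' \<in> carrier B \<Longrightarrow> (\<And>y. \<psi> b y = \<psi> b' y) \<Longrightarrow> b = b'"
    and s: "s \<in> fs" and coeff: "\<And>x y. (\<Sum>(a, b)\<in>#s. \<phi> a x * \<psi> b y) = 0"
  shows "eqv s {#}"
  using s coeff
proof (induction "size s" arbitrary: s)
  case 0
  then show ?case by (simp add: tensor_eq.refl)
next
  case (Suc k)
  obtain a b r where s: "s = {#(a, b)#} + r" and k: "size r = k"
    using Suc.hyps(2) by (metis add_mset_add_single size_Suc_Diff1 size_eq_Suc_imp_eq_union surj_pair union_commute Suc_inject size_add_mset)
  have a: "a \<in> carrier A" and b: "b \<in> carrier B" and r: "r \<in> fs" using Suc.prems(1) by (auto simp: s)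
  have \<phi>_zero: "\<phi> \<zero>\<^bsub>A\<^esub> x = 0" for x using \<phi>_smult[OF A.zero_closed, of 0 x] by simp
  have \<psi>_zero: "\<psi> \<zero>\<^bsub>B\<^esub> y = 0" for y using \<psi>_smult[OF B.zero_closed, of 0 y] by simp
  show ?case
  proof (cases "\<exists>x. \<phi> a x \<noteq> 0")
    case False
    then have "a = \<zero>\<^bsub>A\<^esub>" using \<phi>_inj[OF a] by blast
    then have ab: "eqv {#(a, b)#} {#}" using tensor_eq.zero[OF b] by simp
    have "(\<Sum>(a, b)\<in>#r. \<phi> a x * \<psi> b y) = 0" for x y
      using Suc.prems(2)[of x y] False by (simp add: s)
    then have "eqv r {#}" using Suc.hyps(1)[OF k[symmetric] r] by blast
    from tensor_eq.plus[OF ab this] show ?thesis by (simp add: s)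
  next
    case True
    then obtain x where x: "\<phi> a x \<noteq> 0" by blast
    (* the coefficients of \<open>b\<close> in terms of the second components of \<open>r\<close> *)
    define g where "g = (\<lambda>a'. - (\<phi> a' x / \<phi> a x))"
    have elim: "\<exists>b'\<in>carrier B. (\<forall>y. \<psi> b' y = (\<Sum>(a', b')\<in>#q. g a' * \<psi> b' y)) \<and>
        (\<exists>q'\<in>fs. size q' = size q \<and> eqv ({#(a, b')#} + q) q')" if "q \<in> fs" for q
      using that
    proof (induction rule: fs_induct)
      case empty
      have "eqv ({#(a, \<zero>\<^bsub>B\<^esub>)#} + {#}) {#}" using zero_right_eqv[OF a] by simp
      then show ?case by (intro bexI[of _ "\<zero>\<^bsub>B\<^esub>"] conjI bexI[of _ "{#}"]) (auto simp: \<psi>_zero)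
    next
      case (add c d q)
      then obtain b' q' where b': "b' \<in> carrier B" "\<And>y. \<psi> b' y = (\<Sum>(a', b')\<in>#q. g a' * \<psi> b' y)"
        and q': "q' \<in> fs" "size q' = size q" "eqv ({#(a, b')#} + q) q'" by blast
      let ?b = "g c \<odot>\<^bsub>B\<^esub> d \<oplus>\<^bsub>B\<^esub> b'"
      let ?c = "g c \<odot>\<^bsub>A\<^esub> a \<oplus>\<^bsub>A\<^esub> c"
      have gd: "g c \<odot>\<^bsub>B\<^esub> d \<in> carrier B" using add by simp
      have "eqv {#(a, ?b)#} ({#(a, g c \<odot>\<^bsub>B\<^esub> d)#} + {#(a, b')#})"
        using tensor_eq.add_right[OF a gd b'(1)] by (simp add: add_mset_commute)
      moreover have "eqv ({#(a, g c \<odot>\<^bsub>B\<^esub> d)#} + {#(a, b')#}) ({#(g c \<odot>\<^bsub>A\<^esub> a, d)#} + {#(a, b')#})"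
        using a add b' by (intro tensor_eq.plus smult_left_eqv tensor_eq.refl) auto
      ultimately have "eqv {#(a, ?b)#} ({#(g c \<odot>\<^bsub>A\<^esub> a, d)#} + {#(a, b')#})" by (rule tensor_eq.trans)
      then have "eqv ({#(a, ?b)#} + ({#(c, d)#} + q)) ({#(g c \<odot>\<^bsub>A\<^esub> a, d)#} + {#(a, b')#} + ({#(c, d)#} + q))"
        using add by (intro tensor_eq.plus tensor_eq.refl) auto
      also have "{#(g c \<odot>\<^bsub>A\<^esub> a, d)#} + {#(a, b')#} + ({#(c, d)#} + q)
          = {#(g c \<odot>\<^bsub>A\<^esub> a, d), (c, d)#} + ({#(a, b')#} + q)"
        by (simp add: add_mset_commute)
      finally have 1: "eqv ({#(a, ?b)#} + ({#(c, d)#} + q)) ({#(g c \<odot>\<^bsub>A\<^esub> a, d), (c, d)#} + ({#(a, b')#} + q))" .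
      have "eqv {#(g c \<odot>\<^bsub>A\<^esub> a, d), (c, d)#} {#(?c, d)#}"
        using a add by (intro tensor_eq.sym[OF tensor_eq.add_left]) auto
      from tensor_eq.plus[OF this q'(3)]
      have 2: "eqv ({#(g c \<odot>\<^bsub>A\<^esub> a, d), (c, d)#} + ({#(a, b')#} + q)) ({#(?c, d)#} + q')" .
      have "\<psi> ?b y = (\<Sum>(a', b')\<in>#{#(c, d)#} + q. g a' * \<psi> b' y)" for y
        using add gd b' by (simp add: \<psi>_add \<psi>_smult)
      moreover have "?b \<in> carrier B" "{#(?c, d)#} + q' \<in> fs" using a add b' q' by auto
      ultimately show ?case using tensor_eq.trans[OF 1 2] q'(2)
        by (intro bexI[of _ ?b] conjI bexI[of _ "{#(?c, d)#} + q'"]) auto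
    qed
    obtain b' q where b': "b' \<in> carrier B" "\<And>y. \<psi> b' y = (\<Sum>(a', b')\<in>#r. g a' * \<psi> b' y)"
      and q: "q \<in> fs" "size q = size r" "eqv ({#(a, b')#} + r) q" using elim[OF r] by blast
    have "b = b'"
    proof (rule \<psi>_inj[OF b b'(1)])
      fix y
      have "\<phi> a x * \<psi> b y + (\<Sum>(a', b')\<in>#r. \<phi> a' x * \<psi> b' y) = 0"
        using Suc.prems(2)[of x y] by (simp add: s)
      moreover have "(\<Sum>(a', b')\<in>#r. \<phi> a' x * \<psi> b' y) = - \<phi> a x * (\<Sum>(a', b')\<in>#r. g a' * \<psi> b' y)"
      proof -
        have "\<phi> a' x * \<psi> b' y = - \<phi> a x * (g a' * \<psi> b' y)" for a' b' using x by (simp add: g_def)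
        then show ?thesis
          by (simp add: sum_mset_distrib_left image_mset.compositionality comp_def case_prod_unfold)
      qed
      ultimately have "\<phi> a x * \<psi> b y + - \<phi> a x * \<psi> b' y = 0" unfolding b'(2) by (simp only:)
      then show "\<psi> b y = \<psi> b' y" using x by simp
    qed
    then have sq: "eqv s q" using q(3) by (simp add: s)
    have "(\<Sum>(a, b)\<in>#q. \<phi> a x * \<psi> b y) = 0" for x y
    proof -
      have "(\<Sum>(a, b)\<in>#s. \<phi> a x * \<psi> b y) = (\<Sum>(a, b)\<in>#q. \<phi> a x * \<psi> b y)"
        by (rule balanced_sum_eqv[OF sq]) (simp_all add: \<phi>_add \<psi>_add \<phi>_smult \<psi>_smult \<phi>_zero algebra_simps)
      then show ?thesis using Suc.prems(2) by simp
    qed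
    then have "eqv q {#}" using Suc.hyps(1)[of q] q(1,2) k by simp
    then show ?thesis using sq by (rule tensor_eq.trans[rotated])
  qed
qed

end

section \<open>C*-seminorms on the algebraic tensor product\<close>

context tensor
begin

text \<open>C*-seminorms are studied on formal sums and transported to the quotient by \<open>lift\<close> at the end.\<close>

definition cstar_seminorm :: "(('a \<times> 'b) multiset \<Rightarrow> real) \<Rightarrow> bool" where
  "cstar_seminorm P \<longleftrightarrow>
     (\<forall>s r. eqv s r \<longrightarrow> P s = P r) \<and> (\<forall>s\<in>fs. 0 \<le> P s) \<and>
     (\<forall>s\<in>fs. \<forall>r\<in>fs. P (s + r) \<le> P s + P r) \<and>
     (\<forall>c. \<forall>s\<in>fs. P (fsmul A c s) = cmod c * P s) \<and>
     (\<forall>s\<in>fs. \<forall>r\<in>fs. P (fmul A B s r) \<le> P s * P r) \<and>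
     (\<forall>s\<in>fs. P (fmul A B (fstar A B s) s) = (P s)\<^sup>2)"

lemma cstar_seminorm_max:
  assumes "cstar_seminorm P" "cstar_seminorm Q"
  shows "cstar_seminorm (\<lambda>s. max (P s) (Q s))"
  unfolding cstar_seminorm_def
proof (intro conjI allI impI ballI)
  fix s r assume sr: "s \<in> fs" "r \<in> fs"
  have nn: "0 \<le> P s" "0 \<le> Q s" "0 \<le> P r" "0 \<le> Q r" using assms sr by (auto simp: cstar_seminorm_def)
  have "P (s + r) \<le> P s + P r" "Q (s + r) \<le> Q s + Q r"
    using assms sr by (auto simp: cstar_seminorm_def)
  then show "max (P (s + r)) (Q (s + r)) \<le> max (P s) (Q s) + max (P r) (Q r)" by linarith
  have "P (fmul A B s r) \<le> P s * P r" "Q (fmul A B s r) \<le> Q s * Q r"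
    using assms sr by (auto simp: cstar_seminorm_def)
  moreover have "P s * P r \<le> max (P s) (Q s) * max (P r) (Q r)" using nn by (intro mult_mono) auto
  moreover have "Q s * Q r \<le> max (P s) (Q s) * max (P r) (Q r)" using nn by (intro mult_mono) auto
  ultimately show "max (P (fmul A B s r)) (Q (fmul A B s r)) \<le> max (P s) (Q s) * max (P r) (Q r)"
    by linarith
next
  fix c s assume s: "s \<in> fs"
  then show "max (P (fsmul A c s)) (Q (fsmul A c s)) = cmod c * max (P s) (Q s)"
    using assms by (simp add: cstar_seminorm_def max_mult_distrib_left)
next
  fix s assume s: "s \<in> fs"
  have "0 \<le> P s" "0 \<le> Q s" using assms s by (auto simp: cstar_seminorm_def)
  then have "max ((P s)\<^sup>2) ((Q s)\<^sup>2) = (max (P s) (Q s))\<^sup>2"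
    using power_mono[of "P s" "Q s" 2] power_mono[of "Q s" "P s" 2]
    by (cases "P s \<le> Q s") (simp_all add: max_absorb1 max_absorb2)
  then show "max (P (fmul A B (fstar A B s) s)) (Q (fmul A B (fstar A B s) s)) = (max (P s) (Q s))\<^sup>2"
    using assms s by (simp add: cstar_seminorm_def)
qed (use assms in \<open>auto simp: cstar_seminorm_def le_max_iff_disj\<close>)

definition lift :: "(('a \<times> 'b) multiset \<Rightarrow> real) \<Rightarrow> ('a \<times> 'b) multiset set \<Rightarrow> real" where
  "lift P X = P (SOME s. s \<in> X)"

lemma lift_cls:
  assumes "cstar_seminorm P" "s \<in> fs"
  shows "lift P (cls s) = P s"
proof -
  have "eqv s (SOME r. r \<in> cls s)" using someI[of "eqv s" s] assms(2) by (simp add: cls_mem tensor_eq.refl)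
  then show ?thesis using assms(1) unfolding lift_def cstar_seminorm_def by metis
qed

lemma cstar_norm_lift:
  assumes P: "cstar_seminorm P" and faithful: "\<And>s. s \<in> fs \<Longrightarrow> P s = 0 \<Longrightarrow> eqv s {#}"
  shows "cstar_norm TA (lift P)"
proof -
  have z: "P {#} = 0" using P unfolding cstar_seminorm_def
    by (metis fs_simps(1) fsmul_simps(1) mult_zero_left norm_zero)
  have "(P s = 0) = (cls s = cls {#})" if "s \<in> fs" for s
    using that faithful P z by (auto simp: cls_eq cstar_seminorm_def)
  then show ?thesis
    using P lift_cls[OF P] unfolding cstar_norm_def TA_carrier
    by (auto simp: TA_zero TA_add TA_smult TA_mult TA_star cstar_seminorm_def)
qed

text \<open>The operator seminorm of a representation \<open>\<pi>\<close> on \<open>V\<close>. The set \<open>V\<close> may be a disjoint union of several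
representation spaces with a separate length function \<open>n\<close> on each, so that suprema over families of
representations are covered.\<close>

definition rep_norm :: "'v set \<Rightarrow> ('v \<Rightarrow> real) \<Rightarrow> (('a \<times> 'b) multiset \<Rightarrow> 'v \<Rightarrow> 'v) \<Rightarrow> ('a \<times> 'b) multiset \<Rightarrow> real" where
  "rep_norm V n \<pi> s = Inf {K. 0 \<le> K \<and> (\<forall>v\<in>V. n (\<pi> s v) \<le> K * n v)}"

lemma rep_norm_least: "0 \<le> K \<Longrightarrow> (\<And>v. v \<in> V \<Longrightarrow> n (\<pi> s v) \<le> K * n v) \<Longrightarrow> rep_norm V n \<pi> s \<le> K"
  unfolding rep_norm_def by (intro cInf_lower) (auto intro: bdd_belowI[of _ 0])

lemma rep_norm_ge:
  assumes "\<exists>K\<ge>0. \<forall>v\<in>V. n (\<pi> s v) \<le> K * n v"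
    and "\<And>K. 0 \<le> K \<Longrightarrow> \<forall>v\<in>V. n (\<pi> s v) \<le> K * n v \<Longrightarrow> c \<le> K"
  shows "c \<le> rep_norm V n \<pi> s"
  unfolding rep_norm_def using assms by (intro cInf_greatest) auto

lemma rep_norm_bound:
  assumes "\<exists>K\<ge>0. \<forall>v\<in>V. n (\<pi> s v) \<le> K * n v" and v: "v \<in> V" and n: "0 \<le> n v"
  shows "n (\<pi> s v) \<le> rep_norm V n \<pi> s * n v"
proof (cases "n v = 0")
  case True
  then show ?thesis using assms by auto
next
  case False
  then have p: "n v > 0" using n by simp
  have "n (\<pi> s v) / n v \<le> rep_norm V n \<pi> s"
    using assms(1) v p by (intro rep_norm_ge) (auto simp: divide_le_eq)
  then show ?thesis using p by (simp add: divide_le_eq)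
qed

text \<open>Only lengths of vectors are used: the last hypothesis is the Cauchy-Schwarz inequality
\<open>\<parallel>\<pi>(s) v\<parallel>\<^sup>2 = \<langle>\<pi>(s\<^sup>* s) v, v\<rangle> \<le> \<parallel>\<pi>(s\<^sup>* s) v\<parallel> \<parallel>v\<parallel>\<close>. It gives \<open>\<parallel>s\<parallel>\<^sup>2 \<le> \<parallel>s\<^sup>* s\<parallel>\<close>, and applied to the
adjoint of \<open>s\<close> it gives \<open>\<parallel>s\<^sup>*\<parallel> \<le> \<parallel>s\<parallel>\<close>, whence the C*-identity.\<close>

lemma cstar_seminorm_rep_norm:
  assumes n: "\<And>v. v \<in> V \<Longrightarrow> 0 \<le> n v"
    and \<pi>: "\<And>s v. s \<in> fs \<Longrightarrow> v \<in> V \<Longrightarrow> \<pi> s v \<in> V"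
    and bdd: "\<And>s. s \<in> fs \<Longrightarrow> \<exists>K\<ge>0. \<forall>v\<in>V. n (\<pi> s v) \<le> K * n v"
    and eqv: "\<And>s r v. eqv s r \<Longrightarrow> v \<in> V \<Longrightarrow> n (\<pi> s v) = n (\<pi> r v)"
    and add: "\<And>s r v. s \<in> fs \<Longrightarrow> r \<in> fs \<Longrightarrow> v \<in> V \<Longrightarrow> n (\<pi> (s + r) v) \<le> n (\<pi> s v) + n (\<pi> r v)"
    and smul: "\<And>c s v. s \<in> fs \<Longrightarrow> v \<in> V \<Longrightarrow> n (\<pi> (fsmul A c s) v) = cmod c * n (\<pi> s v)"
    and mul: "\<And>s r v. s \<in> fs \<Longrightarrow> r \<in> fs \<Longrightarrow> v \<in> V \<Longrightarrow> n (\<pi> (fmul A B s r) v) = n (\<pi> s (\<pi> r v))"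
    and star: "\<And>s v. s \<in> fs \<Longrightarrow> v \<in> V \<Longrightarrow> (n (\<pi> s v))\<^sup>2 \<le> n (\<pi> (fmul A B (fstar A B s) s) v) * n v"
  shows "cstar_seminorm (rep_norm V n \<pi>)"
proof -
  let ?P = "rep_norm V n \<pi>"
  have nonneg: "0 \<le> ?P s" if "s \<in> fs" for s using bdd[OF that] by (intro rep_norm_ge) auto
  have bound: "n (\<pi> s v) \<le> ?P s * n v" if "s \<in> fs" "v \<in> V" for s v
    using bdd[OF that(1)] that(2) n[OF that(2)] by (rule rep_norm_bound)
  have submult: "?P (fmul A B s r) \<le> ?P s * ?P r" if s: "s \<in> fs" and r: "r \<in> fs" for s r
  proof (rule rep_norm_least)
    show "0 \<le> ?P s * ?P r" using nonneg s r by simp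
    fix v assume v: "v \<in> V"
    have "n (\<pi> s (\<pi> r v)) \<le> ?P s * n (\<pi> r v)" using bound[OF s] \<pi>[OF r v] by blast
    also have "\<dots> \<le> ?P s * (?P r * n v)" using bound[OF r v] nonneg[OF s] by (rule mult_left_mono)
    finally show "n (\<pi> (fmul A B s r) v) \<le> ?P s * ?P r * n v" using mul[OF s r v] by simp
  qed
  have sq: "(?P s)\<^sup>2 \<le> ?P (fmul A B (fstar A B s) s)" if s: "s \<in> fs" for s
  proof -
    let ?q = "?P (fmul A B (fstar A B s) s)"
    have q: "0 \<le> ?q" using nonneg s by simp
    have "?P s \<le> sqrt ?q"
    proof (rule rep_norm_least)
      fix v assume v: "v \<in> V"
      have "(n (\<pi> s v))\<^sup>2 \<le> n (\<pi> (fmul A B (fstar A B s) s) v) * n v" by (rule star[OF s v])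
      also have "\<dots> \<le> (?q * n v) * n v" using s v n by (intro mult_right_mono bound) auto
      also have "\<dots> = (sqrt ?q * n v)\<^sup>2" using q by (simp add: power2_eq_square power_mult_distrib algebra_simps)
      finally show "n (\<pi> s v) \<le> sqrt ?q * n v" using q n[OF v] by (rule_tac power2_le_imp_le) simp_all
    qed (use q in simp)
    then have "(?P s)\<^sup>2 \<le> (sqrt ?q)\<^sup>2" using nonneg[OF s] by (intro power_mono) auto
    then show ?thesis using q by simp
  qed
  have star_le: "?P (fstar A B s) \<le> ?P s" if s: "s \<in> fs" for s
  proof (cases "?P (fstar A B s) = 0")
    case True
    then show ?thesis using nonneg[OF s] by simp
  next
    case False
    have p: "0 < ?P (fstar A B s)" using nonneg[OF fstar_fs[OF s]] False by simp
    have "(?P (fstar A B s))\<^sup>2 \<le> ?P (fmul A B s (fstar A B s))"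
      using sq[OF fstar_fs[OF s]] by (simp add: fstar_fstar s)
    also have "\<dots> \<le> ?P s * ?P (fstar A B s)" using s by (intro submult) auto
    finally show ?thesis using p by (simp add: power2_eq_square)
  qed
  show ?thesis unfolding cstar_seminorm_def
  proof (intro conjI allI impI ballI)
    fix s r assume e: "eqv s r"
    then show "?P s = ?P r" unfolding rep_norm_def using eqv[OF e] by (metis (no_types, lifting))
  next
    fix s r assume s: "s \<in> fs" and r: "r \<in> fs"
    show "?P (s + r) \<le> ?P s + ?P r"
    proof (rule rep_norm_least)
      show "0 \<le> ?P s + ?P r" using nonneg s r by simp
      fix v assume v: "v \<in> V"
      show "n (\<pi> (s + r) v) \<le> (?P s + ?P r) * n v"
        using add[OF s r v] bound[OF s v] bound[OF r v] by (simp add: ring_distribs)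
    qed
  next
    fix c s assume s: "s \<in> fs"
    show "?P (fsmul A c s) = cmod c * ?P s"
    proof (rule antisym)
      show "?P (fsmul A c s) \<le> cmod c * ?P s"
        by (rule rep_norm_least) (use nonneg s bound smul in \<open>auto simp: mult_left_mono mult.assoc\<close>)
      show "cmod c * ?P s \<le> ?P (fsmul A c s)"
      proof (cases "c = 0")
        case True
        then show ?thesis using nonneg s by simp
      next
        case False
        have "?P s \<le> ?P (fsmul A c s) / cmod c"
        proof (rule rep_norm_least)
          show "0 \<le> ?P (fsmul A c s) / cmod c" using nonneg s by simp
          fix v assume v: "v \<in> V"
          have "cmod c * n (\<pi> s v) \<le> ?P (fsmul A c s) * n v"
            using bound[OF fsmul_fs[OF s] v, of c] smul[OF s v, of c] by simp
          then show "n (\<pi> s v) \<le> ?P (fsmul A c s) / cmod c * n v"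
            using False by (simp add: field_simps)
        qed
        then show ?thesis using False by (simp add: field_simps)
      qed
    qed
  next
    fix s assume s: "s \<in> fs"
    have "?P (fmul A B (fstar A B s) s) \<le> ?P (fstar A B s) * ?P s" using s by (intro submult) auto
    also have "\<dots> \<le> ?P s * ?P s" using star_le[OF s] nonneg[OF s] by (rule mult_right_mono)
    finally show "?P (fmul A B (fstar A B s) s) = (?P s)\<^sup>2"
      using sq[OF s] by (simp add: power2_eq_square)
  qed (use nonneg submult in auto)
qed

lemma cstar_norm_star_square:
  assumes "cstar_norm TA p" "s \<in> fs"
  shows "p (cls (fmul A B (fstar A B s) s)) = (p (cls s))\<^sup>2"
  using assms unfolding cstar_norm_def by (metis TA_mult TA_star cls_carrier fstar_fs)

lemma cstar_norm_projection:
  assumes p: "cstar_norm TA p" and q: "q \<in> fs" "fmul A B (fstar A B q) q = q"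
  shows "p (cls q) = 0 \<or> p (cls q) = 1"
  using cstar_norm_star_square[OF p q(1)] unfolding q(2)
  by (simp add: power2_eq_square)

text \<open>A projection has norm \<open>0\<close> or \<open>1\<close> by the C*-identity, so a partial isometry has norm at most \<open>1\<close>; this
covers unitaries and matrix units.\<close>

lemma cstar_norm_partial_isometry_le:
  assumes p: "cstar_norm TA p" and s: "s \<in> fs" "fmul A B (fstar A B s) s = q" "fmul A B (fstar A B q) q = q"
  shows "p (cls s) \<le> 1"
proof -
  have q: "q \<in> fs" using s fmul_fs fstar_fs by blast
  have "(p (cls s))\<^sup>2 = p (cls q)" using cstar_norm_star_square[OF p s(1)] s(2) by simp
  then have "(p (cls s))\<^sup>2 \<le> 1\<^sup>2" using cstar_norm_projection[OF p q s(3)] by auto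
  then show ?thesis by (rule power2_le_imp_le) simp
qed

lemma cstar_norm_unitary_le:
  assumes p: "cstar_norm TA p" and u: "unitary A u" and v: "unitary B v"
  shows "p (cls {#(u, v)#}) \<le> 1"
proof (rule cstar_norm_partial_isometry_le[OF p])
  let ?o = "{#(\<one>\<^bsub>A\<^esub>, \<one>\<^bsub>B\<^esub>)#}"
  show "{#(u, v)#} \<in> fs" using u v by (auto simp: unitary_def)
  show "fmul A B (fstar A B {#(u, v)#}) {#(u, v)#} = ?o"
    using u v by (simp add: fmul_single_left unitary_def)
  have "star A \<one>\<^bsub>A\<^esub> = \<one>\<^bsub>A\<^esub>" "star B \<one>\<^bsub>B\<^esub> = \<one>\<^bsub>B\<^esub>"
    using A.star_star[OF A.one_closed] A.star_mult[of "\<one>\<^bsub>A\<^esub>" "star A \<one>\<^bsub>A\<^esub>"]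
      B.star_star[OF B.one_closed] B.star_mult[of "\<one>\<^bsub>B\<^esub>" "star B \<one>\<^bsub>B\<^esub>"] by auto
  then show "fmul A B (fstar A B ?o) ?o = ?o" by (simp add: fmul_single_left)
qed

end

lemma (in tensor) cstar_norm_cls:
  assumes p: "cstar_norm TA p" and s: "s \<in> fs"
  shows "0 \<le> p (cls s)" "p (cls s) = 0 \<longleftrightarrow> eqv s {#}" "p (cls (fsmul A c s)) = cmod c * p (cls s)"
    "r \<in> fs \<Longrightarrow> p (cls (s + r)) \<le> p (cls s) + p (cls r)"
    "r \<in> fs \<Longrightarrow> p (cls (fmul A B s r)) \<le> p (cls s) * p (cls r)"
proof -
  note c = cls_carrier[OF s]
  show "0 \<le> p (cls s)" using p c unfolding cstar_norm_def by blast
  have "p (cls s) = 0 \<longleftrightarrow> cls s = \<zero>\<^bsub>TA\<^esub>" using p c unfolding cstar_norm_def by blast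
  then show "p (cls s) = 0 \<longleftrightarrow> eqv s {#}" by (simp add: TA_zero cls_eq s)
  have "p (c \<odot>\<^bsub>TA\<^esub> cls s) = cmod c * p (cls s)" using p c unfolding cstar_norm_def by blast
  then show "p (cls (fsmul A c s)) = cmod c * p (cls s)" by (simp add: TA_smult s)
  assume r: "r \<in> fs"
  have "p (cls s \<oplus>\<^bsub>TA\<^esub> cls r) \<le> p (cls s) + p (cls r)"
    using p c cls_carrier[OF r] unfolding cstar_norm_def by blast
  then show "p (cls (s + r)) \<le> p (cls s) + p (cls r)" by (simp add: TA_add s r)
  have "p (cls s \<otimes>\<^bsub>TA\<^esub> cls r) \<le> p (cls s) * p (cls r)"
    using p c cls_carrier[OF r] unfolding cstar_norm_def by blast
  then show "p (cls (fmul A B s r)) \<le> p (cls s) * p (cls r)" by (simp add: TA_mult s r)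
qed

section \<open>Families of matrices as elements of one ring\<close>

text \<open>The entry \<open>x m i j\<close> belongs to the matrix with index \<open>m\<close>. The sizes of the matrices are left open, so
that one type of class \<open>ring\<close> serves for all sequences of sizes and the abstract results apply to it;
local finiteness makes the product well defined.\<close>

typedef fam = "{x :: nat \<Rightarrow> nat \<Rightarrow> nat \<Rightarrow> complex. \<forall>m. \<exists>d. \<forall>i j. x m i j \<noteq> 0 \<longrightarrow> i < d \<and> j < d}"
  morphisms ent Fam
  by (rule exI[of _ "\<lambda>_ _ _. 0"]) simp

lemma fam_eqI: "(\<And>m i j. ent x m i j = ent y m i j) \<Longrightarrow> x = y"
  by (simp add: ent_inject[symmetric] fun_eq_iff)

lemma ent_support: "\<exists>d. \<forall>i j. ent x m i j \<noteq> 0 \<longrightarrow> i < d \<and> j < d"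
  using ent[of x] by blast

lemma ent_beyond: "\<exists>d. \<forall>m i j. i \<ge> d m \<or> j \<ge> d m \<longrightarrow> ent x m i j = 0"
proof -
  obtain d where "\<And>m i j. ent x m i j \<noteq> 0 \<Longrightarrow> i < d m \<and> j < d m" using ent_support by metis
  then show ?thesis by (intro exI[of _ d]) (metis leD)
qed

lemma ent_Fam:
  "(\<And>m i j. i \<ge> d m \<or> j \<ge> d m \<Longrightarrow> x m i j = 0) \<Longrightarrow> ent (Fam x) = x"
  by (rule Fam_inverse) (auto, metis linorder_not_less)

instantiation fam :: ring
begin

definition "0 = Fam (\<lambda>_ _ _. 0)"
definition "x + y = Fam (\<lambda>m i j. ent x m i j + ent y m i j)"
definition "x - y = Fam (\<lambda>m i j. ent x m i j - ent y m i j)"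
definition "- x = Fam (\<lambda>m i j. - ent x m i j)"
definition "x * y = Fam (\<lambda>m i j. \<Sum>k | ent x m i k \<noteq> 0. ent x m i k * ent y m k j)"

lemma ent_zero [simp]: "ent 0 m i j = 0"
  by (simp add: zero_fam_def ent_Fam)

lemma ent_add [simp]: "ent (x + y) m i j = ent x m i j + ent y m i j"
proof -
  obtain d d' where "\<And>m i j. i \<ge> d m \<or> j \<ge> d m \<Longrightarrow> ent x m i j = 0"
    "\<And>m i j. i \<ge> d' m \<or> j \<ge> d' m \<Longrightarrow> ent y m i j = 0" using ent_beyond by metis
  then show ?thesis unfolding plus_fam_def
    by (subst ent_Fam[where d = "\<lambda>m. max (d m) (d' m)"]) auto
qed

lemma ent_diff [simp]: "ent (x - y) m i j = ent x m i j - ent y m i j"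
proof -
  obtain d d' where "\<And>m i j. i \<ge> d m \<or> j \<ge> d m \<Longrightarrow> ent x m i j = 0"
    "\<And>m i j. i \<ge> d' m \<or> j \<ge> d' m \<Longrightarrow> ent y m i j = 0" using ent_beyond by metis
  then show ?thesis unfolding minus_fam_def
    by (subst ent_Fam[where d = "\<lambda>m. max (d m) (d' m)"]) auto
qed

lemma ent_uminus [simp]: "ent (- x) m i j = - ent x m i j"
proof -
  obtain d where "\<And>m i j. i \<ge> d m \<or> j \<ge> d m \<Longrightarrow> ent x m i j = 0" using ent_beyond by metis
  then show ?thesis unfolding uminus_fam_def
    by (subst ent_Fam[where d = d]) auto
qed

lemma ent_mult:
  assumes "\<And>i k. ent x m i k \<noteq> 0 \<Longrightarrow> k < d"
  shows "ent (x * y) m i j = (\<Sum>k<d. ent x m i k * ent y m k j)"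
proof -
  obtain c c' where c: "\<And>m i j. ent x m i j \<noteq> 0 \<Longrightarrow> i < c m \<and> j < c m"
    "\<And>m i j. ent y m i j \<noteq> 0 \<Longrightarrow> i < c' m \<and> j < c' m" using ent_support by metis
  have "ent (x * y) m i j = (\<Sum>k | ent x m i k \<noteq> 0. ent x m i k * ent y m k j)"
    unfolding times_fam_def
  proof (subst ent_Fam[where d = "\<lambda>m. max (c m) (c' m)"])
    fix m i j assume ij: "max (c m) (c' m) \<le> i \<or> max (c m) (c' m) \<le> j"
    have "ent x m i k * ent y m k j = 0" for k
    proof (rule ccontr)
      assume "ent x m i k * ent y m k j \<noteq> 0"
      then have "i < c m" "j < c' m" using c by auto
      then show False using ij by linarith
    qed
    then show "(\<Sum>k | ent x m i k \<noteq> 0. ent x m i k * ent y m k j) = 0" by (rule sum.neutral[OF ballI])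
  qed simp
  also have "\<dots> = (\<Sum>k<d. ent x m i k * ent y m k j)"
    using assms by (intro sum.mono_neutral_left) auto
  finally show ?thesis .
qed

instance
proof
  fix x y z :: fam
  show "x * y * z = x * (y * z)"
  proof (rule fam_eqI)
    fix m i j
    obtain c c' where c: "\<And>i j. ent x m i j \<noteq> 0 \<Longrightarrow> i < c \<and> j < c"
      "\<And>i j. ent y m i j \<noteq> 0 \<Longrightarrow> i < c' \<and> j < c'" using ent_support by metis
    have xy: "ent (x * y) m i k = (\<Sum>l<c. ent x m i l * ent y m l k)" for i k
      using c by (intro ent_mult) auto
    have nz: "k < c'" if "ent (x * y) m i k \<noteq> 0" for i k
    proof -
      have "\<exists>l<c. ent x m i l * ent y m l k \<noteq> 0"
        using that unfolding xy by (meson lessThan_iff sum.neutral)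
      then show ?thesis using c by auto
    qed
    have "ent (x * y * z) m i j = (\<Sum>k<c'. \<Sum>l<c. ent x m i l * ent y m l k * ent z m k j)"
      using nz by (subst ent_mult[where d = c']) (auto simp: xy sum_distrib_right)
    also have "\<dots> = (\<Sum>l<c. \<Sum>k<c'. ent x m i l * ent y m l k * ent z m k j)" by (rule sum.swap)
    also have "\<dots> = (\<Sum>l<c. ent x m i l * ent (y * z) m l j)"
      using c by (subst ent_mult[where d = c' and x = y]) (auto simp: sum_distrib_left mult.assoc)
    also have "\<dots> = ent (x * (y * z)) m i j"
      using c by (intro ent_mult[symmetric]) auto
    finally show "ent (x * y * z) m i j = ent (x * (y * z)) m i j" .
  qed
  show "(x + y) * z = x * z + y * z"
  proof (rule fam_eqI)
    fix m i j
    obtain c c' where c: "\<And>i j. ent x m i j \<noteq> 0 \<Longrightarrow> i < c \<and> j < c"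
      "\<And>i j. ent y m i j \<noteq> 0 \<Longrightarrow> i < c' \<and> j < c'" using ent_support by metis
    let ?d = "max c c'"
    have d: "ent x m i k \<noteq> 0 \<Longrightarrow> k < ?d" "ent y m i k \<noteq> 0 \<Longrightarrow> k < ?d"
      "ent (x + y) m i k \<noteq> 0 \<Longrightarrow> k < ?d" for i k
      using c[of i k] by (cases "ent x m i k = 0"; auto simp: less_max_iff_disj)+
    have "ent ((x + y) * z) m i j = (\<Sum>k<?d. ent (x + y) m i k * ent z m k j)"
      "ent (x * z) m i j = (\<Sum>k<?d. ent x m i k * ent z m k j)"
      "ent (y * z) m i j = (\<Sum>k<?d. ent y m i k * ent z m k j)"
      by (rule ent_mult, rule d, assumption)+
    then show "ent ((x + y) * z) m i j = ent (x * z + y * z) m i j"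
      by (simp add: distrib_right sum.distrib)
  qed
  show "x * (y + z) = x * y + x * z"
  proof (rule fam_eqI)
    fix m i j
    obtain c where c: "\<And>i j. ent x m i j \<noteq> 0 \<Longrightarrow> i < c \<and> j < c" using ent_support by metis
    then have "ent x m i k \<noteq> 0 \<Longrightarrow> k < c" for i k by blast
    then show "ent (x * (y + z)) m i j = ent (x * y + x * z) m i j"
      by (simp add: ent_mult[where d = c] distrib_left sum.distrib)
  qed
qed (rule fam_eqI, simp)+

end

definition fscl :: "complex \<Rightarrow> fam \<Rightarrow> fam" where
  "fscl c x = Fam (\<lambda>m i j. c * ent x m i j)"

definition fadj :: "fam \<Rightarrow> fam" where
  "fadj x = Fam (\<lambda>m i j. cnj (ent x m j i))"

lemma ent_fscl [simp]: "ent (fscl c x) m i j = c * ent x m i j"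
proof -
  obtain d where "\<And>m i j. i \<ge> d m \<or> j \<ge> d m \<Longrightarrow> ent x m i j = 0" using ent_beyond by metis
  then show ?thesis unfolding fscl_def
    by (subst ent_Fam[where d = d]) auto
qed

lemma ent_fadj [simp]: "ent (fadj x) m i j = cnj (ent x m j i)"
proof -
  obtain d where "\<And>m i j. i \<ge> d m \<or> j \<ge> d m \<Longrightarrow> ent x m i j = 0" using ent_beyond by metis
  then show ?thesis unfolding fadj_def
    by (subst ent_Fam[where d = d]) auto
qed

lemma fadj_mult: "fadj (x * y) = fadj y * fadj x"
proof (rule fam_eqI)
  fix m i j
  obtain c c' where c: "\<And>i j. ent x m i j \<noteq> 0 \<Longrightarrow> i < c \<and> j < c"
    "\<And>i j. ent y m i j \<noteq> 0 \<Longrightarrow> i < c' \<and> j < c'" using ent_support by metis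
  let ?d = "max c c'"
  have d: "ent x m i k \<noteq> 0 \<Longrightarrow> k < ?d" "ent (fadj y) m i k \<noteq> 0 \<Longrightarrow> k < ?d" for i k
    using c[of i k] c[of k i] by (auto simp: less_max_iff_disj)
  have "ent (x * y) m j i = (\<Sum>k<?d. ent x m j k * ent y m k i)"
    "ent (fadj y * fadj x) m i j = (\<Sum>k<?d. ent (fadj y) m i k * ent (fadj x) m k j)"
    by (rule ent_mult, rule d, assumption)+
  then show "ent (fadj (x * y)) m i j = ent (fadj y * fadj x) m i j"
    by (simp add: cnj_sum mult.commute)
qed

lemma fscl_mult_left: "fscl c x * y = fscl c (x * y)"
proof (rule fam_eqI)
  fix m i j
  obtain d where d: "\<And>i j. ent x m i j \<noteq> 0 \<Longrightarrow> i < d \<and> j < d" using ent_support by metis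
  then have "ent x m i k \<noteq> 0 \<Longrightarrow> k < d" "ent (fscl c x) m i k \<noteq> 0 \<Longrightarrow> k < d" for i k
    by auto
  then have "ent (fscl c x * y) m i j = (\<Sum>k<d. ent (fscl c x) m i k * ent y m k j)"
    "ent (x * y) m i j = (\<Sum>k<d. ent x m i k * ent y m k j)"
    by (auto intro: ent_mult simp del: ent_fscl)
  then show "ent (fscl c x * y) m i j = ent (fscl c (x * y)) m i j"
    by (simp add: sum_distrib_left mult.assoc)
qed

lemma fscl_mult_right: "x * fscl c y = fscl c (x * y)"
proof (rule fam_eqI)
  fix m i j
  obtain d where d: "\<And>i j. ent x m i j \<noteq> 0 \<Longrightarrow> i < d \<and> j < d" using ent_support by metis
  then have "ent x m i k \<noteq> 0 \<Longrightarrow> k < d" for i k by blast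
  then show "ent (x * fscl c y) m i j = ent (fscl c (x * y)) m i j"
    by (simp add: ent_mult[where d = d] sum_distrib_left mult.left_commute)
qed

definition app :: "nat \<Rightarrow> (nat \<Rightarrow> nat \<Rightarrow> complex) \<Rightarrow> (nat \<Rightarrow> complex) \<Rightarrow> nat \<Rightarrow> complex" where
  "app d a v i = (\<Sum>j<d. a i j * v j)"

definition nsq :: "nat \<Rightarrow> (nat \<Rightarrow> complex) \<Rightarrow> real" where
  "nsq d v = (\<Sum>i<d. (cmod (v i))\<^sup>2)"

lemma nsq_nonneg [simp]: "0 \<le> nsq d v"
  by (simp add: nsq_def sum_nonneg)

lemma nsq_add_le: "nsq d (\<lambda>i. v i + w i) \<le> 2 * nsq d v + 2 * nsq d w"
proof -
  have "(cmod (a + b))\<^sup>2 \<le> 2 * (cmod a)\<^sup>2 + 2 * (cmod b)\<^sup>2" for a b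
  proof -
    have "(cmod (a + b))\<^sup>2 \<le> (cmod a + cmod b)\<^sup>2" by (intro power_mono norm_triangle_ineq) simp
    also have "\<dots> \<le> 2 * (cmod a)\<^sup>2 + 2 * (cmod b)\<^sup>2"
      using sum_squares_bound[of "cmod a" "cmod b"] by (simp add: power2_sum)
    finally show ?thesis .
  qed
  then show ?thesis unfolding nsq_def sum_distrib_left sum.distrib[symmetric] by (intro sum_mono)
qed

locale dims = fixes N :: "nat \<Rightarrow> nat"
begin

definition supported :: "fam \<Rightarrow> bool" where
  "supported x \<longleftrightarrow> (\<forall>m i j. ent x m i j \<noteq> 0 \<longrightarrow> i < N m \<and> j < N m)"

text \<open>The constant bounds the squares of the operator norms.\<close>

definition obound :: "fam \<Rightarrow> bool" where
  "obound x \<longleftrightarrow> (\<exists>K\<ge>0. \<forall>m v. nsq (N m) (app (N m) (ent x m) v) \<le> K * nsq (N m) v)"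

definition M :: "fam set" where
  "M = {x. supported x \<and> obound x \<and> obound (fadj x)}"

lemma ent_mult_supported:
  "supported x \<Longrightarrow> ent (x * y) m i j = (\<Sum>k<N m. ent x m i k * ent y m k j)"
  by (rule ent_mult) (auto simp: supported_def)

lemma supported_0: "supported x \<Longrightarrow> \<not> (i < N m \<and> j < N m) \<Longrightarrow> ent x m i j = 0"
  unfolding supported_def by blast

lemma supported_add: "supported x \<Longrightarrow> supported y \<Longrightarrow> supported (x + y)"
  unfolding supported_def by (metis add.right_neutral add_0 ent_add)

lemma supported_fscl: "supported x \<Longrightarrow> supported (fscl c x)"
  unfolding supported_def by auto

lemma supported_fadj: "supported x \<Longrightarrow> supported (fadj x)"
  unfolding supported_def by auto

lemma supported_mult:
  assumes "supported x" "supported y"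
  shows "supported (x * y)"
  unfolding supported_def[of "x * y"]
proof (intro allI impI)
  fix m i j assume "ent (x * y) m i j \<noteq> 0"
  then have "(\<Sum>k<N m. ent x m i k * ent y m k j) \<noteq> 0" by (simp add: ent_mult_supported assms)
  then obtain k where "ent x m i k * ent y m k j \<noteq> 0" by (meson sum.neutral)
  then show "i < N m \<and> j < N m" using assms unfolding supported_def by auto
qed

lemma obound_add:
  assumes "obound x" "obound y"
  shows "obound (x + y)"
proof -
  obtain K L where K: "K \<ge> 0" "\<And>m v. nsq (N m) (app (N m) (ent x m) v) \<le> K * nsq (N m) v"
    and L: "L \<ge> 0" "\<And>m v. nsq (N m) (app (N m) (ent y m) v) \<le> L * nsq (N m) v"
    using assms unfolding obound_def by blast
  have "nsq (N m) (app (N m) (ent (x + y) m) v) \<le> (2 * K + 2 * L) * nsq (N m) v" for m v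
  proof -
    have "app (N m) (ent (x + y) m) v = (\<lambda>i. app (N m) (ent x m) v i + app (N m) (ent y m) v i)"
      by (simp add: app_def fun_eq_iff distrib_right sum.distrib)
    then show ?thesis using nsq_add_le[of "N m" "app (N m) (ent x m) v" "app (N m) (ent y m) v"] K(2)[of m v] L(2)[of m v]
      by (simp add: distrib_right)
  qed
  then show ?thesis using K(1) L(1) unfolding obound_def by (intro exI[of _ "2 * K + 2 * L"]) auto
qed

lemma obound_fscl:
  assumes "obound x"
  shows "obound (fscl c x)"
proof -
  obtain K where K: "K \<ge> 0" "\<And>m v. nsq (N m) (app (N m) (ent x m) v) \<le> K * nsq (N m) v"
    using assms unfolding obound_def by blast
  have "nsq (N m) (app (N m) (ent (fscl c x) m) v) = (cmod c)\<^sup>2 * nsq (N m) (app (N m) (ent x m) v)" for m v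
    by (simp add: nsq_def app_def mult.assoc sum_distrib_left[symmetric] norm_mult power_mult_distrib)
  then have "nsq (N m) (app (N m) (ent (fscl c x) m) v) \<le> (cmod c)\<^sup>2 * K * nsq (N m) v" for m v
    using K(2)[of m v] by (simp add: mult_left_mono mult.assoc)
  then show ?thesis using K(1) unfolding obound_def by (intro exI[of _ "(cmod c)\<^sup>2 * K"]) auto
qed

lemma app_mult:
  assumes "supported x"
  shows "app (N m) (ent (x * y) m) v = app (N m) (ent x m) (app (N m) (ent y m) v)"
proof
  fix i
  have "app (N m) (ent (x * y) m) v i = (\<Sum>j<N m. \<Sum>k<N m. ent x m i k * (ent y m k j * v j))"
    by (simp add: app_def ent_mult_supported[OF assms] sum_distrib_right mult.assoc)
  also have "\<dots> = (\<Sum>k<N m. \<Sum>j<N m. ent x m i k * (ent y m k j * v j))" by (rule sum.swap)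
  finally show "app (N m) (ent (x * y) m) v i = app (N m) (ent x m) (app (N m) (ent y m) v) i"
    by (simp add: app_def sum_distrib_left)
qed

lemma obound_mult:
  assumes "supported x" "obound x" "obound y"
  shows "obound (x * y)"
proof -
  obtain K L where K: "K \<ge> 0" "\<And>m v. nsq (N m) (app (N m) (ent x m) v) \<le> K * nsq (N m) v"
    and L: "L \<ge> 0" "\<And>m v. nsq (N m) (app (N m) (ent y m) v) \<le> L * nsq (N m) v"
    using assms unfolding obound_def by blast
  have "nsq (N m) (app (N m) (ent (x * y) m) v) \<le> (K * L) * nsq (N m) v" for m v
  proof -
    have "nsq (N m) (app (N m) (ent (x * y) m) v) \<le> K * nsq (N m) (app (N m) (ent y m) v)"
      unfolding app_mult[OF assms(1)] by (rule K(2))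
    also have "\<dots> \<le> K * (L * nsq (N m) v)" using K(1) L(2) by (intro mult_left_mono) auto
    finally show ?thesis by simp
  qed
  then show ?thesis using K(1) L(1) unfolding obound_def by (intro exI[of _ "K * L"]) auto
qed

lemma fadj_add: "fadj (x + y) = fadj x + fadj y"
  by (rule fam_eqI) simp

lemma fadj_fscl: "fadj (fscl c x) = fscl (cnj c) (fadj x)"
  by (rule fam_eqI) simp

lemma fadj_fadj [simp]: "fadj (fadj x) = x"
  by (rule fam_eqI) simp

sublocale star_ring fscl fadj M
proof
  fix c d :: complex and x y :: fam
  show "fscl c x * y = fscl c (x * y)" by (rule fscl_mult_left)
  show "x * fscl c y = fscl c (x * y)" by (rule fscl_mult_right)
  show "fadj (x * y) = fadj y * fadj x" by (rule fadj_mult)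
  show "fscl c (x + y) = fscl c x + fscl c y" "fscl (c + d) x = fscl c x + fscl d x"
    "fscl c (fscl d x) = fscl (c * d) x" "fscl 1 x = x"
    by (rule fam_eqI; simp add: algebra_simps)+
  show "fadj (x + y) = fadj x + fadj y" by (rule fadj_add)
  show "fadj (fscl c x) = fscl (cnj c) (fadj x)" by (rule fadj_fscl)
  show "fadj (fadj x) = x" by simp
  show "x \<in> M \<Longrightarrow> y \<in> M \<Longrightarrow> x + y \<in> M"
    by (simp add: M_def supported_add obound_add fadj_add)
  show "x \<in> M \<Longrightarrow> y \<in> M \<Longrightarrow> x * y \<in> M"
    by (simp add: M_def supported_mult obound_mult fadj_mult supported_fadj)
  show "x \<in> M \<Longrightarrow> fscl c x \<in> M"
    by (simp add: M_def supported_fscl obound_fscl fadj_fscl)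
  show "x \<in> M \<Longrightarrow> fadj x \<in> M" by (simp add: M_def supported_fadj)
  have "fadj 0 = 0" by (rule fam_eqI) simp
  then show "0 \<in> M" by (auto simp: M_def supported_def obound_def nsq_def app_def)
qed

lemma M_supported: "x \<in> M \<Longrightarrow> supported x" and M_obound: "x \<in> M \<Longrightarrow> obound x"
  by (auto simp: M_def)

definition mtr :: "nat \<Rightarrow> fam \<Rightarrow> complex" where
  "mtr m x = (\<Sum>i<N m. ent x m i i) / of_nat (N m)"

lemma mtr_bounded:
  assumes "x \<in> M"
  shows "\<exists>K. \<forall>m. cmod (mtr m x) \<le> K"
proof -
  obtain K where K: "K \<ge> 0" "\<And>m v. nsq (N m) (app (N m) (ent x m) v) \<le> K * nsq (N m) v"
    using M_obound[OF assms] unfolding obound_def by blast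
  have diag: "cmod (ent x m i i) \<le> sqrt K" if i: "i < N m" for m i
  proof -
    let ?v = "\<lambda>j. if j = i then 1 else 0 :: complex"
    have v: "nsq (N m) ?v = 1"
      unfolding nsq_def using i by (simp add: if_distrib[of cmod] if_distrib[of "\<lambda>z. z\<^sup>2"] cong: if_cong)
    have a: "app (N m) (ent x m) ?v l = ent x m l i" for l
      unfolding app_def using i by (simp add: if_distrib cong: if_cong)
    have "(cmod (ent x m i i))\<^sup>2 \<le> nsq (N m) (app (N m) (ent x m) ?v)"
      unfolding nsq_def a using i by (intro member_le_sum) auto
    also have "\<dots> \<le> K" using K(2)[of m ?v] v by simp
    finally show ?thesis by (rule real_le_rsqrt)
  qed
  have "cmod (mtr m x) \<le> sqrt K" for m
  proof (cases "N m = 0")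
    case True
    then show ?thesis using K(1) by (simp add: mtr_def)
  next
    case False
    have "cmod (\<Sum>i<N m. ent x m i i) \<le> (\<Sum>i<N m. sqrt K)"
      using diag by (intro order_trans[OF norm_sum] sum_mono) auto
    then show ?thesis using False by (simp add: mtr_def norm_divide divide_le_eq mult.commute)
  qed
  then show ?thesis by blast
qed

lemma mtr_add: "mtr m (x + y) = mtr m x + mtr m y"
  by (simp add: mtr_def sum.distrib add_divide_distrib)

lemma mtr_fscl: "mtr m (fscl c x) = c * mtr m x"
  by (simp add: mtr_def sum_distrib_left)

lemma mtr_fadj: "mtr m (fadj x) = cnj (mtr m x)"
  by (simp add: mtr_def cnj_sum)

lemma mtr_comm: "supported x \<Longrightarrow> supported y \<Longrightarrow> mtr m (x * y) = mtr m (y * x)"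
  unfolding mtr_def ent_mult_supported by (subst sum.swap) (simp add: ent_mult_supported mult.commute)

lemma mtr_sq:
  assumes "supported x"
  shows "mtr m (fadj x * x) = complex_of_real ((\<Sum>j<N m. nsq (N m) (\<lambda>i. ent x m i j)) / real (N m))"
proof -
  have "ent (fadj x * x) m j j = complex_of_real (nsq (N m) (\<lambda>i. ent x m i j))" for j
    unfolding ent_mult_supported[OF supported_fadj[OF assms]] nsq_def
    by (simp add: complex_norm_square mult.commute del: of_real_power)
  then show ?thesis by (simp add: mtr_def)
qed

definition utr :: "nat filter \<Rightarrow> fam \<Rightarrow> complex" where
  "utr U x = Lim U (\<lambda>m. mtr m x)"

lemma utr_tendsto:
  assumes "ultra U" "x \<in> M"
  shows "((\<lambda>m. mtr m x) \<longlongrightarrow> utr U x) U"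
proof -
  obtain K where "\<And>m. cmod (mtr m x) \<le> K" using mtr_bounded[OF assms(2)] by blast
  then show ?thesis unfolding utr_def by (rule ultra_tendsto_Lim[OF assms(1)])
qed

lemma utr_eqI:
  assumes "ultra U" "x \<in> M" "((\<lambda>m. mtr m x) \<longlongrightarrow> l) U"
  shows "utr U x = l"
  using tendsto_unique[OF _ utr_tendsto[OF assms(1,2)] assms(3)] assms(1) by (simp add: ultra_def)

text \<open>All properties pass to the limit from the normalized traces; multiplication by \<open>x\<close> is bounded because
it acts on each column of a matrix separately.\<close>

lemma tracial_utr:
  assumes U: "ultra U"
  shows "tracial fscl fadj M (utr U)"
proof
  have nb: "U \<noteq> bot" using U by (simp add: ultra_def)
  fix x y :: fam and c :: complex
  show "utr U (x + y) = utr U x + utr U y" if "x \<in> M" "y \<in> M"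
    using that by (intro utr_eqI[OF U]) (auto simp: mtr_add intro: tendsto_add utr_tendsto[OF U])
  show "utr U (fscl c x) = c * utr U x" if "x \<in> M"
    using that by (intro utr_eqI[OF U]) (auto simp: mtr_fscl intro: tendsto_mult_left utr_tendsto[OF U])
  show "utr U (x * y) = utr U (y * x)" if "x \<in> M" "y \<in> M"
    using that by (simp add: utr_def mtr_comm M_supported)
  show "utr U (fadj x) = cnj (utr U x)" if "x \<in> M"
    using that by (intro utr_eqI[OF U]) (auto simp: mtr_fadj intro: tendsto_cnj utr_tendsto[OF U])
  show "0 \<le> Re (utr U (fadj x * x))" if x: "x \<in> M"
  proof (rule tendsto_lowerbound[OF _ _ nb])
    show "((\<lambda>m. Re (mtr m (fadj x * x))) \<longlongrightarrow> Re (utr U (fadj x * x))) U"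
      using x by (intro tendsto_Re utr_tendsto[OF U]) auto
    show "eventually (\<lambda>m. 0 \<le> Re (mtr m (fadj x * x))) U"
      using x by (intro always_eventually allI) (simp add: mtr_sq M_supported sum_nonneg)
  qed
  show "\<exists>K\<ge>0. \<forall>y\<in>M. Re (utr U (fadj (x * y) * (x * y))) \<le> K\<^sup>2 * Re (utr U (fadj y * y))"
    if x: "x \<in> M"
  proof -
    obtain K where K: "K \<ge> 0" "\<And>m v. nsq (N m) (app (N m) (ent x m) v) \<le> K * nsq (N m) v"
      using M_obound[OF x] unfolding obound_def by blast
    have "Re (utr U (fadj (x * y) * (x * y))) \<le> K * Re (utr U (fadj y * y))" if y: "y \<in> M" for y
    proof (rule tendsto_le[OF nb])
      show "((\<lambda>m. K * Re (mtr m (fadj y * y))) \<longlongrightarrow> K * Re (utr U (fadj y * y))) U"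
        using y by (intro tendsto_mult_left tendsto_Re utr_tendsto[OF U]) auto
      show "((\<lambda>m. Re (mtr m (fadj (x * y) * (x * y)))) \<longlongrightarrow> Re (utr U (fadj (x * y) * (x * y)))) U"
        using x y by (intro tendsto_Re utr_tendsto[OF U]) auto
      have "Re (mtr m (fadj (x * y) * (x * y))) \<le> K * Re (mtr m (fadj y * y))" for m
      proof -
        have col: "(\<lambda>i. ent (x * y) m i j) = app (N m) (ent x m) (\<lambda>i. ent y m i j)" for j
          using x by (simp add: fun_eq_iff app_def ent_mult_supported M_supported)
        have "(\<Sum>j<N m. nsq (N m) (\<lambda>i. ent (x * y) m i j)) \<le> (\<Sum>j<N m. K * nsq (N m) (\<lambda>i. ent y m i j))"
          unfolding col by (intro sum_mono K(2))
        then have "(\<Sum>j<N m. nsq (N m) (\<lambda>i. ent (x * y) m i j)) / real (N m)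
            \<le> (K * (\<Sum>j<N m. nsq (N m) (\<lambda>i. ent y m i j))) / real (N m)"
          by (intro divide_right_mono) (auto simp: sum_distrib_left)
        then show ?thesis using x y
          by (simp add: mtr_sq M_supported supported_mult)
      qed
      then show "eventually (\<lambda>m. Re (mtr m (fadj (x * y) * (x * y))) \<le> K * Re (mtr m (fadj y * y))) U"
        by simp
    qed
    then show ?thesis using K(1) by (intro exI[of _ "sqrt K"]) auto
  qed
qed

end

section \<open>Bounded direct sums of matrix algebras\<close>

text \<open>An injective homomorphism into the ring transports its laws, which spares their verification for the
extensional families of matrices that make up a direct sum.\<close>

lemma (in star_ring) star_algebra_embedding:
  fixes A :: "('a, 'm) star_alg_scheme" and \<iota> :: "'a \<Rightarrow> 'x"
  assumes inj: "inj_on \<iota> (carrier A)"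
    and closed: "\<zero>\<^bsub>A\<^esub> \<in> carrier A" "\<one>\<^bsub>A\<^esub> \<in> carrier A"
      "\<And>a b. a \<in> carrier A \<Longrightarrow> b \<in> carrier A \<Longrightarrow> a \<oplus>\<^bsub>A\<^esub> b \<in> carrier A"
      "\<And>a b. a \<in> carrier A \<Longrightarrow> b \<in> carrier A \<Longrightarrow> a \<otimes>\<^bsub>A\<^esub> b \<in> carrier A"
      "\<And>z a. a \<in> carrier A \<Longrightarrow> z \<odot>\<^bsub>A\<^esub> a \<in> carrier A"
      "\<And>a. a \<in> carrier A \<Longrightarrow> star A a \<in> carrier A"
    and hom: "\<iota> \<zero>\<^bsub>A\<^esub> = 0"
      "\<And>a b. a \<in> carrier A \<Longrightarrow> b \<in> carrier A \<Longrightarrow> \<iota> (a \<oplus>\<^bsub>A\<^esub> b) = \<iota> a + \<iota> b"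
      "\<And>a b. a \<in> carrier A \<Longrightarrow> b \<in> carrier A \<Longrightarrow> \<iota> (a \<otimes>\<^bsub>A\<^esub> b) = \<iota> a * \<iota> b"
      "\<And>z a. a \<in> carrier A \<Longrightarrow> \<iota> (z \<odot>\<^bsub>A\<^esub> a) = scl z (\<iota> a)"
      "\<And>a. a \<in> carrier A \<Longrightarrow> \<iota> (star A a) = adj (\<iota> a)"
    and unit: "\<And>a. a \<in> carrier A \<Longrightarrow> \<iota> \<one>\<^bsub>A\<^esub> * \<iota> a = \<iota> a" "\<And>a. a \<in> carrier A \<Longrightarrow> \<iota> a * \<iota> \<one>\<^bsub>A\<^esub> = \<iota> a"
  shows "star_algebra A"
  by unfold_locales
    (rule closed inj_onD[OF inj];
      simp add: closed hom unit distrib_left distrib_right mult.assoc scl_mult_left scl_mult_right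
        scl_add_right scl_add_left scl_one scl_scl adj_add adj_mult adj_scl)+

interpretation cvec: pos_form UNIV "\<lambda>v z w i. v i + z * w i" "\<lambda>v w. \<Sum>i<d. v i * cnj (w i)" for d :: nat
proof
  fix v w x :: "nat \<Rightarrow> complex" and z
  show "(\<Sum>i<d. (v i + z * w i) * cnj (x i)) = (\<Sum>i<d. v i * cnj (x i)) + z * (\<Sum>i<d. w i * cnj (x i))"
    by (simp add: distrib_right sum.distrib sum_distrib_left mult.assoc)
  show "(\<Sum>i<d. w i * cnj (v i)) = cnj (\<Sum>i<d. v i * cnj (w i))"
    by (simp add: cnj_sum mult.commute)
  have "0 \<le> Re (v i * cnj (v i))" for i
    by (metis Re_complex_of_real complex_norm_square zero_le_power2)
  then show "0 \<le> Re (\<Sum>i<d. v i * cnj (v i))" unfolding Re_sum by (intro sum_nonneg)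
qed simp

lemma nsq_ip: "complex_of_real (nsq d v) = (\<Sum>i<d. v i * cnj (v i))"
  by (simp add: nsq_def complex_norm_square del: of_real_power)

lemma cvec_nrm: "cvec.nrm d v = sqrt (nsq d v)"
  by (simp add: cvec.nrm_def nsq_ip[symmetric])

lemma cvec_Cauchy_Schwarz: "cmod (\<Sum>i<d. v i * cnj (w i)) \<le> sqrt (nsq d v) * sqrt (nsq d w)"
  using cvec.Cauchy_Schwarz[of v w d] by (simp add: cvec_nrm)

lemma mat_adjoint_index:
  "A \<in> carrier_mat n n \<Longrightarrow> i < n \<Longrightarrow> j < n \<Longrightarrow> mat_adjoint A $$ (i, j) = cnj (A $$ (j, i))"
  by (auto simp: mat_adjoint_def mat_of_rows_index conjugate_complex_def)

lemma mat_adjoint_carrier: "A \<in> carrier_mat n n \<Longrightarrow> mat_adjoint A \<in> carrier_mat n n"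
  by (auto simp: mat_adjoint_def)

lemma vec_norm2_nsq: "v \<in> carrier_vec n \<Longrightarrow> vec_norm2 v = sqrt (nsq n (\<lambda>i. v $ i))"
  by (auto simp: vec_norm2_def nsq_def)

lemma mult_mat_vec_app:
  assumes "a \<in> carrier_mat n n" "v \<in> carrier_vec n"
  shows "vec_norm2 (a *\<^sub>v v) = sqrt (nsq n (app n (\<lambda>i j. a $$ (i, j)) (\<lambda>i. v $ i)))"
proof -
  have "(a *\<^sub>v v) $ i = app n (\<lambda>i j. a $$ (i, j)) (\<lambda>i. v $ i) i" if "i < n" for i
    using assms that by (simp add: scalar_prod_def app_def lessThan_atLeast0)
  then have "nsq n (\<lambda>i. (a *\<^sub>v v) $ i) = nsq n (app n (\<lambda>i j. a $$ (i, j)) (\<lambda>i. v $ i))"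
    unfolding nsq_def by (intro sum.cong) auto
  then show ?thesis using vec_norm2_nsq[of "a *\<^sub>v v" n] assms by simp
qed

lemma app_bounded: "\<exists>K\<ge>0. \<forall>v. nsq n (app n a v) \<le> K * nsq n v"
proof -
  let ?K = "\<Sum>i<n. (\<Sum>j<n. cmod (a i j))\<^sup>2"
  have "nsq n (app n a v) \<le> ?K * nsq n v" for v
  proof -
    have c: "cmod (v j) \<le> sqrt (nsq n v)" if "j < n" for j
      unfolding nsq_def using that by (intro real_le_rsqrt member_le_sum) auto
    have "(cmod (app n a v i))\<^sup>2 \<le> (\<Sum>j<n. cmod (a i j))\<^sup>2 * nsq n v" for i
    proof -
      have "cmod (app n a v i) \<le> (\<Sum>j<n. cmod (a i j) * cmod (v j))"
        unfolding app_def by (rule order_trans[OF norm_sum]) (simp add: norm_mult)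
      also have "\<dots> \<le> (\<Sum>j<n. cmod (a i j) * sqrt (nsq n v))"
        using c by (intro sum_mono mult_left_mono) auto
      also have "\<dots> = (\<Sum>j<n. cmod (a i j)) * sqrt (nsq n v)" by (simp add: sum_distrib_right)
      finally have "(cmod (app n a v i))\<^sup>2 \<le> ((\<Sum>j<n. cmod (a i j)) * sqrt (nsq n v))\<^sup>2"
        by (intro power_mono) auto
      then show ?thesis by (simp add: power_mult_distrib)
    qed
    then show ?thesis unfolding nsq_def[of n "app n a v"] sum_distrib_right by (intro sum_mono)
  qed
  then show ?thesis by (intro exI[of _ ?K]) (auto intro: sum_nonneg)
qed

lemma nsq_scale: "nsq n (\<lambda>i. c * v i) = (cmod c)\<^sup>2 * nsq n v"
  by (simp add: nsq_def norm_mult power_mult_distrib sum_distrib_left)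

lemma app_scale: "app n a (\<lambda>i. c * v i) = (\<lambda>i. c * app n a v i)"
  by (simp add: app_def fun_eq_iff sum_distrib_left mult.left_commute)

lemma
  assumes a: "a \<in> carrier_mat n n"
  shows op_norm_nonneg: "0 \<le> op_norm a"
    and op_norm_bound: "nsq n (app n (\<lambda>i j. a $$ (i, j)) v) \<le> (op_norm a)\<^sup>2 * nsq n v"
    and op_norm_least: "0 \<le> c \<Longrightarrow> (\<And>v. nsq n (app n (\<lambda>i j. a $$ (i, j)) v) \<le> c\<^sup>2 * nsq n v) \<Longrightarrow> op_norm a \<le> c"
proof -
  let ?a = "\<lambda>i j. a $$ (i, j)"
  let ?S = "{v \<in> carrier_vec (dim_col a). vec_norm2 v \<le> 1}"
  have dc: "dim_col a = n" using a by auto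
  obtain K where K: "K \<ge> 0" "\<And>v. nsq n (app n ?a v) \<le> K * nsq n v" using app_bounded by blast
  have le1: "nsq n (\<lambda>i. v $ i) \<le> 1" if "v \<in> ?S" for v
    using that dc by (auto simp: vec_norm2_nsq)
  have bdd: "bdd_above ((\<lambda>v. vec_norm2 (a *\<^sub>v v)) ` ?S)"
  proof (rule bdd_aboveI2)
    fix v assume v: "v \<in> ?S"
    have "nsq n (app n ?a (\<lambda>i. v $ i)) \<le> K * 1"
      using K(2)[of "\<lambda>i. v $ i"] mult_left_mono[OF le1[OF v] K(1)] by linarith
    then show "vec_norm2 (a *\<^sub>v v) \<le> sqrt K"
      using v a dc by (simp add: mult_mat_vec_app)
  qed
  have ne: "0\<^sub>v n \<in> ?S" using dc by (simp add: vec_norm2_def)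
  have vn: "0 \<le> vec_norm2 v" for v by (simp add: vec_norm2_def sum_nonneg)
  show nn: "0 \<le> op_norm a"
    unfolding op_norm_def using cSUP_upper[OF ne bdd] vn order_trans by blast
  show "nsq n (app n ?a v) \<le> (op_norm a)\<^sup>2 * nsq n v"
  proof (cases "nsq n v = 0")
    case True
    then show ?thesis using K(2)[of v] by simp
  next
    case False
    then have pos: "nsq n v > 0" by (simp add: less_le)
    define r where "r = 1 / sqrt (nsq n v)"
    have r: "r\<^sup>2 * nsq n v = 1" using pos by (simp add: r_def power_divide)
    define w where "w = vec n (\<lambda>i. complex_of_real r * v i)"
    have w: "w \<in> carrier_vec n" by (simp add: w_def)
    have wv: "nsq n (\<lambda>i. w $ i) = nsq n (\<lambda>i. complex_of_real r * v i)"
      unfolding nsq_def w_def by (intro sum.cong) auto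
    have "app n ?a (\<lambda>i. w $ i) = app n ?a (\<lambda>i. complex_of_real r * v i)"
      unfolding app_def w_def by (intro ext sum.cong) auto
    then have aw: "vec_norm2 (a *\<^sub>v w) = sqrt (r\<^sup>2 * nsq n (app n ?a v))"
      using a w by (simp add: mult_mat_vec_app app_scale nsq_scale)
    have "w \<in> ?S" using w dc wv r by (simp add: vec_norm2_nsq nsq_scale)
    then have "vec_norm2 (a *\<^sub>v w) \<le> op_norm a"
      unfolding op_norm_def by (rule cSUP_upper[OF _ bdd])
    then have "r\<^sup>2 * nsq n (app n ?a v) \<le> (op_norm a)\<^sup>2"
      unfolding aw by (rule sqrt_le_D)
    then have "(r\<^sup>2 * nsq n (app n ?a v)) * nsq n v \<le> (op_norm a)\<^sup>2 * nsq n v"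
      by (rule mult_right_mono) simp
    also have "(r\<^sup>2 * nsq n (app n ?a v)) * nsq n v = (r\<^sup>2 * nsq n v) * nsq n (app n ?a v)"
      by (simp add: ac_simps)
    finally show ?thesis unfolding r by simp
  qed
  show "op_norm a \<le> c" if c: "0 \<le> c" "\<And>v. nsq n (app n ?a v) \<le> c\<^sup>2 * nsq n v"
    unfolding op_norm_def
  proof (rule cSUP_least)
    show "?S \<noteq> {}" using ne by blast
    fix v assume v: "v \<in> ?S"
    have "nsq n (app n ?a (\<lambda>i. v $ i)) \<le> c\<^sup>2 * 1"
      using c(2)[of "\<lambda>i. v $ i"] mult_left_mono[OF le1[OF v], of "c\<^sup>2"] by (simp; linarith)
    then show "vec_norm2 (a *\<^sub>v v) \<le> c"
      using v a dc c(1) by (simp add: mult_mat_vec_app real_le_lsqrt)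
  qed
qed

text \<open>The identity \<open>\<parallel>a v\<parallel>\<^sup>2 = \<langle>a\<^sup>* a v, v\<rangle>\<close> in coordinates.\<close>

lemma nsq_app_adjoint:
  "complex_of_real (nsq d (app d a v))
    = (\<Sum>i<d. app d (\<lambda>i j. \<Sum>k<d. cnj (a k i) * a k j) v i * cnj (v i))"
proof -
  let ?w = "app d a v"
  have w: "app d (\<lambda>i j. \<Sum>k<d. cnj (a k i) * a k j) v i = (\<Sum>k<d. cnj (a k i) * ?w k)" for i
  proof -
    have "app d (\<lambda>i j. \<Sum>k<d. cnj (a k i) * a k j) v i = (\<Sum>j<d. \<Sum>k<d. cnj (a k i) * (a k j * v j))"
      by (simp add: app_def sum_distrib_right mult.assoc)
    also have "\<dots> = (\<Sum>k<d. \<Sum>j<d. cnj (a k i) * (a k j * v j))" by (rule sum.swap)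
    finally show ?thesis by (simp add: app_def sum_distrib_left)
  qed
  have "(\<Sum>i<d. app d (\<lambda>i j. \<Sum>k<d. cnj (a k i) * a k j) v i * cnj (v i))
      = (\<Sum>i<d. \<Sum>k<d. cnj (a k i) * ?w k * cnj (v i))"
    unfolding w by (simp add: sum_distrib_right)
  also have "\<dots> = (\<Sum>k<d. \<Sum>i<d. cnj (a k i) * ?w k * cnj (v i))" by (rule sum.swap)
  also have "\<dots> = (\<Sum>k<d. ?w k * cnj (?w k))"
  proof (rule sum.cong[OF HOL.refl])
    fix k
    have "cnj (?w k) = (\<Sum>i<d. cnj (a k i) * cnj (v i))" by (simp add: app_def cnj_sum)
    then show "(\<Sum>i<d. cnj (a k i) * ?w k * cnj (v i)) = ?w k * cnj (?w k)"
      by (simp only: sum_distrib_left) (simp add: ac_simps)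
  qed
  finally show ?thesis by (simp add: nsq_ip)
qed

context dims
begin

lemma nsq_app:
  assumes "supported x"
  shows "complex_of_real (nsq (N m) (app (N m) (ent x m) v))
    = (\<Sum>i<N m. app (N m) (ent (fadj x * x) m) v i * cnj (v i))"
  unfolding nsq_app_adjoint ent_mult_supported[OF supported_fadj[OF assms], abs_def] by simp

lemma obound_fadj:
  assumes s: "supported x" and "obound x"
  shows "obound (fadj x)"
proof -
  obtain K where K: "K \<ge> 0" "\<And>m v. nsq (N m) (app (N m) (ent x m) v) \<le> K * nsq (N m) v"
    using assms unfolding obound_def by blast
  have "nsq (N m) (app (N m) (ent (fadj x) m) v) \<le> K * nsq (N m) v" for m v
  proof -
    let ?w = "app (N m) (ent (fadj x) m) v"
    let ?n = "nsq (N m)"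
    have "?n ?w = cmod (complex_of_real (?n ?w))" by simp
    also have "\<dots> = cmod (\<Sum>i<N m. app (N m) (ent (x * fadj x) m) v i * cnj (v i))"
      using nsq_app[OF supported_fadj[OF s], of m v] by simp
    also have "\<dots> \<le> sqrt (?n (app (N m) (ent (x * fadj x) m) v)) * sqrt (?n v)"
      by (rule cvec_Cauchy_Schwarz)
    also have "\<dots> \<le> sqrt (K * ?n ?w) * sqrt (?n v)"
      unfolding app_mult[OF s] using K(2) by (intro mult_right_mono real_sqrt_le_mono) auto
    also have "\<dots> = sqrt (?n ?w) * sqrt (K * ?n v)" by (simp add: real_sqrt_mult)
    finally have ineq: "sqrt (?n ?w) * sqrt (?n ?w) \<le> sqrt (?n ?w) * sqrt (K * ?n v)" by simp
    show ?thesis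
    proof (cases "?n ?w = 0")
      case True
      then show ?thesis using K(1) by simp
    next
      case False
      then have "0 < sqrt (?n ?w)" by (simp add: less_le)
      then have "sqrt (?n ?w) \<le> sqrt (K * ?n v)" using ineq by (rule_tac mult_left_le_imp_le)
      then show ?thesis by simp
    qed
  qed
  then show ?thesis using K(1) unfolding obound_def by blast
qed

lemma M_iff: "x \<in> M \<longleftrightarrow> supported x \<and> obound x"
  using obound_fadj by (auto simp: M_def)

text \<open>Families over different index sets are compared inside one ring, where they vanish outside their
index set.\<close>

definition iota :: "nat set \<Rightarrow> (nat \<Rightarrow> complex mat) \<Rightarrow> fam" where
  "iota I y = Fam (\<lambda>m i j. if m \<in> I \<and> i < N m \<and> j < N m then y m $$ (i, j) else 0)"

lemma ent_iota: "ent (iota I y) m i j = (if m \<in> I \<and> i < N m \<and> j < N m then y m $$ (i, j) else 0)"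
  unfolding iota_def by (subst ent_Fam[where d = N]) auto

lemma supported_iota [simp]: "supported (iota I y)"
  by (auto simp: supported_def ent_iota)

abbreviation BS :: "nat set \<Rightarrow> (nat \<Rightarrow> complex mat) normed_star_alg" where
  "BS I \<equiv> bounded_sum I (\<lambda>m. matrix_alg (N m))"

lemma BS_simps [simp]:
  "monoid.mult (BS I) x y = (\<lambda>m\<in>I. x m * y m)" "one (BS I) = (\<lambda>m\<in>I. 1\<^sub>m (N m))"
  "zero (BS I) = (\<lambda>m\<in>I. 0\<^sub>m (N m) (N m))" "add (BS I) x y = (\<lambda>m\<in>I. x m + y m)"
  "module.smult (BS I) c x = (\<lambda>m\<in>I. c \<cdot>\<^sub>m x m)" "star (BS I) x = (\<lambda>m\<in>I. mat_adjoint (x m))"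
  by (simp_all add: bounded_sum_def matrix_alg_def)

lemma bdd_op_norm_iff:
  assumes y: "\<And>m. m \<in> I \<Longrightarrow> y m \<in> carrier_mat (N m) (N m)"
  shows "bdd_above ((\<lambda>m. op_norm (y m)) ` I) \<longleftrightarrow> obound (iota I y)"
proof
  have ap: "nsq (N m) (app (N m) (ent (iota I y) m) v) = nsq (N m) (app (N m) (\<lambda>i j. y m $$ (i, j)) v)"
    if "m \<in> I" for m v
    using that unfolding nsq_def app_def
    by (intro sum.cong HOL.refl arg_cong[where f = "\<lambda>z. (cmod z)\<^sup>2"]) (auto simp: ent_iota)
  {
    assume "bdd_above ((\<lambda>m. op_norm (y m)) ` I)"
    then obtain K where K: "\<And>m. m \<in> I \<Longrightarrow> op_norm (y m) \<le> K" by (auto simp: bdd_above_def)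
    have "nsq (N m) (app (N m) (ent (iota I y) m) v) \<le> K\<^sup>2 * nsq (N m) v" for m v
    proof (cases "m \<in> I")
      case True
      have "(op_norm (y m))\<^sup>2 \<le> K\<^sup>2" using K op_norm_nonneg[OF y] True by (intro power_mono) auto
      then show ?thesis using op_norm_bound[OF y[OF True], of v] ap[OF True, of v]
        by (metis mult_right_mono nsq_nonneg order_trans)
    next
      case False
      then show ?thesis by (simp add: app_def ent_iota nsq_def[of _ "app _ _ _"])
    qed
    then show "obound (iota I y)" unfolding obound_def by (intro exI[of _ "K\<^sup>2"]) auto
  next
    assume "obound (iota I y)"
    then obtain K where K: "K \<ge> 0" "\<And>m v. nsq (N m) (app (N m) (ent (iota I y) m) v) \<le> K * nsq (N m) v"
      unfolding obound_def by blast
    show "bdd_above ((\<lambda>m. op_norm (y m)) ` I)"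
    proof (rule bdd_aboveI2)
      fix m assume m: "m \<in> I"
      show "op_norm (y m) \<le> sqrt K"
      proof (rule op_norm_least[OF y[OF m]])
        show "nsq (N m) (app (N m) (\<lambda>i j. y m $$ (i, j)) v) \<le> (sqrt K)\<^sup>2 * nsq (N m) v" for v
          using K(2)[of m v] K(1) by (simp add: ap[OF m])
      qed (use K(1) in simp)
    qed
  }
qed

lemma BS_carrier:
  "y \<in> carrier (BS I) \<longleftrightarrow> y \<in> extensional I \<and> (\<forall>m\<in>I. y m \<in> carrier_mat (N m) (N m)) \<and> iota I y \<in> M"
proof -
  have "y \<in> carrier (BS I) \<longleftrightarrow> (y \<in> extensional I \<and> (\<forall>m\<in>I. y m \<in> carrier_mat (N m) (N m)))
      \<and> bdd_above ((\<lambda>m. op_norm (y m)) ` I)"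
    by (auto simp: bounded_sum_def matrix_alg_def PiE_iff)
  moreover have "bdd_above ((\<lambda>m. op_norm (y m)) ` I) \<longleftrightarrow> obound (iota I y)"
    if "\<forall>m\<in>I. y m \<in> carrier_mat (N m) (N m)" using that by (intro bdd_op_norm_iff) blast
  moreover have "supported (iota I y)" by simp
  ultimately show ?thesis
    unfolding M_iff by (cases "\<forall>m\<in>I. y m \<in> carrier_mat (N m) (N m)") simp_all
qed

lemma BS_mat [simp]: "y \<in> carrier (BS I) \<Longrightarrow> m \<in> I \<Longrightarrow> y m \<in> carrier_mat (N m) (N m)"
  and iota_M [simp]: "y \<in> carrier (BS I) \<Longrightarrow> iota I y \<in> M"
  by (drule iffD1[OF BS_carrier], blast)+

lemma BS_dims [simp]: "y \<in> carrier (BS I) \<Longrightarrow> m \<in> I \<Longrightarrow> dim_row (y m) = N m"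
  "y \<in> carrier (BS I) \<Longrightarrow> m \<in> I \<Longrightarrow> dim_col (y m) = N m"
  by (rule carrier_matD[OF BS_mat]; assumption)+

lemma iota_inj: "inj_on (iota I) (carrier (BS I))"
proof (rule inj_onI)
  fix x y assume xy: "x \<in> carrier (BS I)" "y \<in> carrier (BS I)" and eq: "iota I x = iota I y"
  show "x = y"
  proof (rule extensionalityI[of _ I])
    show "x \<in> extensional I" "y \<in> extensional I" using xy iffD1[OF BS_carrier] by blast+
    fix m assume m: "m \<in> I"
    show "x m = y m"
    proof (rule eq_matI)
      fix i j assume "i < dim_row (y m)" "j < dim_col (y m)"
      then show "x m $$ (i, j) = y m $$ (i, j)"
        using arg_cong[OF eq, of "\<lambda>z. ent z m i j"] m xy by (simp add: ent_iota)
    qed (use xy m in auto)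
  qed
qed

lemma iota_zero: "iota I (\<lambda>m\<in>I. 0\<^sub>m (N m) (N m)) = 0"
  by (rule fam_eqI) (simp add: ent_iota)

lemma iota_add:
  assumes "\<And>m. m \<in> I \<Longrightarrow> x m \<in> carrier_mat (N m) (N m)" "\<And>m. m \<in> I \<Longrightarrow> y m \<in> carrier_mat (N m) (N m)"
  shows "iota I (\<lambda>m\<in>I. x m + y m) = iota I x + iota I y"
  by (rule fam_eqI) (use carrier_matD[OF assms(2)] in \<open>auto simp: ent_iota\<close>)

lemma iota_smult:
  assumes "\<And>m. m \<in> I \<Longrightarrow> x m \<in> carrier_mat (N m) (N m)"
  shows "iota I (\<lambda>m\<in>I. c \<cdot>\<^sub>m x m) = fscl c (iota I x)"
  by (rule fam_eqI) (use carrier_matD[OF assms] in \<open>auto simp: ent_iota\<close>)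

lemma iota_star:
  assumes "\<And>m. m \<in> I \<Longrightarrow> x m \<in> carrier_mat (N m) (N m)"
  shows "iota I (\<lambda>m\<in>I. mat_adjoint (x m)) = fadj (iota I x)"
  by (rule fam_eqI) (use mat_adjoint_index[OF assms] in \<open>auto simp: ent_iota\<close>)

lemma iota_mult:
  assumes "\<And>m. m \<in> I \<Longrightarrow> x m \<in> carrier_mat (N m) (N m)" "\<And>m. m \<in> I \<Longrightarrow> y m \<in> carrier_mat (N m) (N m)"
  shows "iota I (\<lambda>m\<in>I. x m * y m) = iota I x * iota I y"
proof (rule fam_eqI)
  fix m i j
  show "ent (iota I (\<lambda>m\<in>I. x m * y m)) m i j = ent (iota I x * iota I y) m i j"
  proof (cases "m \<in> I \<and> i < N m \<and> j < N m")
    case True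
    have "(x m * y m) $$ (i, j) = (\<Sum>k<N m. x m $$ (i, k) * y m $$ (k, j))"
      using True assms[of m] by (auto simp: scalar_prod_def lessThan_atLeast0)
    then show ?thesis using True by (simp add: ent_iota ent_mult_supported)
  next
    case False
    then show ?thesis by (auto simp: ent_iota ent_mult_supported)
  qed
qed

lemma iota_one_left: "iota I (\<lambda>m\<in>I. 1\<^sub>m (N m)) * iota I x = iota I x"
  by (rule fam_eqI) (auto simp: ent_iota ent_mult_supported if_distrib[of "\<lambda>z. z * _"] cong: if_cong)

lemma iota_one_right: "iota I x * iota I (\<lambda>m\<in>I. 1\<^sub>m (N m)) = iota I x"
  by (rule fam_eqI) (auto simp: ent_iota ent_mult_supported if_distrib[of "\<lambda>z. _ * z"] cong: if_cong)

lemma iota_one_M: "iota I (\<lambda>m\<in>I. 1\<^sub>m (N m)) \<in> M"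
proof -
  have "app (N m) (ent (iota I (\<lambda>m\<in>I. 1\<^sub>m (N m))) m) v i = (if m \<in> I then v i else 0)" if "i < N m" for m v i
    using that by (auto simp: app_def ent_iota if_distrib[of "\<lambda>z. z * _"] cong: if_cong)
  then have "nsq (N m) (app (N m) (ent (iota I (\<lambda>m\<in>I. 1\<^sub>m (N m))) m) v) \<le> 1 * nsq (N m) v" for m v
    unfolding nsq_def mult_1 by (intro sum_mono) auto
  then show ?thesis unfolding M_iff obound_def by (intro conjI exI[of _ 1]) auto
qed

lemma star_algebra_BS: "star_algebra (BS I)"
proof (rule star_algebra_embedding[where \<iota> = "iota I"])
  have ex: "(\<lambda>m\<in>I. g m) \<in> carrier (BS I)"
    if "\<And>m. m \<in> I \<Longrightarrow> g m \<in> carrier_mat (N m) (N m)" "iota I (\<lambda>m\<in>I. g m) \<in> M" for g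
    using that by (intro iffD2[OF BS_carrier] conjI ballI restrict_extensional) simp_all
  show "\<zero>\<^bsub>BS I\<^esub> \<in> carrier (BS I)" unfolding BS_simps by (rule ex) (simp_all add: iota_zero)
  show "\<one>\<^bsub>BS I\<^esub> \<in> carrier (BS I)" unfolding BS_simps by (rule ex) (simp_all add: iota_one_M)
  show "a \<oplus>\<^bsub>BS I\<^esub> b \<in> carrier (BS I)" if "a \<in> carrier (BS I)" "b \<in> carrier (BS I)" for a b
    unfolding BS_simps using that by (intro ex) (simp_all add: iota_add)
  show "a \<otimes>\<^bsub>BS I\<^esub> b \<in> carrier (BS I)" if ab: "a \<in> carrier (BS I)" "b \<in> carrier (BS I)" for a b
  proof -
    have "a m * b m \<in> carrier_mat (N m) (N m)" if "m \<in> I" for m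
      using mult_carrier_mat[OF BS_mat[OF ab(1) that] BS_mat[OF ab(2) that]] .
    then show ?thesis unfolding BS_simps using ab by (intro ex) (simp_all add: iota_mult)
  qed
  show "z \<odot>\<^bsub>BS I\<^esub> a \<in> carrier (BS I)" if "a \<in> carrier (BS I)" for z a
    unfolding BS_simps using that by (intro ex) (simp_all add: iota_smult)
  show "star (BS I) a \<in> carrier (BS I)" if "a \<in> carrier (BS I)" for a
    unfolding BS_simps using that by (intro ex) (simp_all add: iota_star mat_adjoint_carrier)
qed (simp_all add: iota_inj iota_zero iota_add iota_mult iota_smult iota_star iota_one_left iota_one_right)

end

section \<open>Noncommutative polynomials in the unitaries\<close>

context dims
begin

lemma iota_restrict: "iota I (\<lambda>m\<in>I. g m) = iota I g"
  by (rule fam_eqI) (simp add: ent_iota)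

definition unit :: fam where "unit = iota UNIV (\<lambda>m. 1\<^sub>m (N m))"

lemma unit_M [simp]: "unit \<in> M"
  using iota_one_M[of UNIV] by (simp add: unit_def iota_restrict)

lemma ent_unit: "ent unit m i j = (if i < N m \<and> i = j then 1 else 0)"
  by (auto simp: unit_def ent_iota)

lemma unit_left [simp]: "supported x \<Longrightarrow> unit * x = x"
proof (rule fam_eqI)
  fix m i j assume x: "supported x"
  have "ent (unit * x) m i j = (\<Sum>k<N m. if i = k then (if i < N m then ent x m k j else 0) else 0)"
    unfolding ent_mult_supported[OF M_supported[OF unit_M]]
    by (intro sum.cong HOL.refl) (simp add: ent_unit)
  then show "ent (unit * x) m i j = ent x m i j" using supported_0[OF x, of i m j] by auto
qed

lemma fadj_unit [simp]: "fadj unit = unit"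
  by (rule fam_eqI) (auto simp: ent_unit)

lemma unit_right [simp]: "supported x \<Longrightarrow> x * unit = x"
  using unit_left[OF supported_fadj, of x] fadj_mult[of x unit] by (metis fadj_fadj fadj_unit)

lemma mtr_iota_UNIV: "y m \<in> carrier_mat (N m) (N m) \<Longrightarrow> mtr m (iota UNIV y) = normalized_trace (N m) (y m)"
  by (simp add: mtr_def normalized_trace_def ent_iota)

lemma unitary_matD:
  assumes "unitary (matrix_alg k) a"
  shows "a \<in> carrier_mat k k" "mat_adjoint a * a = 1\<^sub>m k" "a * mat_adjoint a = 1\<^sub>m k"
  using assms by (auto simp: unitary_def matrix_alg_def)

lemma iota_unitary:
  assumes u: "\<And>m. m \<in> I \<Longrightarrow> unitary (matrix_alg (N m)) (y m)"
  shows "fadj (iota I y) * iota I y = iota I (\<lambda>m\<in>I. 1\<^sub>m (N m))" "iota I y \<in> M"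
proof -
  have c: "\<And>m. m \<in> I \<Longrightarrow> y m \<in> carrier_mat (N m) (N m)" using u unitary_matD by blast
  have "fadj (iota I y) * iota I y = iota I (\<lambda>m\<in>I. mat_adjoint (y m) * y m)"
    using c iota_star[of I y] iota_mult[of I "\<lambda>m. mat_adjoint (y m)" y] by (simp add: iota_restrict mat_adjoint_carrier)
  also have "(\<lambda>m\<in>I. mat_adjoint (y m) * y m) = (\<lambda>m\<in>I. 1\<^sub>m (N m))"
    using unitary_matD(2)[OF u] by (auto simp: restrict_def)
  finally show eq: "fadj (iota I y) * iota I y = iota I (\<lambda>m\<in>I. 1\<^sub>m (N m))" .
  have "nsq (N m) (app (N m) (ent (iota I y) m) v) \<le> 1 * nsq (N m) v" for m v
  proof (cases "m \<in> I")
    case True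
    have "app (N m) (ent (iota I (\<lambda>m\<in>I. 1\<^sub>m (N m))) m) v i = v i" if "i < N m" for i
      using that True by (auto simp: app_def ent_iota if_distrib[of "\<lambda>z. z * _"] cong: if_cong)
    then have "complex_of_real (nsq (N m) (app (N m) (ent (iota I y) m) v)) = complex_of_real (nsq (N m) v)"
      unfolding nsq_app[OF supported_iota] eq nsq_ip[of _ v] by (intro sum.cong HOL.refl) auto
    then show ?thesis by simp
  next
    case False
    then show ?thesis by (simp add: app_def ent_iota nsq_def[of _ "app _ _ _"])
  qed
  then show "iota I y \<in> M" unfolding M_iff obound_def by (intro conjI exI[of _ 1]) auto
qed

end

locale unitary_tuples = dims +
  fixes n :: nat and u :: "nat \<Rightarrow> nat \<Rightarrow> complex mat"
  assumes N_pos: "\<And>m. N m \<ge> 1"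
    and u_unitary: "\<And>i m. i \<in> {1..n} \<Longrightarrow> unitary (matrix_alg (N m)) (u i m)"
    and u_conv: "converges_in_distribution n N u"
begin

definition gen :: "nat \<Rightarrow> fam" where "gen i = iota UNIV (u i)"

lemma gen_M [simp]: "i \<in> {1..n} \<Longrightarrow> gen i \<in> M"
  unfolding gen_def using u_unitary by (intro iota_unitary(2)) auto

primrec wd :: "(nat \<times> bool) list \<Rightarrow> fam" where
  "wd [] = unit"
| "wd (l # w) = (if snd l then fadj (gen (fst l)) else gen (fst l)) * wd w"

lemma words_Cons: "(i, b) # w \<in> words n \<longleftrightarrow> i \<in> {1..n} \<and> w \<in> words n"
  by (auto simp: words_def)

lemma wd_M [simp]: "w \<in> words n \<Longrightarrow> wd w \<in> M"
proof (induction w)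
  case (Cons l w)
  then show ?case by (cases l) (auto simp: words_Cons simp del: atLeastAtMost_iff)
qed simp

lemma wd_append: "w \<in> words n \<Longrightarrow> v \<in> words n \<Longrightarrow> wd (w @ v) = wd w * wd v"
proof (induction w)
  case Nil
  then show ?case by (simp add: M_supported)
next
  case (Cons l w)
  then show ?case by (cases l) (auto simp: words_Cons mult.assoc)
qed

lemma wd_single: "i \<in> {1..n} \<Longrightarrow> wd [(i, b)] = (if b then fadj (gen i) else gen i)"
  by (simp add: M_supported supported_fadj del: atLeastAtMost_iff)

lemma wd_fadj: "w \<in> words n \<Longrightarrow> \<exists>v\<in>words n. fadj (wd w) = wd v"
proof (induction w)
  case Nil
  then show ?case by (auto intro!: bexI[of _ "[]"])
next
  case (Cons l w)
  obtain i b where l: "l = (i, b)" by (cases l)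
  have i: "i \<in> {1..n}" and w: "w \<in> words n" using Cons.prems by (auto simp: l words_Cons)
  obtain v where v: "v \<in> words n" "fadj (wd w) = wd v" using Cons.IH w by blast
  have s: "[(i, \<not> b)] \<in> words n" using i by (simp add: words_def)
  have "fadj (wd (l # w)) = wd v * wd [(i, \<not> b)]"
    unfolding wd_single[OF i] by (simp add: l fadj_mult v)
  also have "\<dots> = wd (v @ [(i, \<not> b)])" using v s by (simp add: wd_append)
  finally show ?case using v s by (auto intro!: bexI[of _ "v @ [(i, \<not> b)]"] simp: words_def)
qed

lemma wd_eval:
  assumes "w \<in> words n"
  shows "wd w = iota UNIV (\<lambda>m. eval_word (matrix_alg (N m)) (\<lambda>i. u i m) w) \<and>
    (\<forall>m. eval_word (matrix_alg (N m)) (\<lambda>i. u i m) w \<in> carrier_mat (N m) (N m))"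
  using assms
proof (induction w)
  case Nil
  then show ?case by (simp add: unit_def eval_word_def matrix_alg_def)
next
  case (Cons l w)
  obtain i b where l: "l = (i, b)" by (cases l)
  have i: "i \<in> {1..n}" and w: "w \<in> words n" using Cons.prems by (auto simp: l words_Cons)
  let ?e = "\<lambda>m. eval_word (matrix_alg (N m)) (\<lambda>i. u i m) w"
  let ?g = "\<lambda>m. if b then mat_adjoint (u i m) else u i m"
  have uc: "u i m \<in> carrier_mat (N m) (N m)" for m using unitary_matD(1)[OF u_unitary[OF i]] .
  have e: "wd w = iota UNIV ?e" "\<And>m. ?e m \<in> carrier_mat (N m) (N m)" using Cons.IH w by auto
  have g: "?g m \<in> carrier_mat (N m) (N m)" for m using uc by (simp add: mat_adjoint_carrier)
  have ig: "iota UNIV ?g = (if b then fadj (gen i) else gen i)"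
    using iota_star[of UNIV "u i"] uc by (simp add: gen_def iota_restrict)
  have ev: "eval_word (matrix_alg (N m)) (\<lambda>i. u i m) (l # w) = ?g m * ?e m" for m
    by (simp add: eval_word_def matrix_alg_def l)
  have "iota UNIV (\<lambda>m. ?g m * ?e m) = iota UNIV ?g * iota UNIV ?e"
    using iota_mult[of UNIV ?g ?e] g e(2) by (simp add: iota_restrict)
  then have "wd (l # w) = iota UNIV (\<lambda>m. ?g m * ?e m)"
    using ig e(1) by (simp add: l)
  moreover have "?g m * ?e m \<in> carrier_mat (N m) (N m)" for m
    by (rule mult_carrier_mat[OF g e(2)])
  ultimately show ?case unfolding ev by blast
qed

lemma wd_convergent: "w \<in> words n \<Longrightarrow> convergent (\<lambda>m. mtr m (wd w))"
  using u_conv wd_eval[of w] mtr_iota_UNIV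
  unfolding converges_in_distribution_def distribution_def by simp

text \<open>The linear span of the words in the generators and their adjoints, that is, the noncommutative
polynomials, realized as families over all indices.\<close>

inductive_set W :: "fam set" where
  W_0: "0 \<in> W"
| W_step: "x \<in> W \<Longrightarrow> w \<in> words n \<Longrightarrow> fscl c (wd w) + x \<in> W"

lemma W_M: "x \<in> W \<Longrightarrow> x \<in> M"
  by (induction rule: W.induct) auto

lemma W_single: "w \<in> words n \<Longrightarrow> fscl c (wd w) \<in> W"
  using W_step[OF W_0, of w c] by simp

lemma wd_W: "w \<in> words n \<Longrightarrow> wd w \<in> W"
  using W_single[of w 1] by (simp add: scl_one)

lemma W_plus: "x \<in> W \<Longrightarrow> y \<in> W \<Longrightarrow> x + y \<in> W"
  by (induction rule: W.induct) (auto simp: add.assoc intro: W_step)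

lemma W_fscl: "x \<in> W \<Longrightarrow> fscl c x \<in> W"
  by (induction rule: W.induct) (auto simp: scl_add_right scl_scl intro: W_0 W_step)

lemma W_wd_mult: "x \<in> W \<Longrightarrow> w \<in> words n \<Longrightarrow> wd w * x \<in> W"
proof (induction rule: W.induct)
  case (W_step x v c)
  have "wd w * (fscl c (wd v) + x) = fscl c (wd (w @ v)) + wd w * x"
    using W_step by (simp add: distrib_left scl_mult_right wd_append)
  then show ?case using W_step by (auto intro!: W.W_step simp: words_def)
qed (simp add: W_0)

lemma W_times: "x \<in> W \<Longrightarrow> y \<in> W \<Longrightarrow> x * y \<in> W"
proof (induction rule: W.induct)
  case (W_step x w c)
  have "(fscl c (wd w) + x) * y = fscl c (wd w * y) + x * y"
    by (simp add: distrib_right scl_mult_left)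
  then show ?case using W_step by (simp add: W_plus W_fscl W_wd_mult)
qed (simp add: W_0)

lemma W_fadj: "x \<in> W \<Longrightarrow> fadj x \<in> W"
proof (induction rule: W.induct)
  case (W_step x w c)
  obtain v where "v \<in> words n" "fadj (wd w) = wd v" using wd_fadj W_step by blast
  then show ?case using W_step by (simp add: fadj_add fadj_fscl W.W_step)
qed (simp add: W_0)

lemma W_convergent: "x \<in> W \<Longrightarrow> convergent (\<lambda>m. mtr m x)"
proof (induction rule: W.induct)
  case W_0
  have "mtr m 0 = 0" for m by (simp add: mtr_def)
  then show ?case by (simp add: convergent_const)
next
  case (W_step x w c)
  then show ?case
    by (auto simp: mtr_add mtr_fscl intro!: convergent_add convergent_mult convergent_const wd_convergent)
qed

lemma gen_W: "i \<in> {1..n} \<Longrightarrow> gen i \<in> W"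
  using wd_W[of "[(i, False)]"] wd_single[of i False] by (simp add: words_def)

lemma gen_unitary: "i \<in> {1..n} \<Longrightarrow> fadj (gen i) * gen i = unit"
  using iota_unitary(1)[of UNIV "u i"] u_unitary by (simp add: gen_def unit_def iota_restrict)

text \<open>On \<open>W\<close> the normalized traces converge by the convergence in distribution, so every ultrafilter finer
than the filter of cofinite sets yields the same limit.\<close>

lemma tracial_pair_utr:
  assumes U: "ultra U" "U \<le> sequentially" and U': "ultra U'" "U' \<le> sequentially"
  shows "tracial_pair fscl fadj M (utr U) (utr U') W unit"
proof -
  interpret T1: tracial fscl fadj M "utr U" by (rule tracial_utr[OF U(1)])
  interpret T2: tracial fscl fadj M "utr U'" by (rule tracial_utr[OF U'(1)])
  show ?thesis
  proof
    fix x assume x: "x \<in> W"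
    obtain l where l: "(\<lambda>m. mtr m x) \<longlonglongrightarrow> l" using W_convergent[OF x] by (auto simp: convergent_def)
    have "utr U x = l" "utr U' x = l"
      using x tendsto_mono[OF U(2) l] tendsto_mono[OF U'(2) l] U U' by (auto intro!: utr_eqI W_M)
    then show "utr U x = utr U' x" by simp
  next
    show "unit \<in> W" using wd_W[of "[]"] by (simp add: words_def)
  qed (auto simp: W_plus W_fscl W_times W_fadj W_M M_supported)
qed

lemma utr_unit: "ultra U \<Longrightarrow> utr U unit = 1"
proof (rule utr_eqI)
  have "N m \<noteq> 0" for m using N_pos[of m] by simp
  then have "mtr m unit = 1" for m by (simp add: mtr_def ent_unit)
  then show "((\<lambda>m. mtr m unit) \<longlongrightarrow> 1) U" by simp
qed auto

lemma utr_null: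
  assumes U: "ultra U" and I: "eventually (\<lambda>m. m \<in> I) U" and x: "x \<in> M"
    and z: "\<And>m i j. m \<in> I \<Longrightarrow> ent x m i j = 0"
  shows "utr U (fadj x * x) = 0"
proof (rule utr_eqI[OF U])
  have "eventually (\<lambda>m. mtr m (fadj x * x) = 0) U"
    using I by (rule eventually_mono) (simp add: mtr_sq M_supported[OF x] nsq_def z)
  then show "((\<lambda>m. mtr m (fadj x * x)) \<longlongrightarrow> 0) U" by (rule tendsto_eventually)
qed (use x in auto)

end

section \<open>The spatial norm\<close>

text \<open>The enumeration \<open>(i, j) \<mapsto> i b + j\<close> of pairs that underlies the Kronecker product.\<close>

lemma sum_div_mod:
  fixes g :: "nat \<Rightarrow> nat \<Rightarrow> 'c::comm_monoid_add"
  shows "(\<Sum>p<a * b. g (p div b) (p mod b)) = (\<Sum>i<a. \<Sum>j<b. g i j)"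
proof (cases "b = 0")
  case False
  have "(\<Sum>p<a * b. g (p div b) (p mod b)) = (\<Sum>i<a. \<Sum>p\<in>{i * b..<i * b + b}. g (p div b) (p mod b))"
    by (rule sum.nat_group[symmetric])
  also have "\<dots> = (\<Sum>i<a. \<Sum>j<b. g i j)"
  proof (rule sum.cong[OF HOL.refl])
    fix i
    have "(\<Sum>p\<in>{i * b..<i * b + b}. g (p div b) (p mod b)) = (\<Sum>j\<in>{0..<b}. g ((j + i * b) div b) ((j + i * b) mod b))"
      using sum.shift_bounds_nat_ivl[of "\<lambda>p. g (p div b) (p mod b)" 0 "i * b" b] by (simp add: add.commute)
    also have "\<dots> = (\<Sum>j<b. g i j)"
      using False by (intro sum.cong) auto
    finally show "(\<Sum>p\<in>{i * b..<i * b + b}. g (p div b) (p mod b)) = (\<Sum>j<b. g i j)" .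
  qed
  finally show ?thesis .
qed simp

locale two_sums = dims + fixes \<alpha> \<beta> :: "nat set"
begin

abbreviation "AA \<equiv> BS \<alpha>"
abbreviation "BB \<equiv> conj_alg (BS \<beta>)"

sublocale tensor AA BB
  by (intro tensor.intro star_algebra_BS star_algebra_conj_alg)

definition ea :: "(nat \<Rightarrow> complex mat) \<Rightarrow> nat \<Rightarrow> nat \<Rightarrow> nat \<Rightarrow> complex" where
  "ea a m i j = ent (iota \<alpha> a) m i j"

text \<open>The conjugate makes the entries linear for the conjugate algebra.\<close>

definition eb :: "(nat \<Rightarrow> complex mat) \<Rightarrow> nat \<Rightarrow> nat \<Rightarrow> nat \<Rightarrow> complex" where
  "eb b m i j = cnj (ent (iota \<beta> b) m i j)"

lemma iota_ops:
  assumes "a \<in> carrier (BS I)"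
  shows "b \<in> carrier (BS I) \<Longrightarrow> iota I (a \<oplus>\<^bsub>BS I\<^esub> b) = iota I a + iota I b"
    "b \<in> carrier (BS I) \<Longrightarrow> iota I (a \<otimes>\<^bsub>BS I\<^esub> b) = iota I a * iota I b"
    "iota I (z \<odot>\<^bsub>BS I\<^esub> a) = fscl z (iota I a)"
    "iota I (star (BS I) a) = fadj (iota I a)"
    "iota I \<zero>\<^bsub>BS I\<^esub> = 0"
  using assms by (simp_all add: iota_add iota_mult iota_smult iota_star iota_zero del: restrict_apply)

lemma ea_ops:
  assumes "a \<in> carrier AA"
  shows "a' \<in> carrier AA \<Longrightarrow> ea (a \<oplus>\<^bsub>AA\<^esub> a') m i j = ea a m i j + ea a' m i j"
    "a' \<in> carrier AA \<Longrightarrow> ea (a \<otimes>\<^bsub>AA\<^esub> a') m i j = (\<Sum>k<N m. ea a m i k * ea a' m k j)"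
    "ea (z \<odot>\<^bsub>AA\<^esub> a) m i j = z * ea a m i j"
    "ea (star AA a) m i j = cnj (ea a m j i)"
  using assms by (simp_all add: ea_def iota_ops ent_mult_supported del: BS_simps)

lemma ea_zero [simp]: "ea \<zero>\<^bsub>AA\<^esub> m i j = 0"
  by (simp add: ea_def iota_zero)

lemma eb_ops:
  assumes "b \<in> carrier BB"
  shows "b' \<in> carrier BB \<Longrightarrow> eb (b \<oplus>\<^bsub>BB\<^esub> b') m i j = eb b m i j + eb b' m i j"
    "b' \<in> carrier BB \<Longrightarrow> eb (b \<otimes>\<^bsub>BB\<^esub> b') m i j = (\<Sum>k<N m. eb b m i k * eb b' m k j)"
    "eb (z \<odot>\<^bsub>BB\<^esub> b) m i j = z * eb b m i j"
    "eb (star BB b) m i j = cnj (eb b m j i)"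
  using assms by (simp_all add: eb_def iota_ops ent_mult_supported del: BS_simps)

text \<open>The image of a formal sum in \<open>M\<^bsub>N m\<^esub> \<otimes> M\<^bsub>N m'\<^esub>\<close>, as a Kronecker matrix of size
\<open>N m * N m'\<close>.\<close>

definition kmat :: "nat \<times> nat \<Rightarrow> ((nat \<Rightarrow> complex mat) \<times> (nat \<Rightarrow> complex mat)) multiset \<Rightarrow> nat \<Rightarrow> nat \<Rightarrow> complex" where
  "kmat mm s p q = (case mm of (m, m') \<Rightarrow> \<Sum>(a, b)\<in>#s.
     ea a m (p div N m') (q div N m') * eb b m' (p mod N m') (q mod N m'))"

definition kdim :: "nat \<times> nat \<Rightarrow> nat" where "kdim mm = N (fst mm) * N (snd mm)"

lemma kmat_eqv: "eqv s r \<Longrightarrow> kmat mm s = kmat mm r"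
  unfolding kmat_def fun_eq_iff
  by (cases mm) (auto intro!: balanced_sum_eqv simp: ea_ops eb_ops ea_zero algebra_simps simp del: BS_simps conj_alg_simps)

lemma kmat_add: "kmat mm (s + r) p q = kmat mm s p q + kmat mm r p q"
  by (cases mm) (simp add: kmat_def)

lemma kmat_fsmul: "s \<in> fs \<Longrightarrow> kmat mm (fsmul AA c s) p q = c * kmat mm s p q"
  by (induction rule: fs_induct)
    (simp_all only: fsmul_simps kmat_add, simp_all add: kmat_def ea_ops distrib_left split: prod.split del: BS_simps)

lemma kmat_fstar: "s \<in> fs \<Longrightarrow> kmat mm (fstar AA BB s) p q = cnj (kmat mm s q p)"
  by (induction rule: fs_induct)
    (simp_all only: fstar_simps kmat_add, simp_all add: kmat_def ea_ops eb_ops split: prod.split del: BS_simps conj_alg_simps)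

lemma kmat_fmul:
  assumes "s \<in> fs" "r \<in> fs"
  shows "kmat mm (fmul AA BB s r) p q = (\<Sum>k<kdim mm. kmat mm s p k * kmat mm r k q)"
  using assms(1)
proof (induction rule: fs_induct)
  case empty
  then show ?case by (simp add: kmat_def split: prod.split)
next
  case (add a b s)
  note ab = add.hyps(1,2)
  have "kmat mm (fmul AA BB {#(a, b)#} r) p q = (\<Sum>k<kdim mm. kmat mm {#(a, b)#} p k * kmat mm r k q)"
    using assms(2)
  proof (induction rule: fs_induct)
    case empty
    then show ?case by (simp add: kmat_def split: prod.split)
  next
    case (add a' b' r)
    obtain m m' where mm: "mm = (m, m')" by (cases mm)
    let ?d = "N m'"
    have "kmat mm (fmul AA BB {#(a, b)#} {#(a', b')#}) p q
      = (\<Sum>i<N m. \<Sum>i'<N m'. (ea a m (p div ?d) i * eb b m' (p mod ?d) i') * (ea a' m i (q div ?d) * eb b' m' i' (q mod ?d)))"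
      using ab add.hyps
      by (simp add: kmat_def mm fmul_single_left ea_ops eb_ops sum_product del: BS_simps conj_alg_simps)
        (simp add: ac_simps)
    also have "\<dots> = (\<Sum>k<kdim mm. kmat mm {#(a, b)#} p k * kmat mm {#(a', b')#} k q)"
      unfolding kdim_def mm fst_conv snd_conv kmat_def
      by (subst sum_div_mod[symmetric]) simp
    finally show ?case using add.IH by (simp only: fmul_add_right kmat_add distrib_left sum.distrib)
  qed
  then show ?case using add.IH by (simp only: fmul_add_left kmat_add distrib_right sum.distrib)
qed

text \<open>All vectors of all the spaces on which the matrices \<open>kmat\<close> act, tagged with the pair of indices.\<close>

definition spV :: "((nat \<times> nat) \<times> (nat \<Rightarrow> complex)) set" where "spV = (\<alpha> \<times> \<beta>) \<times> UNIV"

definition spn :: "(nat \<times> nat) \<times> (nat \<Rightarrow> complex) \<Rightarrow> real" where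
  "spn v = sqrt (nsq (kdim (fst v)) (snd v))"

definition sprep where
  "sprep s v = (fst v, app (kdim (fst v)) (kmat (fst v) s) (snd v))"

text \<open>The tensor of two operators is bounded uniformly in the indices: the second one is applied for each
first coordinate, and then the first one for each second coordinate.\<close>

lemma kmat_single_bound:
  assumes a: "a \<in> carrier AA" and b: "b \<in> carrier BB"
  shows "\<exists>K\<ge>0. \<forall>mm v. nsq (kdim mm) (app (kdim mm) (kmat mm {#(a, b)#}) v) \<le> K * nsq (kdim mm) v"
proof -
  obtain K where K: "K \<ge> 0" "\<And>m v. nsq (N m) (app (N m) (ent (iota \<alpha> a) m) v) \<le> K * nsq (N m) v"
    using M_obound[OF iota_M[OF a]] unfolding obound_def by blast
  have b': "b \<in> carrier (BS \<beta>)" using b by simp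
  obtain L where L: "L \<ge> 0" "\<And>m v. nsq (N m) (app (N m) (ent (iota \<beta> b) m) v) \<le> L * nsq (N m) v"
    using M_obound[OF iota_M[OF b']] unfolding obound_def by blast
  have Ka: "nsq (N m) (app (N m) (ea a m) v) \<le> K * nsq (N m) v" for m v
    using K(2)[of m v] by (simp add: ea_def[abs_def])
  have Lb: "nsq (N m) (app (N m) (eb b m) v) \<le> L * nsq (N m) v" for m v
  proof -
    have "app (N m) (eb b m) v i = cnj (app (N m) (ent (iota \<beta> b) m) (\<lambda>j. cnj (v j)) i)" for i
      by (simp add: app_def eb_def cnj_sum)
    then have "nsq (N m) (app (N m) (eb b m) v) = nsq (N m) (app (N m) (ent (iota \<beta> b) m) (\<lambda>j. cnj (v j)))"
      by (simp add: nsq_def)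
    also have "\<dots> \<le> L * nsq (N m) (\<lambda>j. cnj (v j))" by (rule L(2))
    finally show ?thesis by (simp add: nsq_def)
  qed
  have "nsq (kdim mm) (app (kdim mm) (kmat mm {#(a, b)#}) v) \<le> (K * L) * nsq (kdim mm) v" for mm v
  proof -
    obtain m m' where mm: "mm = (m, m')" by (cases mm)
    let ?d = "N m'"
    let ?v = "\<lambda>j j'. v (j * ?d + j')"
    have vsq: "nsq (kdim mm) v = (\<Sum>j<N m. nsq ?d (?v j))"
    proof -
      show ?thesis using sum_div_mod[of "\<lambda>j j'. (cmod (?v j j'))\<^sup>2" ?d "N m"]
        by (simp add: nsq_def kdim_def mm)
    qed
    define w where "w = (\<lambda>j i'. app ?d (eb b m') (?v j) i')"
    have ap: "app (kdim mm) (kmat mm {#(a, b)#}) v p = app (N m) (ea a m) (\<lambda>j. w j (p mod ?d)) (p div ?d)" for p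
    proof -
      show ?thesis
        using sum_div_mod[of "\<lambda>j j'. ea a m (p div ?d) j * eb b m' (p mod ?d) j' * ?v j j'" ?d "N m"]
        by (simp add: app_def kmat_def mm kdim_def w_def sum_distrib_left mult.assoc)
    qed
    have "nsq (kdim mm) (app (kdim mm) (kmat mm {#(a, b)#}) v)
      = (\<Sum>p<N m * ?d. (\<lambda>i i'. (cmod (app (N m) (ea a m) (\<lambda>j. w j i') i))\<^sup>2) (p div ?d) (p mod ?d))"
      unfolding nsq_def[of _ "app (kdim mm) _ _"] ap by (simp add: kdim_def mm)
    also have "\<dots> = (\<Sum>i<N m. \<Sum>i'<?d. (cmod (app (N m) (ea a m) (\<lambda>j. w j i') i))\<^sup>2)"
      by (rule sum_div_mod)
    also have "\<dots> = (\<Sum>i'<?d. nsq (N m) (app (N m) (ea a m) (\<lambda>j. w j i')))"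
      unfolding nsq_def by (rule sum.swap)
    also have "\<dots> \<le> (\<Sum>i'<?d. K * nsq (N m) (\<lambda>j. w j i'))" by (intro sum_mono Ka)
    also have "\<dots> = K * (\<Sum>i'<?d. \<Sum>j<N m. (cmod (w j i'))\<^sup>2)" by (simp add: nsq_def sum_distrib_left)
    also have "(\<Sum>i'<?d. \<Sum>j<N m. (cmod (w j i'))\<^sup>2) = (\<Sum>j<N m. nsq ?d (w j))"
      unfolding nsq_def by (rule sum.swap)
    also have "K * \<dots> \<le> K * (\<Sum>j<N m. L * nsq ?d (?v j))"
      unfolding w_def using K(1) by (intro mult_left_mono sum_mono Lb)
    also have "\<dots> = (K * L) * nsq (kdim mm) v" by (simp add: vsq sum_distrib_left mult.assoc)
    finally show ?thesis .
  qed
  then show ?thesis using K(1) L(1) by (intro exI[of _ "K * L"]) auto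
qed

lemma spn_add: "spn (mm, \<lambda>i. v i + w i) \<le> spn (mm, v) + spn (mm, w)"
  using cvec.nrm_comb[of v w "kdim mm" 1] by (simp add: cvec_nrm spn_def)

lemma sprep_add: "spn (sprep (s + r) v) \<le> spn (sprep s v) + spn (sprep r v)"
proof -
  have "app d (kmat mm (s + r)) w = (\<lambda>i. app d (kmat mm s) w i + app d (kmat mm r) w i)" for d mm w
    by (simp add: app_def fun_eq_iff kmat_add distrib_right sum.distrib)
  then show ?thesis unfolding sprep_def by (simp add: spn_add)
qed

lemma sprep_bounded: "s \<in> fs \<Longrightarrow> \<exists>K\<ge>0. \<forall>v\<in>spV. spn (sprep s v) \<le> K * spn v"
proof (induction rule: fs_induct)
  case empty
  have "spn (sprep {#} v) = 0" for v by (simp add: sprep_def spn_def kmat_def app_def nsq_def split: prod.split)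
  then show ?case by (intro exI[of _ 0]) auto
next
  case (add a b s)
  obtain K where K: "K \<ge> 0" "\<And>v. v \<in> spV \<Longrightarrow> spn (sprep s v) \<le> K * spn v" using add.IH by blast
  obtain L where L: "L \<ge> 0" "\<And>mm v. nsq (kdim mm) (app (kdim mm) (kmat mm {#(a, b)#}) v) \<le> L * nsq (kdim mm) v"
    using kmat_single_bound[OF add.hyps(1,2)] by blast
  have "spn (sprep {#(a, b)#} v) \<le> sqrt L * spn v" for v
    using real_sqrt_le_mono[OF L(2)] by (simp add: spn_def sprep_def real_sqrt_mult)
  then have "spn (sprep ({#(a, b)#} + s) v) \<le> (sqrt L + K) * spn v" if "v \<in> spV" for v
    using sprep_add[of "{#(a, b)#}" s v] K(2)[OF that] by (simp add: distrib_right) (smt (verit))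
  then show ?case using K(1) L(1) by (intro exI[of _ "sqrt L + K"]) auto
qed

lemma sprep_star:
  assumes s: "s \<in> fs"
  shows "(spn (sprep s v))\<^sup>2 \<le> spn (sprep (fmul AA BB (fstar AA BB s) s) v) * spn v"
proof -
  obtain mm w where v: "v = (mm, w)" by (cases v)
  let ?d = "kdim mm"
  have k: "kmat mm (fmul AA BB (fstar AA BB s) s) = (\<lambda>i j. \<Sum>k<?d. cnj (kmat mm s k i) * kmat mm s k j)"
    using s by (simp add: fun_eq_iff kmat_fmul kmat_fstar)
  have "(spn (sprep s v))\<^sup>2 = cmod (complex_of_real (nsq ?d (app ?d (kmat mm s) w)))"
    by (simp add: spn_def sprep_def v)
  also have "\<dots> \<le> sqrt (nsq ?d (app ?d (kmat mm (fmul AA BB (fstar AA BB s) s)) w)) * sqrt (nsq ?d w)"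
    unfolding nsq_app_adjoint k by (rule cvec_Cauchy_Schwarz)
  finally show ?thesis by (simp add: spn_def sprep_def v)
qed

lemma app_app: "app d a (app d b v) = app d (\<lambda>i j. \<Sum>k<d. a i k * b k j) v"
proof
  fix i
  have "app d (\<lambda>i j. \<Sum>k<d. a i k * b k j) v i = (\<Sum>j<d. \<Sum>k<d. a i k * (b k j * v j))"
    by (simp add: app_def sum_distrib_right mult.assoc)
  also have "\<dots> = (\<Sum>k<d. \<Sum>j<d. a i k * (b k j * v j))" by (rule sum.swap)
  finally show "app d a (app d b v) i = app d (\<lambda>i j. \<Sum>k<d. a i k * b k j) v i"
    by (simp add: app_def sum_distrib_left)
qed

definition "spatial = rep_norm spV spn sprep"

lemma spatial_seminorm: "cstar_seminorm spatial"
  unfolding spatial_def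
proof (rule cstar_seminorm_rep_norm)
  show "spn (sprep (fsmul AA c s) v) = cmod c * spn (sprep s v)" if "s \<in> fs" for c s v
  proof -
    have "app d (kmat mm (fsmul AA c s)) w = (\<lambda>i. c * app d (kmat mm s) w i)" for d mm w
      using that by (simp add: app_def fun_eq_iff kmat_fsmul sum_distrib_left mult.assoc)
    then show ?thesis by (simp add: spn_def sprep_def nsq_scale real_sqrt_mult)
  qed
  show "spn (sprep (fmul AA BB s r) v) = spn (sprep s (sprep r v))" if "s \<in> fs" "r \<in> fs" for s r v
  proof -
    have "kmat mm (fmul AA BB s r) = (\<lambda>i j. \<Sum>k<kdim mm. kmat mm s i k * kmat mm r k j)" for mm
      using kmat_fmul[OF that] by (simp add: fun_eq_iff)
    then show ?thesis by (simp add: sprep_def app_app)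
  qed
  show "spn (sprep s v) = spn (sprep r v)" if "eqv s r" for s r v
    using kmat_eqv[OF that] by (simp add: sprep_def)
  show "0 \<le> spn v" for v by (simp add: spn_def)
  show "sprep s v \<in> spV" if "v \<in> spV" for s v using that by (auto simp: spV_def sprep_def)
qed (rule sprep_bounded sprep_add sprep_star; assumption)+

text \<open>If the spatial seminorm vanishes, so do all entries of all matrices \<open>kmat\<close>, and the entries of
the two factors are separating families of functionals.\<close>

lemma spatial_faithful:
  assumes s: "s \<in> fs" and z: "spatial s = 0"
  shows "eqv s {#}"
proof (rule zero_of_coefficients[where \<phi> = "\<lambda>a (m, i, j). ea a m i j" and \<psi> = "\<lambda>b (m, i, j). eb b m i j"])
  have k0: "kmat (m, m') s p q = 0" if m: "m \<in> \<alpha>" "m' \<in> \<beta>" and pq: "p < N m * N m'" "q < N m * N m'" for m m' p q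
  proof -
    let ?v = "((m, m'), \<lambda>j. if j = q then 1 else 0 :: complex)"
    have v: "?v \<in> spV" using m by (simp add: spV_def)
    have "spn (sprep s ?v) \<le> spatial s * spn ?v"
      unfolding spatial_def by (rule rep_norm_bound[where V = spV and n = spn and \<pi> = sprep, OF sprep_bounded[OF s] v]) (simp add: spn_def)
    then have *: "nsq (kdim (m, m')) (app (kdim (m, m')) (kmat (m, m') s) (snd ?v)) \<le> 0"
      using z by (simp add: spn_def sprep_def)
    have "nsq (kdim (m, m')) (\<lambda>p. kmat (m, m') s p q) \<le> 0"
    proof -
      have "app (kdim (m, m')) (kmat (m, m') s) (snd ?v) = (\<lambda>p. kmat (m, m') s p q)"
        using pq by (simp add: app_def fun_eq_iff kdim_def if_distrib[of "\<lambda>z. _ * z"] cong: if_cong)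
      then show ?thesis using *  by simp
    qed
    moreover have "(cmod (kmat (m, m') s p q))\<^sup>2 \<le> nsq (kdim (m, m')) (\<lambda>p. kmat (m, m') s p q)"
      unfolding nsq_def using pq by (intro member_le_sum) (auto simp: kdim_def)
    ultimately have "(cmod (kmat (m, m') s p q))\<^sup>2 \<le> 0" by linarith
    then show ?thesis by simp
  qed
  fix x y :: "nat \<times> nat \<times> nat"
  obtain m i j where x: "x = (m, i, j)" by (cases x)
  obtain m' i' j' where y: "y = (m', i', j')" by (cases y)
  show "(\<Sum>(a, b)\<in>#s. (case x of (m, i, j) \<Rightarrow> ea a m i j) * (case y of (m, i, j) \<Rightarrow> eb b m i j)) = 0"
  proof (cases "m \<in> \<alpha> \<and> i < N m \<and> j < N m \<and> m' \<in> \<beta> \<and> i' < N m' \<and> j' < N m'")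
    case True
    have lt: "i * N m' + i' < N m * N m'" if "i < N m" "i' < N m'" for i i'
    proof -
      have "i * N m' + i' < Suc i * N m'" using that by simp
      also have "\<dots> \<le> N m * N m'" using that by (intro mult_le_mono1) simp
      finally show ?thesis .
    qed
    have "kmat (m, m') s (i * N m' + i') (j * N m' + j') = 0" using True by (intro k0 lt) auto
    then show ?thesis using True by (simp add: kmat_def x y)
  next
    case False
    then have z: "ea a m i j * eb b m' i' j' = 0" for a b by (auto simp: ea_def eb_def ent_iota)
    have "(\<Sum>(a, b)\<in>#r. ea a m i j * eb b m' i' j') = 0" for r
      by (induction r) (simp_all add: z split: prod.split)
    then show ?thesis by (simp add: x y)
  qed
next
  fix a assume a: "a \<in> carrier AA" "\<And>x. (case x of (m, i, j) \<Rightarrow> ea a m i j) = 0"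
  have "iota \<alpha> a = iota \<alpha> \<zero>\<^bsub>AA\<^esub>"
    using a(2)[of "(_, _, _)"] a(1) by (intro fam_eqI) (simp add: ea_def iota_ops del: BS_simps)
  then show "a = \<zero>\<^bsub>AA\<^esub>" using inj_onD[OF iota_inj _ a(1) A.zero_closed] by blast
next
  fix b b' assume b: "b \<in> carrier BB" "b' \<in> carrier BB"
    "\<And>y. (case y of (m, i, j) \<Rightarrow> eb b m i j) = (case y of (m, i, j) \<Rightarrow> eb b' m i j)"
  have "iota \<beta> b = iota \<beta> b'"
    using b(3)[of "(_, _, _)"] by (intro fam_eqI) (simp add: eb_def)
  then show "b = b'" using inj_onD[OF iota_inj] b by auto
qed (use s in \<open>auto simp: ea_ops eb_ops simp del: BS_simps conj_alg_simps\<close>)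

end

section \<open>The GNS seminorm of the coupled traces\<close>

text \<open>The ultrafilters exist because \<open>\<alpha>\<close> and \<open>\<beta>\<close> are infinite.\<close>

locale coupled_traces = unitary_tuples N n u + two_sums N \<alpha> \<beta>
  for N n u \<alpha> \<beta> +
  fixes Ua Ub :: "nat filter"
  assumes Ua: "ultra Ua" "Ua \<le> sequentially" "eventually (\<lambda>m. m \<in> \<alpha>) Ua"
    and Ub: "ultra Ub" "Ub \<le> sequentially" "eventually (\<lambda>m. m \<in> \<beta>) Ub"
begin

sublocale tp: tracial_pair fscl fadj M "utr Ua" "utr Ub" W unit
  by (rule tracial_pair_utr[OF Ua(1,2) Ub(1,2)])

text \<open>The functional induced by the coupling. The conjugate algebra in the second factor matches the
conjugate linearity of \<open>pair\<close> in its second argument.\<close>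

definition F :: "((nat \<Rightarrow> complex mat) \<times> (nat \<Rightarrow> complex mat)) multiset \<Rightarrow> complex" where
  "F s = (\<Sum>(a, b)\<in>#s. tp.pair (iota \<alpha> a) (iota \<beta> b))"

lemma F_simps [simp]: "F {#} = 0" "F (s + r) = F s + F r" "F {#(a, b)#} = tp.pair (iota \<alpha> a) (iota \<beta> b)"
  by (simp_all add: F_def)

lemma BB_ops:
  assumes "b \<in> carrier BB"
  shows "b' \<in> carrier BB \<Longrightarrow> iota \<beta> (b \<oplus>\<^bsub>BB\<^esub> b') = iota \<beta> b + iota \<beta> b'"
    "b' \<in> carrier BB \<Longrightarrow> iota \<beta> (b \<otimes>\<^bsub>BB\<^esub> b') = iota \<beta> b * iota \<beta> b'"
    "iota \<beta> (z \<odot>\<^bsub>BB\<^esub> b) = fscl (cnj z) (iota \<beta> b)"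
    "iota \<beta> (star BB b) = fadj (iota \<beta> b)"
  using assms by (simp_all add: iota_ops del: BS_simps)

lemma F_eqv: "eqv s r \<Longrightarrow> F s = F r"
  unfolding F_def
proof (rule balanced_sum_eqv)
  fix b assume "b \<in> carrier BB"
  then show "tp.pair (iota \<alpha> \<zero>\<^bsub>AA\<^esub>) (iota \<beta> b) = 0"
    by (simp add: iota_zero tp.pair_zero_left)
qed (simp_all add: iota_ops BB_ops tp.pair_add_left tp.pair_add_right tp.pair_scl_left tp.pair_scl_right
       del: BS_simps conj_alg_simps(2-))

lemma F_fsmul: "s \<in> fs \<Longrightarrow> F (fsmul AA c s) = c * F s"
  by (induction rule: fs_induct)
    (simp_all only: fsmul_simps F_simps, simp_all add: iota_ops tp.pair_scl_left distrib_left del: BS_simps)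

lemma F_fstar: "s \<in> fs \<Longrightarrow> F (fstar AA BB s) = cnj (F s)"
  by (induction rule: fs_induct)
    (simp_all only: fstar_simps F_simps, simp_all add: iota_ops BB_ops tp.pair_adj del: BS_simps conj_alg_simps(2-))

text \<open>The components of a formal sum as sequences, continued by zero, to which \<open>gram\<close> applies.\<close>

definition pa :: "((nat \<Rightarrow> complex mat) \<times> (nat \<Rightarrow> complex mat)) list \<Rightarrow> nat \<Rightarrow> fam" where
  "pa xs j = (if j < length xs then iota \<alpha> (fst (xs ! j)) else 0)"

definition pb :: "((nat \<Rightarrow> complex mat) \<times> (nat \<Rightarrow> complex mat)) list \<Rightarrow> nat \<Rightarrow> fam" where
  "pb xs j = (if j < length xs then iota \<beta> (snd (xs ! j)) else 0)"

lemma fs_nth: "mset xs \<in> fs \<Longrightarrow> j < length xs \<Longrightarrow> fst (xs ! j) \<in> carrier AA \<and> snd (xs ! j) \<in> carrier BB"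
  unfolding formal_sums_def using nth_mem[of j xs] by (auto simp: mem_Times_iff subset_eq)

lemma pa_M: "mset xs \<in> fs \<Longrightarrow> pa xs j \<in> M" and pb_M: "mset xs \<in> fs \<Longrightarrow> pb xs j \<in> M"
  using fs_nth[of xs j] by (auto simp: pa_def pb_def)

lemma sum_mset_nth:
  fixes g :: "'p \<Rightarrow> complex"
  shows "(\<Sum>x\<in>#mset xs. g x) = (\<Sum>j<length xs. g (xs ! j))"
  by (simp add: sum_mset_sum_list mset_map[symmetric] sum_list_sum_nth lessThan_atLeast0 del: mset_map)

lemma F_gram:
  assumes "mset xs \<in> fs"
  shows "Re (F (fmul AA BB (fstar AA BB (mset xs)) (mset xs))) = tp.gram (length xs) (pa xs) (pb xs)"
proof -
  have "F (fmul AA BB (fstar AA BB (mset xs)) (mset xs))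
     = (\<Sum>j<length xs. \<Sum>l<length xs. tp.pair (iota \<alpha> (star AA (fst (xs ! j)) \<otimes>\<^bsub>AA\<^esub> fst (xs ! l)))
          (iota \<beta> (star BB (snd (xs ! j)) \<otimes>\<^bsub>BB\<^esub> snd (xs ! l))))"
    unfolding F_def fmul_sum fstar_def
    by (simp add: image_mset.compositionality comp_def case_prod_unfold sum_mset_nth del: BS_simps conj_alg_simps)
  also have "\<dots> = (\<Sum>j<length xs. \<Sum>l<length xs. tp.pair (fadj (pa xs j) * pa xs l) (fadj (pb xs j) * pb xs l))"
    using fs_nth[OF assms]
    by (intro sum.cong HOL.refl) (simp add: pa_def pb_def iota_ops BB_ops del: BS_simps conj_alg_simps)
  finally show ?thesis by (simp add: tp.gram_def)
qed

definition gcomb where "gcomb s z r = s + fsmul AA z r"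

text \<open>The GNS form \<open>\<langle>s, r\<rangle> = F(r\<^sup>* s)\<close>.\<close>

definition gform where "gform s r = F (fmul AA BB (fstar AA BB r) s)"

sublocale gns: pos_form fs gcomb gform
proof
  fix v w x :: "((nat \<Rightarrow> complex mat) \<times> (nat \<Rightarrow> complex mat)) multiset" and z
  assume v: "v \<in> fs" and w: "w \<in> fs"
  show "gcomb v z w \<in> fs" using v w by (simp add: gcomb_def)
  show "gform (gcomb v z w) x = gform v x + z * gform w x" if "x \<in> fs"
    using v w that by (simp add: gform_def gcomb_def fmul_add_right fsmul_fmul_right F_fsmul)
  show "gform w v = cnj (gform v w)"
    using v w F_fstar[of "fmul AA BB (fstar AA BB w) v"] by (simp add: gform_def fstar_fmul fstar_fstar)
next
  fix v assume v: "v \<in> fs"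
  obtain xs where xs: "v = mset xs" using ex_mset by metis
  show "0 \<le> Re (gform v v)"
    unfolding gform_def xs using v F_gram[of xs] tp.gram_nonneg[OF pa_M pb_M] by (simp add: xs)
qed

text \<open>In the positive form of \<open>F\<close>, left multiplication by \<open>a \<otimes> b\<close> multiplies one sequence of components by
\<open>a\<close> and the other by \<open>b\<close>, and \<open>gram\<close> controls the two in turn.\<close>

lemma gns_single_bound:
  assumes a: "a \<in> carrier AA" and b: "b \<in> carrier BB"
  shows "\<exists>K\<ge>0. \<forall>s\<in>fs. gns.nrm (fmul AA BB {#(a, b)#} s) \<le> K * gns.nrm s"
proof -
  have aM: "iota \<alpha> a \<in> M" and bM: "iota \<beta> b \<in> M" using a b by auto
  obtain K where K: "K \<ge> 0" "\<And>y. y \<in> M \<Longrightarrow> tp.n1 (iota \<alpha> a * y) \<le> K * tp.n1 y"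
    using tp.T1.left_bound[OF aM] by blast
  obtain L where L: "L \<ge> 0" "\<And>y. y \<in> M \<Longrightarrow> tp.n2 (iota \<beta> b * y) \<le> L * tp.n2 y"
    using tp.T2.left_bound[OF bM] by blast
  have "gns.nrm (fmul AA BB {#(a, b)#} s) \<le> (K * L) * gns.nrm s" if s: "s \<in> fs" for s
  proof -
    obtain xs where xs: "s = mset xs" using ex_mset by metis
    let ?g = "\<lambda>(a', b'). (a \<otimes>\<^bsub>AA\<^esub> a', b \<otimes>\<^bsub>BB\<^esub> b')"
    let ?ys = "map ?g xs"
    let ?k = "length xs"
    have ys: "fmul AA BB {#(a, b)#} s = mset ?ys" by (simp add: fmul_single_left xs)
    have ysf: "mset ?ys \<in> fs" using fmul_fs[OF _ s, of "{#(a, b)#}"] a b unfolding ys by simp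
    have xsf: "mset xs \<in> fs" using s by (simp add: xs)
    have pys: "pa ?ys j = iota \<alpha> a * pa xs j" "pb ?ys j = iota \<beta> b * pb xs j" for j
      using fs_nth[OF xsf, of j] a b
      by (simp_all add: pa_def pb_def case_prod_unfold iota_ops BB_ops del: BS_simps conj_alg_simps)
    have pM: "\<And>j. pa xs j \<in> M" and qM: "\<And>j. pb xs j \<in> M" using pa_M pb_M xsf by auto
    have bq: "\<And>j. iota \<beta> b * pb xs j \<in> M" using bM qM by simp
    have "(gns.nrm (fmul AA BB {#(a, b)#} s))\<^sup>2 = tp.gram ?k (\<lambda>j. iota \<alpha> a * pa xs j) (\<lambda>j. iota \<beta> b * pb xs j)"
      using F_gram[OF ysf] gns.nrm_sq[OF ysf] unfolding ys gform_def by (simp add: pys[abs_def] del: BS_simps conj_alg_simps)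
    also have "\<dots> \<le> K\<^sup>2 * tp.gram ?k (pa xs) (\<lambda>j. iota \<beta> b * pb xs j)"
      by (rule tp.gram_left[OF aM K pM bq])
    also have "\<dots> \<le> K\<^sup>2 * (L\<^sup>2 * tp.gram ?k (pa xs) (pb xs))"
      by (intro mult_left_mono tp.gram_right[OF bM L pM qM]) simp_all
    also have "\<dots> = (K * L * gns.nrm s)\<^sup>2"
      using F_gram[OF xsf] gns.nrm_sq[OF xsf] by (simp add: xs gform_def power_mult_distrib)
    finally show ?thesis using K(1) L(1) s by (rule_tac power2_le_imp_le) simp_all
  qed
  then show ?thesis using K(1) L(1) by (intro exI[of _ "K * L"]) auto
qed

lemma fsmul_one: "s \<in> fs \<Longrightarrow> fsmul AA 1 s = s"
  by (induction rule: fs_induct) (simp_all only: fsmul_simps A.smult_one)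

lemma gns_add: "s \<in> fs \<Longrightarrow> r \<in> fs \<Longrightarrow> gns.nrm (s + r) \<le> gns.nrm s + gns.nrm r"
  using gns.nrm_comb[of s r 1] by (simp add: gcomb_def fsmul_one)

lemma gns_nrm_empty [simp]: "gns.nrm {#} = 0"
  by (simp add: gns.nrm_def gform_def)

lemma gns_fsmul: "s \<in> fs \<Longrightarrow> gns.nrm (fsmul AA c s) = cmod c * gns.nrm s"
proof -
  assume s: "s \<in> fs"
  have "(gns.nrm (fsmul AA c s))\<^sup>2 = (cmod c * gns.nrm s)\<^sup>2"
    using gns.nrm_comb_sq[of "{#}" s c] s by (simp add: gcomb_def gform_def power_mult_distrib)
  then show ?thesis using s by (simp add: power2_eq_iff_nonneg)
qed

lemma gns_bounded: "s \<in> fs \<Longrightarrow> \<exists>K\<ge>0. \<forall>v\<in>fs. gns.nrm (fmul AA BB s v) \<le> K * gns.nrm v"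
proof (induction rule: fs_induct)
  case empty
  then show ?case by (intro exI[of _ 0]) auto
next
  case (add a b s)
  obtain K where K: "K \<ge> 0" "\<And>v. v \<in> fs \<Longrightarrow> gns.nrm (fmul AA BB s v) \<le> K * gns.nrm v" using add.IH by blast
  obtain L where L: "L \<ge> 0" "\<And>v. v \<in> fs \<Longrightarrow> gns.nrm (fmul AA BB {#(a, b)#} v) \<le> L * gns.nrm v"
    using gns_single_bound[OF add.hyps(1,2)] by blast
  have "gns.nrm (fmul AA BB ({#(a, b)#} + s) v) \<le> (L + K) * gns.nrm v" if v: "v \<in> fs" for v
  proof -
    have "{#(a, b)#} \<in> fs" using add.hyps by simp
    then have "gns.nrm (fmul AA BB {#(a, b)#} v + fmul AA BB s v)
        \<le> gns.nrm (fmul AA BB {#(a, b)#} v) + gns.nrm (fmul AA BB s v)"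
      using v add.hyps by (intro gns_add fmul_fs)
    then show ?thesis using K(2)[OF v] L(2)[OF v] unfolding fmul_add_left distrib_right by linarith
  qed
  then show ?case using K(1) L(1) by (intro exI[of _ "L + K"]) auto
qed

definition "gns_norm = rep_norm fs gns.nrm (fmul AA BB)"

lemma gns_seminorm: "cstar_seminorm gns_norm"
  unfolding gns_norm_def
proof (rule cstar_seminorm_rep_norm)
  show "gns.nrm (fmul AA BB s v) = gns.nrm (fmul AA BB r v)" if "eqv s r" "v \<in> fs" for s r v
  proof -
    have e: "eqv (fmul AA BB s v) (fmul AA BB r v)" using that by (intro fmul_cong_left)
    have "eqv (fmul AA BB (fstar AA BB (fmul AA BB s v)) (fmul AA BB s v))
      (fmul AA BB (fstar AA BB (fmul AA BB r v)) (fmul AA BB r v))" by (rule fmul_cong[OF fstar_cong[OF e] e])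
    then show ?thesis using F_eqv by (simp add: gns.nrm_def gform_def)
  qed
  show "gns.nrm (fmul AA BB (s + r) v) \<le> gns.nrm (fmul AA BB s v) + gns.nrm (fmul AA BB r v)"
    if "s \<in> fs" "r \<in> fs" "v \<in> fs" for s r v
    unfolding fmul_add_left using that by (intro gns_add fmul_fs)
  show "gns.nrm (fmul AA BB (fsmul AA c s) v) = cmod c * gns.nrm (fmul AA BB s v)"
    if "s \<in> fs" "v \<in> fs" for c s v
    using that by (simp add: fsmul_fmul_left gns_fsmul)
  show "gns.nrm (fmul AA BB (fmul AA BB s r) v) = gns.nrm (fmul AA BB s (fmul AA BB r v))"
    if "s \<in> fs" "r \<in> fs" "v \<in> fs" for s r v
    using that by (simp add: fmul_assoc)
  show "(gns.nrm (fmul AA BB s v))\<^sup>2 \<le> gns.nrm (fmul AA BB (fmul AA BB (fstar AA BB s) s) v) * gns.nrm v"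
    if s: "s \<in> fs" and v: "v \<in> fs" for s v
  proof -
    have "gform (fmul AA BB s v) (fmul AA BB s v) = gform (fmul AA BB (fmul AA BB (fstar AA BB s) s) v) v"
      using s v by (simp add: gform_def fstar_fmul fmul_assoc)
    then have "(gns.nrm (fmul AA BB s v))\<^sup>2 = Re (gform (fmul AA BB (fmul AA BB (fstar AA BB s) s) v) v)"
      using s v by (simp add: gns.nrm_sq)
    also have "\<dots> \<le> cmod (gform (fmul AA BB (fmul AA BB (fstar AA BB s) s) v) v)" by (rule complex_Re_le_cmod)
    also have "\<dots> \<le> gns.nrm (fmul AA BB (fmul AA BB (fstar AA BB s) s) v) * gns.nrm v"
      using s v by (intro gns.Cauchy_Schwarz fmul_fs fstar_fs)
    finally show ?thesis .
  qed
qed (use gns_bounded in auto)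

definition ua :: "nat \<Rightarrow> nat \<Rightarrow> complex mat" where "ua i = (\<lambda>m\<in>\<alpha>. u i m)"
definition ub :: "nat \<Rightarrow> nat \<Rightarrow> complex mat" where "ub i = (\<lambda>m\<in>\<beta>. u i m)"
definition ts where "ts = (\<Sum>i\<in>{1..n}. {#(ua i, ub i)#})"

lemma restrict_unitary:
  assumes y: "\<And>m. m \<in> I \<Longrightarrow> unitary (matrix_alg (N m)) (y m)"
  shows "(\<lambda>m\<in>I. y m) \<in> carrier (BS I)" "unitary (BS I) (\<lambda>m\<in>I. y m)"
proof -
  have c: "\<And>m. m \<in> I \<Longrightarrow> y m \<in> carrier_mat (N m) (N m)" using unitary_matD(1)[OF y] .
  show 1: "(\<lambda>m\<in>I. y m) \<in> carrier (BS I)"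
    using iota_unitary(2)[OF y] c
    by (intro iffD2[OF BS_carrier] conjI ballI restrict_extensional) (simp_all add: iota_restrict)
  have "(\<lambda>m\<in>I. mat_adjoint (y m) * y m) = (\<lambda>m\<in>I. 1\<^sub>m (N m))"
    "(\<lambda>m\<in>I. y m * mat_adjoint (y m)) = (\<lambda>m\<in>I. 1\<^sub>m (N m))"
    using unitary_matD(2,3)[OF y] by (auto simp: restrict_def)
  moreover have "star (BS I) (\<lambda>m\<in>I. y m) \<otimes>\<^bsub>BS I\<^esub> (\<lambda>m\<in>I. y m) = (\<lambda>m\<in>I. mat_adjoint (y m) * y m)"
    "(\<lambda>m\<in>I. y m) \<otimes>\<^bsub>BS I\<^esub> star (BS I) (\<lambda>m\<in>I. y m) = (\<lambda>m\<in>I. y m * mat_adjoint (y m))"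
    by (auto simp: restrict_def)
  ultimately show "unitary (BS I) (\<lambda>m\<in>I. y m)" unfolding unitary_def using 1 by simp
qed

lemma ua_carrier: "i \<in> {1..n} \<Longrightarrow> ua i \<in> carrier AA"
  unfolding ua_def using u_unitary by (rule restrict_unitary(1))

lemma ub_carrier: "i \<in> {1..n} \<Longrightarrow> ub i \<in> carrier BB"
  unfolding ub_def conj_alg_simps using u_unitary by (rule restrict_unitary(1))

lemma ua_unitary: "i \<in> {1..n} \<Longrightarrow> unitary AA (ua i)"
  unfolding ua_def using u_unitary by (rule restrict_unitary(2))

lemma ub_unitary: "i \<in> {1..n} \<Longrightarrow> unitary BB (ub i)"
proof -
  assume i: "i \<in> {1..n}"
  have "unitary (BS \<beta>) (ub i)" unfolding ub_def using u_unitary[OF i] by (rule restrict_unitary(2))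
  then show ?thesis by (simp add: unitary_def)
qed

lemma ts_fs: "ts \<in> fs"
  using TA_finsum[of "{1..n}" "\<lambda>i. {#(ua i, ub i)#}"] ua_carrier ub_carrier by (auto simp: ts_def)

lemma cls_ts: "(\<Oplus>\<^bsub>TA\<^esub> i\<in>{1..n}. pure_tensor AA BB (ua i) (ub i)) = cls ts"
  unfolding pure_tensor_def
  using TA_finsum[of "{1..n}" "\<lambda>i. {#(ua i, ub i)#}"] ua_carrier ub_carrier by (auto simp: ts_def)

lemma gen_unitary': "i \<in> {1..n} \<Longrightarrow> gen i * fadj (gen i) = unit"
proof -
  assume i: "i \<in> {1..n}"
  have c: "u i m \<in> carrier_mat (N m) (N m)" for m using unitary_matD(1)[OF u_unitary[OF i]] .
  have "gen i * fadj (gen i) = iota UNIV (\<lambda>m. u i m * mat_adjoint (u i m))"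
    using c iota_star[of UNIV "u i"] iota_mult[of UNIV "u i" "\<lambda>m. mat_adjoint (u i m)"]
    by (simp add: gen_def iota_restrict mat_adjoint_carrier)
  then show ?thesis using unitary_matD(3)[OF u_unitary[OF i]] by (simp add: unit_def)
qed

lemma sum_mset_singletons:
  fixes G :: "'p \<Rightarrow> complex"
  shows "(\<Sum>x\<in>#(\<Sum>i\<in>I. {#h i#}). G x) = (\<Sum>i\<in>I. G (h i))"
  by (induction I rule: infinite_finite_induct) auto

text \<open>On the set where the first ultrafilter is concentrated, the restricted families coincide with the full
ones, and likewise for the second; so the value is that of the common trace at \<open>z\<^sup>* z\<close> for the unitary
\<open>z = u\<^sub>i\<^sup>* u\<^sub>j\<close> of \<open>W\<close>.\<close>

lemma pair_gen:
  assumes i: "i \<in> {1..n}" and j: "j \<in> {1..n}"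
  shows "tp.pair (fadj (iota \<alpha> (ua i)) * iota \<alpha> (ua j)) (fadj (iota \<beta> (ub i)) * iota \<beta> (ub j)) = 1"
proof -
  let ?z = "fadj (gen i) * gen j"
  have z: "?z \<in> W" using gen_W i j by (intro W_times W_fadj)
  have aM: "iota \<alpha> (ua i) \<in> M" "iota \<alpha> (ua j) \<in> M" using ua_carrier i j by auto
  have bM: "iota \<beta> (ub i) \<in> M" "iota \<beta> (ub j) \<in> M" using ub_carrier i j by auto
  let ?x = "fadj (iota \<alpha> (ua i)) * iota \<alpha> (ua j)" and ?y = "fadj (iota \<beta> (ub i)) * iota \<beta> (ub j)"
  have "tp.pair ?x ?y = tp.pair ?z ?z"
  proof (rule tp.pair_cong)
    have "utr Ua (fadj (?x - ?z) * (?x - ?z)) = 0"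
      using aM W_M[OF z] by (intro utr_null[OF Ua(1,3)])
        (auto simp: ent_mult_supported supported_fadj ent_iota gen_def M_supported ua_def iota_restrict)
    then show "tp.n1 (?x - ?z) = 0" by (simp add: tp.T1.L2.nrm_def)
    have "utr Ub (fadj (?y - ?z) * (?y - ?z)) = 0"
      using bM W_M[OF z] by (intro utr_null[OF Ub(1,3)])
        (auto simp: ent_mult_supported supported_fadj ent_iota gen_def M_supported ub_def iota_restrict)
    then show "tp.n2 (?y - ?z) = 0" by (simp add: tp.T2.L2.nrm_def)
  qed (use aM bM W_M[OF z] in auto)
  also have "\<dots> = utr Ua (fadj ?z * ?z)" by (rule tp.pair_W[OF W_M[OF z] z])
  also have "fadj ?z * ?z = fadj (gen j) * (gen i * fadj (gen i)) * gen j"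
    by (simp add: fadj_mult mult.assoc)
  also have "\<dots> = unit"
    using i j gen_M[OF j] by (simp add: gen_unitary' gen_unitary M_supported supported_fadj del: atLeastAtMost_iff)
  finally show ?thesis using utr_unit[OF Ua(1)] by simp
qed

lemma gns_nrm_ts: "gns.nrm ts = real n"
proof -
  have "F (fmul AA BB (fstar AA BB ts) ts)
     = (\<Sum>i\<in>{1..n}. \<Sum>j\<in>{1..n}. tp.pair (iota \<alpha> (star AA (ua i) \<otimes>\<^bsub>AA\<^esub> ua j)) (iota \<beta> (star BB (ub i) \<otimes>\<^bsub>BB\<^esub> ub j)))"
    unfolding F_def fmul_sum fstar_def ts_def
    by (simp add: image_mset.compositionality comp_def case_prod_unfold sum_mset_singletons del: BS_simps conj_alg_simps)
  also have "\<dots> = (\<Sum>i\<in>{1..n}. \<Sum>j\<in>{1..n}. 1)"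
    using pair_gen ua_carrier ub_carrier
    by (intro sum.cong HOL.refl) (simp add: iota_ops BB_ops del: BS_simps conj_alg_simps atLeastAtMost_iff)
  also have "\<dots> = complex_of_real ((real n)\<^sup>2)" by (simp add: power2_eq_square)
  finally have "(gns.nrm ts)\<^sup>2 = (real n)\<^sup>2" using gns.nrm_sq[OF ts_fs] by (simp add: gform_def)
  then show ?thesis using gns.nrm_nonneg[OF ts_fs] by (simp add: power2_eq_iff_nonneg)
qed

lemma fmul_one: "s \<in> fs \<Longrightarrow> fmul AA BB s {#(\<one>\<^bsub>AA\<^esub>, \<one>\<^bsub>BB\<^esub>)#} = s"
  by (induction rule: fs_induct)
    (simp_all only: fmul_empty_left fmul_add_left,
     simp add: fmul_single_left A.one_right B.one_right del: BS_simps conj_alg_simps)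

lemma gns_nrm_one: "gns.nrm {#(\<one>\<^bsub>AA\<^esub>, \<one>\<^bsub>BB\<^esub>)#} = 1"
proof -
  let ?o = "{#(\<one>\<^bsub>AA\<^esub>, \<one>\<^bsub>BB\<^esub>)#}"
  have o: "?o \<in> fs" using A.one_closed B.one_closed by simp
  have aM: "iota \<alpha> \<one>\<^bsub>AA\<^esub> \<in> M" "iota \<beta> \<one>\<^bsub>BB\<^esub> \<in> M" using A.one_closed B.one_closed by auto
  have "fmul AA BB (fstar AA BB ?o) ?o = fstar AA BB ?o" using o by (intro fmul_one fstar_fs)
  then have "gform ?o ?o = cnj (F ?o)" using F_fstar[OF o] by (simp add: gform_def)
  also have "F ?o = tp.pair unit unit"
    unfolding F_simps
  proof (rule tp.pair_cong)
    have "utr Ua (fadj (iota \<alpha> \<one>\<^bsub>AA\<^esub> - unit) * (iota \<alpha> \<one>\<^bsub>AA\<^esub> - unit)) = 0"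
    proof (rule utr_null[OF Ua(1,3)])
      show "iota \<alpha> \<one>\<^bsub>AA\<^esub> - unit \<in> M" by (rule M_minus[OF aM(1) unit_M])
    qed (simp add: ent_iota unit_def)
    then show "tp.n1 (iota \<alpha> \<one>\<^bsub>AA\<^esub> - unit) = 0" by (simp add: tp.T1.L2.nrm_def)
    have "utr Ub (fadj (iota \<beta> \<one>\<^bsub>BB\<^esub> - unit) * (iota \<beta> \<one>\<^bsub>BB\<^esub> - unit)) = 0"
    proof (rule utr_null[OF Ub(1,3)])
      show "iota \<beta> \<one>\<^bsub>BB\<^esub> - unit \<in> M" by (rule M_minus[OF aM(2) unit_M])
    qed (simp add: ent_iota unit_def)
    then show "tp.n2 (iota \<beta> \<one>\<^bsub>BB\<^esub> - unit) = 0" by (simp add: tp.T2.L2.nrm_def)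
  qed (use aM in auto)
  also have "tp.pair unit unit = 1"
    using tp.pair_W[OF unit_M tp.e_W] utr_unit[OF Ua(1)] by (simp add: M_supported)
  finally have "gform ?o ?o = cnj 1" .
  then have "(gns.nrm ?o)\<^sup>2 = 1\<^sup>2" unfolding gns.nrm_sq[OF o] by (simp only: complex_cnj_one one_complex.sel one_power2)
  then show ?thesis by (rule power2_eq_imp_eq[OF _ gns.nrm_nonneg[OF o] zero_le_one])
qed

text \<open>The unit is a vector of length \<open>1\<close> that \<open>t\<close> maps to a vector of length \<open>n\<close>.\<close>

lemma gns_norm_ts: "real n \<le> gns_norm ts"
proof -
  have o: "{#(\<one>\<^bsub>AA\<^esub>, \<one>\<^bsub>BB\<^esub>)#} \<in> fs" using A.one_closed B.one_closed by simp
  have "gns.nrm (fmul AA BB ts {#(\<one>\<^bsub>AA\<^esub>, \<one>\<^bsub>BB\<^esub>)#}) \<le> gns_norm ts * gns.nrm {#(\<one>\<^bsub>AA\<^esub>, \<one>\<^bsub>BB\<^esub>)#}"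
    unfolding gns_norm_def
    by (rule rep_norm_bound[where V = fs and n = gns.nrm and \<pi> = "fmul AA BB", OF gns_bounded[OF ts_fs] o gns.nrm_nonneg[OF o]])
  then show ?thesis unfolding fmul_one[OF ts_fs] gns_nrm_one gns_nrm_ts by simp
qed

end

section \<open>Matrix entries are bounded by every C*-norm\<close>

context dims
begin

text \<open>The matrix unit \<open>e\<^sub>i\<^sub>j\<close> of the summand with index \<open>m\<close>, extended by zero.\<close>

definition munit :: "nat set \<Rightarrow> nat \<Rightarrow> nat \<Rightarrow> nat \<Rightarrow> nat \<Rightarrow> complex mat" where
  "munit I m i j = (\<lambda>k\<in>I. Matrix.mat (N k) (N k) (\<lambda>(a, b). if k = m \<and> a = i \<and> b = j then 1 else 0))"

context
  fixes I :: "nat set" and m :: nat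
  assumes m: "m \<in> I"
begin

lemma ent_munit: "i < N m \<Longrightarrow> j < N m \<Longrightarrow>
    ent (iota I (munit I m i j)) k a b = (if k = m \<and> a = i \<and> b = j then 1 else 0)"
  unfolding munit_def iota_restrict using m by (auto simp: ent_iota)

lemma munit_mult_left:
  assumes "i < N m" "j < N m"
  shows "ent (iota I (munit I m i j) * x) k a b = (if k = m \<and> a = i then ent x m j b else 0)"
proof -
  have "ent (iota I (munit I m i j) * x) k a b
      = (\<Sum>l<N k. if l = j then (if k = m \<and> a = i then ent x k l b else 0) else 0)"
    unfolding ent_mult_supported[OF supported_iota]
    by (intro sum.cong HOL.refl) (auto simp: ent_munit assms)
  then show ?thesis using assms by auto
qed

lemma munit_mult_right:
  assumes "i < N m" "j < N m" and x: "supported x"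
  shows "ent (x * iota I (munit I m i j)) k a b = (if k = m \<and> b = j then ent x m a i else 0)"
proof -
  have "ent (x * iota I (munit I m i j)) k a b
      = (\<Sum>l<N k. if l = i then (if k = m \<and> b = j then ent x k a l else 0) else 0)"
    unfolding ent_mult_supported[OF x]
    by (intro sum.cong HOL.refl) (auto simp: ent_munit assms)
  then show ?thesis using assms by auto
qed

lemma munit_carrier:
  assumes i: "i < N m" and j: "j < N m"
  shows "munit I m i j \<in> carrier (BS I)"
proof (intro iffD2[OF BS_carrier] conjI ballI)
  show "munit I m i j \<in> extensional I" by (simp add: munit_def)
  show "munit I m i j k \<in> carrier_mat (N k) (N k)" if "k \<in> I" for k using that by (simp add: munit_def)
  have "nsq (N k) (app (N k) (ent (iota I (munit I m i j)) k) v) \<le> 1 * nsq (N k) v" for k v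
  proof -
    have a: "app (N k) (ent (iota I (munit I m i j)) k) v a = (if k = m \<and> a = i then v j else 0)" for a
    proof -
      have "app (N k) (ent (iota I (munit I m i j)) k) v a
          = (\<Sum>l<N k. if l = j then (if k = m \<and> a = i then v l else 0) else 0)"
        unfolding app_def by (intro sum.cong HOL.refl) (auto simp: ent_munit i j)
      then show ?thesis using j by auto
    qed
    have "nsq (N k) (app (N k) (ent (iota I (munit I m i j)) k) v)
        = (\<Sum>a<N k. if a = i then (if k = m then (cmod (v j))\<^sup>2 else 0) else 0)"
      unfolding nsq_def a by (intro sum.cong HOL.refl) auto
    also have "\<dots> \<le> (if k = m then (cmod (v j))\<^sup>2 else 0)" by simp
    also have "\<dots> \<le> nsq (N k) v"
      using j member_le_sum[of j "{..<N m}" "\<lambda>j. (cmod (v j))\<^sup>2"] by (auto simp: nsq_def sum_nonneg)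
    finally show ?thesis by simp
  qed
  then show "iota I (munit I m i j) \<in> M" unfolding M_iff obound_def by (intro conjI exI[of _ 1]) auto
qed

lemma munit_mult:
  assumes "i < N m" "j < N m" "l < N m"
  shows "munit I m i j \<otimes>\<^bsub>BS I\<^esub> munit I m j l = munit I m i l"
proof (rule inj_onD[OF iota_inj])
  have "iota I (munit I m i j \<otimes>\<^bsub>BS I\<^esub> munit I m j l) = iota I (munit I m i j) * iota I (munit I m j l)"
    unfolding BS_simps using munit_carrier[OF assms(1,2)] munit_carrier[OF assms(2,3)] by (intro iota_mult BS_mat)
  then show "iota I (munit I m i j \<otimes>\<^bsub>BS I\<^esub> munit I m j l) = iota I (munit I m i l)"
    using assms by (intro fam_eqI) (simp add: munit_mult_left ent_munit del: BS_simps)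
qed (use assms munit_carrier star_algebra.mult_closed[OF star_algebra_BS] in \<open>auto simp del: BS_simps\<close>)

lemma munit_star:
  assumes "i < N m" "j < N m"
  shows "star (BS I) (munit I m i j) = munit I m j i"
proof (rule inj_onD[OF iota_inj])
  have "iota I (star (BS I) (munit I m i j)) = fadj (iota I (munit I m i j))"
    unfolding BS_simps using munit_carrier[OF assms] by (intro iota_star BS_mat)
  then show "iota I (star (BS I) (munit I m i j)) = iota I (munit I m j i)"
    using assms by (intro fam_eqI) (simp add: ent_munit del: BS_simps)
qed (use assms munit_carrier star_algebra.star_closed[OF star_algebra_BS] in \<open>auto simp del: BS_simps\<close>)

lemma munit_compress:
  assumes i: "i < N m" and j: "j < N m" and a: "a \<in> carrier (BS I)"
  shows "munit I m 0 i \<otimes>\<^bsub>BS I\<^esub> a \<otimes>\<^bsub>BS I\<^esub> munit I m j 0 = ent (iota I a) m i j \<odot>\<^bsub>BS I\<^esub> munit I m 0 0"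
proof (rule inj_onD[OF iota_inj])
  have z: "0 < N m" using i by simp
  interpret star_algebra "BS I" by (rule star_algebra_BS)
  have c: "munit I m 0 i \<in> carrier (BS I)" "munit I m j 0 \<in> carrier (BS I)" "munit I m 0 0 \<in> carrier (BS I)"
    using i j z by (auto intro: munit_carrier)
  have c2: "munit I m 0 i \<otimes>\<^bsub>BS I\<^esub> a \<in> carrier (BS I)" using c a by (intro mult_closed)
  show "munit I m 0 i \<otimes>\<^bsub>BS I\<^esub> a \<otimes>\<^bsub>BS I\<^esub> munit I m j 0 \<in> carrier (BS I)"
    using c2 c(2) by (rule mult_closed)
  show "ent (iota I a) m i j \<odot>\<^bsub>BS I\<^esub> munit I m 0 0 \<in> carrier (BS I)" using c by (intro smult_closed)
  have "iota I (munit I m 0 i \<otimes>\<^bsub>BS I\<^esub> a \<otimes>\<^bsub>BS I\<^esub> munit I m j 0)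
      = iota I (munit I m 0 i \<otimes>\<^bsub>BS I\<^esub> a) * iota I (munit I m j 0)"
    unfolding BS_simps(1)[of _ _ "munit I m j 0"] using c c2 by (intro iota_mult BS_mat)
  also have "iota I (munit I m 0 i \<otimes>\<^bsub>BS I\<^esub> a) = iota I (munit I m 0 i) * iota I a"
    unfolding BS_simps using c a by (intro iota_mult BS_mat)
  finally have 1: "iota I (munit I m 0 i \<otimes>\<^bsub>BS I\<^esub> a \<otimes>\<^bsub>BS I\<^esub> munit I m j 0)
      = iota I (munit I m 0 i) * iota I a * iota I (munit I m j 0)" .
  have 2: "iota I (ent (iota I a) m i j \<odot>\<^bsub>BS I\<^esub> munit I m 0 0) = fscl (ent (iota I a) m i j) (iota I (munit I m 0 0))"
    unfolding BS_simps using c by (intro iota_smult BS_mat)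
  show "iota I (munit I m 0 i \<otimes>\<^bsub>BS I\<^esub> a \<otimes>\<^bsub>BS I\<^esub> munit I m j 0)
      = iota I (ent (iota I a) m i j \<odot>\<^bsub>BS I\<^esub> munit I m 0 0)"
    unfolding 1 2 using i j z
    by (intro fam_eqI) (simp add: munit_mult_right munit_mult_left supported_mult ent_munit)
qed

end
end

context two_sums
begin

text \<open>Multiplying an elementary tensor by matrix units from both sides leaves a scalar multiple of the fixed
projection \<open>e\<^sub>0\<^sub>0 \<otimes> e\<^sub>0\<^sub>0\<close>, and the scalar is the corresponding entry.\<close>

lemma compression_eqv:
  assumes m: "m \<in> \<alpha>" "m' \<in> \<beta>" and ij: "i < N m" "j < N m" "i' < N m'" "j' < N m'" and s: "s \<in> fs"
  shows "eqv (fmul AA BB (fmul AA BB {#(munit \<alpha> m 0 i, munit \<beta> m' 0 i')#} s) {#(munit \<alpha> m j 0, munit \<beta> m' j' 0)#})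
    {#((\<Sum>(a, b)\<in>#s. ea a m i j * eb b m' i' j') \<odot>\<^bsub>AA\<^esub> munit \<alpha> m 0 0, munit \<beta> m' 0 0)#}"
  (is "eqv (fmul AA BB (fmul AA BB ?x s) ?y) {#(_ \<odot>\<^bsub>AA\<^esub> ?e, ?e')#}")
  using s
proof (induction rule: fs_induct)
  have z: "0 < N m" "0 < N m'" using ij by auto
  have e: "?e \<in> carrier AA" "?e' \<in> carrier BB" using m z munit_carrier by auto
  {
    case empty
    have "eqv {#(0 \<odot>\<^bsub>AA\<^esub> ?e, ?e')#} {#}" using e tensor_eq.zero[of ?e' BB AA] by (simp only: A.zero_smult)
    then show ?case by (simp add: tensor_eq.sym del: BS_simps conj_alg_simps)
  next
    case (add a b s)
    let ?z = "\<Sum>(a, b)\<in>#s. ea a m i j * eb b m' i' j'"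
    have b': "b \<in> carrier (BS \<beta>)" using add.hyps by simp
    have "fmul AA BB (fmul AA BB ?x {#(a, b)#}) ?y
        = {#(ea a m i j \<odot>\<^bsub>AA\<^esub> ?e, eb b m' i' j' \<odot>\<^bsub>BB\<^esub> ?e')#}"
      using munit_compress[OF m(1) ij(1,2) add.hyps(1)] munit_compress[OF m(2) ij(3,4) b']
      by (simp add: fmul_single_left ea_def eb_def del: BS_simps)
    moreover have "eqv {#(ea a m i j \<odot>\<^bsub>AA\<^esub> ?e, eb b m' i' j' \<odot>\<^bsub>BB\<^esub> ?e')#}
        {#(eb b m' i' j' \<odot>\<^bsub>AA\<^esub> (ea a m i j \<odot>\<^bsub>AA\<^esub> ?e), ?e')#}"
      using e by (intro smult_left_eqv A.smult_closed)
    ultimately have "eqv (fmul AA BB (fmul AA BB ?x {#(a, b)#}) ?y) {#((ea a m i j * eb b m' i' j') \<odot>\<^bsub>AA\<^esub> ?e, ?e')#}"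
      using e by (simp only: A.smult_smult mult.commute)
    from tensor_eq.plus[OF this add.IH]
    have "eqv (fmul AA BB (fmul AA BB ?x ({#(a, b)#} + s)) ?y)
      ({#((ea a m i j * eb b m' i' j') \<odot>\<^bsub>AA\<^esub> ?e, ?e')#} + {#(?z \<odot>\<^bsub>AA\<^esub> ?e, ?e')#})"
      by (simp only: fmul_add_left fmul_add_right)
    moreover have "eqv ({#((ea a m i j * eb b m' i' j') \<odot>\<^bsub>AA\<^esub> ?e, ?e')#} + {#(?z \<odot>\<^bsub>AA\<^esub> ?e, ?e')#})
      {#((ea a m i j * eb b m' i' j') \<odot>\<^bsub>AA\<^esub> ?e \<oplus>\<^bsub>AA\<^esub> ?z \<odot>\<^bsub>AA\<^esub> ?e, ?e')#}"
      using tensor_eq.sym[OF tensor_eq.add_left[OF A.smult_closed[OF e(1)] A.smult_closed[OF e(1)] e(2)],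
          of "ea a m i j * eb b m' i' j'" ?z] by (simp add: add_mset_commute del: BS_simps conj_alg_simps)
    ultimately have "eqv (fmul AA BB (fmul AA BB ?x ({#(a, b)#} + s)) ?y)
      {#((ea a m i j * eb b m' i' j' + ?z) \<odot>\<^bsub>AA\<^esub> ?e, ?e')#}"
      unfolding A.add_smult[OF e(1)] by (rule tensor_eq.trans)
    then show ?case by (simp del: BS_simps conj_alg_simps)
  }
qed

text \<open>In the compression all factors other than \<open>s\<close> are partial isometries, hence of norm at most \<open>1\<close>, and the
projection \<open>e\<^sub>0\<^sub>0 \<otimes> e\<^sub>0\<^sub>0\<close> is nonzero, hence of norm exactly \<open>1\<close>.\<close>

lemma entry_le_cstar_norm:
  assumes p: "cstar_norm TA p"
    and m: "m \<in> \<alpha>" "m' \<in> \<beta>" and ij: "i < N m" "j < N m" "i' < N m'" "j' < N m'" and s: "s \<in> fs"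
  shows "cmod (\<Sum>(a, b)\<in>#s. ea a m i j * eb b m' i' j') \<le> p (cls s)"
proof -
  let ?E = "\<lambda>i j i' j'. {#(munit \<alpha> m i j, munit \<beta> m' i' j')#}"
  let ?z = "\<Sum>(a, b)\<in>#s. ea a m i j * eb b m' i' j'"
  have z: "0 < N m" "0 < N m'" using ij by auto
  have E_fs: "?E i j i' j' \<in> fs" if "i < N m" "j < N m" "i' < N m'" "j' < N m'" for i j i' j'
    using that m munit_carrier by simp
  have E_star: "fmul AA BB (fstar AA BB (?E i j i' j')) (?E i j i' j') = ?E j j j' j'"
    if "i < N m" "j < N m" "i' < N m'" "j' < N m'" for i j i' j'
    using that m by (simp add: fmul_single_left munit_star munit_mult del: BS_simps)
  have E_le: "p (cls (?E i j i' j')) \<le> 1" if "i < N m" "j < N m" "i' < N m'" "j' < N m'" for i j i' j'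
    by (rule cstar_norm_partial_isometry_le[OF p E_fs[OF that] E_star[OF that] E_star])
      (use that in auto)
  let ?q = "?E 0 0 0 0"
  have q: "?q \<in> fs" using z by (intro E_fs)
  have q1: "p (cls ?q) = 1"
  proof -
    have "\<not> eqv ?q {#}"
    proof
      assume eq: "eqv ?q {#}"
      have "(\<Sum>(a, b)\<in>#?q. ea a m 0 0 * eb b m' 0 0) = (\<Sum>(a, b)\<in>#{#}. ea a m 0 0 * eb b m' 0 0)"
        by (rule balanced_sum_eqv[OF eq])
          (simp_all add: ea_ops eb_ops algebra_simps del: BS_simps conj_alg_simps)
      then show False using m z by (simp add: ea_def eb_def ent_munit)
    qed
    then have "p (cls ?q) \<noteq> 0" using cstar_norm_cls(2)[OF p q] by blast
    then show ?thesis using cstar_norm_projection[OF p q E_star] z by blast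
  qed
  let ?x = "?E 0 i 0 i'" and ?y = "?E j 0 j' 0"
  have x: "?x \<in> fs" and y: "?y \<in> fs" by (rule E_fs; use ij z in simp)+
  note nn = cstar_norm_cls(1)[OF p] and sub = cstar_norm_cls(5)[OF p]
  have "p (cls (fsmul AA ?z ?q)) = cmod ?z * p (cls ?q)" by (rule cstar_norm_cls(3)[OF p q])
  then have "cmod ?z = p (cls (fsmul AA ?z ?q))" using q1 by simp
  also have "cls (fsmul AA ?z ?q) = cls (fmul AA BB (fmul AA BB ?x s) ?y)"
    using eqv_cls[OF compression_eqv[OF m ij s]] by (simp only: fsmul_simps)
  also have "p \<dots> \<le> p (cls (fmul AA BB ?x s)) * p (cls ?y)" using x y s by (intro sub fmul_fs)
  also have "\<dots> \<le> p (cls (fmul AA BB ?x s)) * 1"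
    using x s ij z by (intro mult_left_mono E_le nn fmul_fs)
  also have "\<dots> \<le> p (cls ?x) * p (cls s)" using sub[OF x s] by simp
  also have "\<dots> \<le> 1 * p (cls s)" using nn[OF s] ij z by (intro mult_right_mono E_le)
  finally show ?thesis by simp
qed

end

section \<open>The norms of the tensor of unitaries\<close>

lemma matrix_alg_simps [simp]:
  "carrier (matrix_alg d) = carrier_mat d d" "add (matrix_alg d) x y = x + y" "zero (matrix_alg d) = 0\<^sub>m d d"
  by (simp_all add: matrix_alg_def)

lemma matrix_alg_finsum:
  assumes "finite I" "\<And>i. i \<in> I \<Longrightarrow> g i \<in> carrier_mat d d"
  shows "(\<Oplus>\<^bsub>matrix_alg d\<^esub> i\<in>I. g i) \<in> carrier_mat d d \<and>
    (\<forall>p<d. \<forall>q<d. (\<Oplus>\<^bsub>matrix_alg d\<^esub> i\<in>I. g i) $$ (p, q) = (\<Sum>i\<in>I. g i $$ (p, q)))"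
proof -
  have am: "abelian_monoid (matrix_alg d)"
    by (rule abelian_monoidI) (auto intro: assoc_add_mat comm_add_mat)
  show ?thesis using assms
  proof (induction I)
    case empty
    then show ?case by (simp add: abelian_monoid.finsum_empty[OF am])
  next
    case (insert i I)
    then have c: "(\<Oplus>\<^bsub>matrix_alg d\<^esub> i\<in>I. g i) \<in> carrier_mat d d" by simp
    have "(\<Oplus>\<^bsub>matrix_alg d\<^esub> i\<in>insert i I. g i) = g i + (\<Oplus>\<^bsub>matrix_alg d\<^esub> i\<in>I. g i)"
      using insert by (subst abelian_monoid.finsum_insert[OF am]) auto
    then show ?case using insert carrier_matD[OF c] c by auto
  qed
qed

context coupled_traces
begin

lemma kmat_ts:
  assumes m: "m \<in> \<alpha>" "m' \<in> \<beta>" and pq: "p < N m * N m'" "q < N m * N m'"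
  shows "kmat (m, m') ts p q
    = (\<Oplus>\<^bsub>matrix_alg (N m * N m')\<^esub> i\<in>{1..n}. kronecker (u i m) (map_mat cnj (u i m'))) $$ (p, q)"
proof -
  let ?d = "N m'"
  have c: "u i k \<in> carrier_mat (N k) (N k)" if "i \<in> {1..n}" for i k
    using unitary_matD(1)[OF u_unitary[OF that]] .
  have d: "0 < ?d" using pq by (cases "?d = 0") auto
  have dm: "p div ?d < N m" "q div ?d < N m" "p mod ?d < ?d" "q mod ?d < ?d"
    using pq d by (auto intro: less_mult_imp_div_less)
  have k: "kronecker (u i m) (map_mat cnj (u i m')) $$ (p, q)
      = u i m $$ (p div ?d, q div ?d) * cnj (u i m' $$ (p mod ?d, q mod ?d))" if "i \<in> {1..n}" for i
    using c[OF that, of m] c[OF that, of m'] pq dm by (simp add: kronecker_def)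
  have kc: "kronecker (u i m) (map_mat cnj (u i m')) \<in> carrier_mat (N m * ?d) (N m * ?d)" if "i \<in> {1..n}" for i
    using c[OF that, of m] c[OF that, of m'] by (simp add: kronecker_def)
  have "kmat (m, m') ts p q = (\<Sum>i\<in>{1..n}. ea (ua i) m (p div ?d) (q div ?d) * eb (ub i) m' (p mod ?d) (q mod ?d))"
    by (simp add: kmat_def ts_def sum_mset_singletons)
  also have "\<dots> = (\<Sum>i\<in>{1..n}. u i m $$ (p div ?d, q div ?d) * cnj (u i m' $$ (p mod ?d, q mod ?d)))"
    using m dm by (intro sum.cong HOL.refl) (simp add: ea_def eb_def ua_def ub_def iota_restrict ent_iota)
  also have "\<dots> = (\<Sum>i\<in>{1..n}. kronecker (u i m) (map_mat cnj (u i m')) $$ (p, q))"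
    using k by (intro sum.cong HOL.refl) auto
  finally show ?thesis using matrix_alg_finsum[OF _ kc, of "{1..n}"] pq by simp
qed

lemma spatial_ts_le:
  assumes C: "0 \<le> C" and hyp: "\<And>m m'. m \<in> \<alpha> \<Longrightarrow> m' \<in> \<beta> \<Longrightarrow>
      op_norm (\<Oplus>\<^bsub>matrix_alg (N m * N m')\<^esub> i\<in>{1..n}. kronecker (u i m) (map_mat cnj (u i m'))) \<le> C"
  shows "spatial ts \<le> C"
  unfolding spatial_def
proof (rule rep_norm_least[OF C])
  fix v assume "v \<in> spV"
  then obtain m m' w where v: "v = ((m, m'), w)" and m: "m \<in> \<alpha>" "m' \<in> \<beta>" by (auto simp: spV_def)
  let ?d = "N m * N m'"
  let ?K = "\<Oplus>\<^bsub>matrix_alg ?d\<^esub> i\<in>{1..n}. kronecker (u i m) (map_mat cnj (u i m'))"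
  have c: "u i k \<in> carrier_mat (N k) (N k)" if "i \<in> {1..n}" for i k
    using unitary_matD(1)[OF u_unitary[OF that]] .
  have "kronecker (u i m) (map_mat cnj (u i m')) \<in> carrier_mat ?d ?d" if "i \<in> {1..n}" for i
    using c[OF that, of m] c[OF that, of m'] by (simp add: kronecker_def)
  then have K: "?K \<in> carrier_mat ?d ?d" using matrix_alg_finsum[of "{1..n}"] by simp
  have "nsq ?d (app ?d (kmat (m, m') ts) w) = nsq ?d (app ?d (\<lambda>i j. ?K $$ (i, j)) w)"
    unfolding nsq_def app_def
    by (intro sum.cong HOL.refl arg_cong[where f = "\<lambda>z. (cmod z)\<^sup>2"]) (simp add: kmat_ts[OF m])
  also have "\<dots> \<le> (op_norm ?K)\<^sup>2 * nsq ?d w" by (rule op_norm_bound[OF K])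
  also have "\<dots> \<le> C\<^sup>2 * nsq ?d w"
    using hyp[OF m] op_norm_nonneg[OF K] by (intro mult_right_mono power_mono) auto
  finally have "sqrt (nsq ?d (app ?d (kmat (m, m') ts) w)) \<le> sqrt (C\<^sup>2 * nsq ?d w)" by (rule real_sqrt_le_mono)
  then show "spn (sprep ts v) \<le> C * spn v"
    using C by (simp add: spn_def sprep_def v kdim_def real_sqrt_mult)
qed

lemma cstar_norm_ts_le:
  assumes p: "cstar_norm TA p"
  shows "p (cls ts) \<le> real n"
proof -
  have "(\<Sum>i\<in>I. {#(ua i, ub i)#}) \<in> fs \<and> p (cls (\<Sum>i\<in>I. {#(ua i, ub i)#})) \<le> real (card I)"
    if "finite I" "I \<subseteq> {1..n}" for I
    using that
  proof (induction I)
    case empty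
    show ?case using cstar_norm_cls(2)[OF p fs_simps(1)] by (simp add: tensor_eq.refl)
  next
    case (insert i I)
    have i: "i \<in> {1..n}" using insert by blast
    let ?r = "\<Sum>i\<in>I. {#(ua i, ub i)#}"
    have f: "{#(ua i, ub i)#} \<in> fs" "?r \<in> fs" using insert ua_carrier[OF i] ub_carrier[OF i] by auto
    have "p (cls ({#(ua i, ub i)#} + ?r)) \<le> p (cls {#(ua i, ub i)#}) + p (cls ?r)"
      by (rule cstar_norm_cls(4)[OF p f])
    also have "\<dots> \<le> 1 + real (card I)"
      using cstar_norm_unitary_le[OF p ua_unitary[OF i] ub_unitary[OF i]] insert by (intro add_mono) auto
    finally show ?case using insert f by simp
  qed
  from this[of "{1..n}"] show ?thesis by (simp add: ts_def)
qed

lemma spatial_norm: "cstar_norm TA (lift spatial)"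
  by (rule cstar_norm_lift[OF spatial_seminorm spatial_faithful])

text \<open>The GNS seminorm need not be faithful; its maximum with the spatial norm is a C*-norm that attains the
upper bound \<open>n\<close> at \<open>t\<close>.\<close>

lemma max_norm_ts: "max_tensor_norm AA BB (cls ts) = real n"
proof -
  let ?P = "\<lambda>s. max (spatial s) (gns_norm s)"
  have P: "cstar_seminorm ?P" by (rule cstar_seminorm_max[OF spatial_seminorm gns_seminorm])
  have norm: "cstar_norm TA (lift ?P)"
  proof (rule cstar_norm_lift[OF P])
    fix s assume s: "s \<in> fs" "?P s = 0"
    have "0 \<le> spatial s" using spatial_seminorm s by (auto simp: cstar_seminorm_def)
    then have "spatial s = 0" using s(2) by linarith
    then show "eqv s {#}" by (rule spatial_faithful[OF s(1)])
  qed
  have eq: "lift ?P (cls ts) = real n"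
    using cstar_norm_ts_le[OF norm] lift_cls[OF P ts_fs] gns_norm_ts by linarith
  show ?thesis
    using max_tensor_norm_eq_greatest[OF norm, of "cls ts"] cstar_norm_ts_le unfolding eq by blast
qed

text \<open>If all entries of \<open>t\<close> vanished, \<open>t\<close> would be zero, and its maximal norm would not be \<open>n\<close>. A nonzero
entry bounds all C*-norms of \<open>t\<close> from below at once.\<close>

lemma min_norm_ts_pos:
  assumes n: "n \<ge> 1"
  shows "0 < min_tensor_norm AA BB (cls ts)"
proof -
  have "\<exists>m\<in>\<alpha>. \<exists>m'\<in>\<beta>. \<exists>p<N m * N m'. \<exists>q<N m * N m'. kmat (m, m') ts p q \<noteq> 0"
  proof (rule ccontr)
    assume "\<not> ?thesis"
    then have z: "kmat (m, m') ts p q = 0" if "m \<in> \<alpha>" "m' \<in> \<beta>" "p < N m * N m'" "q < N m * N m'" for m m' p q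
      using that by blast
    have "spatial ts \<le> 0"
      unfolding spatial_def
    proof (rule rep_norm_least)
      fix v assume "v \<in> spV"
      then obtain m m' w where v: "v = ((m, m'), w)" and m: "m \<in> \<alpha>" "m' \<in> \<beta>" by (auto simp: spV_def)
      have "nsq (N m * N m') (app (N m * N m') (kmat (m, m') ts) w) = 0"
        unfolding nsq_def app_def by (intro sum.neutral ballI) (simp add: z[OF m])
      then show "spn (sprep ts v) \<le> 0 * spn v" by (simp add: spn_def sprep_def v kdim_def)
    qed simp
    moreover have "0 \<le> spatial ts" using spatial_seminorm ts_fs by (auto simp: cstar_seminorm_def)
    ultimately have ts0: "eqv ts {#}" using spatial_faithful[OF ts_fs] by simp
    have p0: "p (cls ts) = 0" if "cstar_norm TA p" for p
      using cstar_norm_cls(2)[OF that ts_fs] ts0 by blast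
    have "max_tensor_norm AA BB (cls ts) = lift spatial (cls ts)"
      by (rule max_tensor_norm_eq_greatest[OF spatial_norm]) (simp add: p0 spatial_norm)
    then have "max_tensor_norm AA BB (cls ts) = 0" by (simp only: p0[OF spatial_norm])
    then show False using n max_norm_ts by simp
  qed
  then obtain m m' p q where m: "m \<in> \<alpha>" "m' \<in> \<beta>" and pq: "p < N m * N m'" "q < N m * N m'"
    and nz: "kmat (m, m') ts p q \<noteq> 0" by blast
  have d: "0 < N m'" using pq by (cases "N m' = 0") auto
  have "cmod (kmat (m, m') ts p q) \<le> r (cls ts)" if "cstar_norm TA r" for r
    unfolding kmat_def prod.case
    using pq d by (intro entry_le_cstar_norm[OF that m _ _ _ _ ts_fs]) (auto intro: less_mult_imp_div_less)
  then have "cmod (kmat (m, m') ts p q) \<le> min_tensor_norm AA BB (cls ts)"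
    unfolding min_tensor_norm_def using spatial_norm by (intro cINF_greatest) auto
  then show ?thesis using nz by (smt (verit) zero_less_norm_iff)
qed

lemma min_norm_ts_le:
  assumes "spatial ts \<le> C"
  shows "min_tensor_norm AA BB (cls ts) \<le> C"
proof -
  have "min_tensor_norm AA BB (cls ts) \<le> lift spatial (cls ts)"
    unfolding min_tensor_norm_def
  proof (rule cINF_lower)
    show "bdd_below ((\<lambda>p. p (cls ts)) ` {p. cstar_norm TA p})"
      using cstar_norm_cls(1)[OF _ ts_fs] by (intro bdd_belowI2[of _ 0]) blast
  qed (use spatial_norm in simp)
  then show ?thesis using assms lift_cls[OF spatial_seminorm ts_fs] by simp
qed

end

lemma ultra_on_infinite:
  fixes I :: "nat set"
  assumes "infinite I"
  shows "\<exists>U. ultra U \<and> U \<le> sequentially \<and> eventually (\<lambda>m. m \<in> I) U"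
proof -
  let ?F = "inf sequentially (principal I)"
  have "?F \<noteq> bot"
    using assms unfolding trivial_limit_def eventually_inf_principal eventually_sequentially
    by (auto simp: infinite_nat_iff_unbounded_le)
  then obtain U where U: "U \<le> ?F" "ultra U" using ultra_exists by blast
  have "eventually (\<lambda>m. m \<in> I) ?F" by (simp add: eventually_inf_principal)
  then show ?thesis using U filter_leD[OF U(1)] by (meson inf_le1 order_trans)
qed

theorem theorem5:
  fixes n :: nat and C :: real and N :: "nat \<Rightarrow> nat"
    and u :: "nat \<Rightarrow> nat \<Rightarrow> complex mat" and \<alpha> \<beta> :: "nat set"
  assumes "n \<ge> 1"
    and "\<And>m. N m \<ge> 1"
    and "\<And>i m. i \<in> {1..n} \<Longrightarrow> unitary (matrix_alg (N m)) (u i m)"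
    and "\<And>m m'. m \<noteq> m' \<Longrightarrow>
          op_norm (\<Oplus>\<^bsub>matrix_alg (N m * N m')\<^esub> i\<in>{1..n}. kronecker (u i m) (map_mat cnj (u i m'))) \<le> C"
    and "converges_in_distribution n N u"
    and "\<alpha> \<union> \<beta> = UNIV" and "\<alpha> \<inter> \<beta> = {}" and "infinite \<alpha>" and "infinite \<beta>"
  defines "A \<equiv> bounded_sum \<alpha> (\<lambda>m. matrix_alg (N m))"
    and "B \<equiv> conj_alg (bounded_sum \<beta> (\<lambda>m. matrix_alg (N m)))"
  defines "t \<equiv> (\<Oplus>\<^bsub>tensor_alg A B\<^esub> i\<in>{1..n}. pure_tensor A B (\<lambda>m\<in>\<alpha>. u i m) (\<lambda>m\<in>\<beta>. u i m))"
  shows "min_tensor_norm A B t \<le> C \<and>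
         max_tensor_norm A B t = real n \<and>
         max_tensor_norm A B t / min_tensor_norm A B t \<ge> real n / C"
proof -
  obtain Ua Ub where U: "ultra Ua" "Ua \<le> sequentially" "eventually (\<lambda>m. m \<in> \<alpha>) Ua"
    "ultra Ub" "Ub \<le> sequentially" "eventually (\<lambda>m. m \<in> \<beta>) Ub"
    using ultra_on_infinite assms(8,9) by meson
  interpret coupled_traces N n u \<alpha> \<beta> Ua Ub
    by unfold_locales (fact assms(2,3,5) U)+
  have t: "t = cls ts"
    unfolding t_def A_def B_def using cls_ts unfolding ua_def ub_def .
  have hyp: "op_norm (\<Oplus>\<^bsub>matrix_alg (N m * N m')\<^esub> i\<in>{1..n}. kronecker (u i m) (map_mat cnj (u i m'))) \<le> C"
    if "m \<in> \<alpha>" "m' \<in> \<beta>" for m m'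
    using assms(4)[of m m'] assms(7) that by blast
  have pos: "0 < min_tensor_norm A B t" using min_norm_ts_pos[OF assms(1)] by (simp only: t A_def B_def)
  have C: "0 \<le> C"
  proof -
    obtain m m' where m: "m \<in> \<alpha>" "m' \<in> \<beta>" using infinite_imp_nonempty[OF assms(8)] infinite_imp_nonempty[OF assms(9)] by blast
    have "kronecker (u i m) (map_mat cnj (u i m')) \<in> carrier_mat (N m * N m') (N m * N m')" if "i \<in> {1..n}" for i
      using unitary_matD(1)[OF assms(3)[OF that, of m]] unitary_matD(1)[OF assms(3)[OF that, of m']]
      by (simp add: kronecker_def)
    then have "(\<Oplus>\<^bsub>matrix_alg (N m * N m')\<^esub> i\<in>{1..n}. kronecker (u i m) (map_mat cnj (u i m')))
        \<in> carrier_mat (N m * N m') (N m * N m')" using matrix_alg_finsum[of "{1..n}"] by simp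
    from op_norm_nonneg[OF this] hyp[OF m] show ?thesis by linarith
  qed
  have le: "min_tensor_norm A B t \<le> C"
    using min_norm_ts_le[OF spatial_ts_le[OF C hyp]] by (simp only: t A_def B_def)
  have mx: "max_tensor_norm A B t = real n" using max_norm_ts by (simp only: t A_def B_def)
  have "real n / C \<le> real n / min_tensor_norm A B t"
    using pos le by (intro divide_left_mono) auto
  then show ?thesis using le mx by simp
qed

end
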